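(* Let $\mathcal D_0\subset F_0$ be the set of points of $F_0$ obtained by transforming the critical points of $E_6$ in $\mathbb H$ into $F_0$ via Möbius transformations $\tau\mapsto\frac{a\tau+b}{c\tau+d}$ of elements of $\Gamma_0(2)$. Then there exist three pairwise disjoint smooth curves $\mathcal C_1,\mathcal C_2,\mathcal C_3$ in $F_0$ with endpoints $\partial\mathcal C_1=\{0,1\}$, $\partial\mathcal C_2=\{0,\tfrac14+i\infty\}$, $\partial\mathcal C_3=\{1,\tfrac34+i\infty\}$, such that $$\mathcal D_0\subset\mathcal C_1\cup\mathcal C_2\cup\mathcal C_3=\overline{\mathcal D_0}\cap F_0=\overline{\mathcal D_0}\setminus\{0,1,\infty\}.$$
   Context: $\mathbb H$ is the upper half-plane. $E_6(\tau)=\frac{27}{8\pi^6}g_3(\tau)$ where $g_3(\tau)=140\sum_{(m,n)\ne(0,0)}(m\tau+n)^{-6}$. $\Gamma_0(2)=\{\begin{pmatrix}a&b\\c&d\end{pmatrix}\in SL(2,\mathbb Z): c\equiv0\bmod2\}$, and $F_0=\{\tau\in\mathbb H:0\le\operatorname{Re}\tau\le1,\ |\tau-\frac12|\ge\frac12\}$. A curve having endpoint $a+i\infty$ means that along that end $\operatorname{Im}\tau\to+\infty$ and $\operatorname{Re}\tau\to a$. The closure $\overline{\mathcal D_0}$ is taken in $\mathbb H\cup\mathbb R\cup\{\infty\}$. *)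

theory Defs
  imports "HOL-Analysis.Analysis"
begin

definition upper_half_plane :: "complex set" where
  "upper_half_plane = {\<tau>. Im \<tau> > 0}"

definition g3 :: "complex \<Rightarrow> complex" where
  "g3 \<tau> = 140 * (\<Sum>\<^sub>\<infinity>(m, n)\<in>UNIV - {(0 :: int, 0 :: int)}.
              1 / (of_int m * \<tau> + of_int n) ^ 6)"

definition E6 :: "complex \<Rightarrow> complex" where
  "E6 \<tau> = of_real (27 / (8 * pi ^ 6)) * g3 \<tau>"

definition Gamma0 :: "int \<Rightarrow> (int ^ 2 ^ 2) set" where
  "Gamma0 N = {A. det A = 1 \<and> N dvd A $ 2 $ 1}"

definition moebius_action :: "int ^ 2 ^ 2 \<Rightarrow> complex \<Rightarrow> complex" where
  "moebius_action A = moebius (of_int (A $ 1 $ 1)) (of_int (A $ 1 $ 2))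
                              (of_int (A $ 2 $ 1)) (of_int (A $ 2 $ 2))"

definition F0 :: "complex set" where
  "F0 = {\<tau> \<in> upper_half_plane. 0 \<le> Re \<tau> \<and> Re \<tau> \<le> 1 \<and> cmod (\<tau> - 1 / 2) \<ge> 1 / 2}"

definition E6_critical_points :: "complex set" where
  "E6_critical_points = {\<tau> \<in> upper_half_plane. (E6 has_field_derivative 0) (at \<tau>)}"

definition D0 :: "complex set" where
  "D0 = {moebius_action A \<tau> |A \<tau>. A \<in> Gamma0 2 \<and> \<tau> \<in> E6_critical_points} \<inter> F0"

text \<open>
  The space \<open>\<H> \<union> \<real> \<union> {\<infinity>}\<close>, topologised as a subspace of the Riemann sphere, that is, as the
  one-point compactification of the closed upper half-plane; \<open>None\<close> is the point \<open>\<infinity>\<close>.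
\<close>
definition extended_half_plane :: "complex option topology" where
  "extended_half_plane = Alexandroff_compactification (top_of_set {\<tau>. Im \<tau> \<ge> 0})"

text \<open>Infinite differentiability; meaningful for open parameter sets \<open>S\<close>.\<close>
definition smooth_on_open :: "real set \<Rightarrow> (real \<Rightarrow> complex) \<Rightarrow> bool" where
  "smooth_on_open S \<gamma> \<longleftrightarrow>
     (\<forall>k. ((\<lambda>f t. vector_derivative f (at t)) ^^ k) \<gamma> differentiable_on S)"

text \<open>
  An end of a curve is described by the filter along which the curve approaches it: \<open>nhds a\<close> for
  an endpoint \<open>a \<in> \<complex>\<close>, and the following filter for the endpoint \<open>a + \<i>\<infinity>\<close>.
\<close>
definition at_i_infinity :: "real \<Rightarrow> complex filter" where
  "at_i_infinity a = inf (filtercomap Im at_top) (filtercomap Re (nhds a))"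

text \<open>
  \<open>C\<close> is a smooth simple regular open arc whose two ends tend to \<open>P\<close> and \<open>Q\<close>; the endpoints
  themselves do not belong to \<open>C\<close>. Reversing the parameter shows that the notion is symmetric
  in \<open>P\<close> and \<open>Q\<close>.
\<close>
definition smooth_curve_with_ends ::
    "complex set \<Rightarrow> complex filter \<Rightarrow> complex filter \<Rightarrow> bool" where
  "smooth_curve_with_ends C P Q \<longleftrightarrow>
     (\<exists>\<gamma> :: real \<Rightarrow> complex.
        smooth_on_open {0<..<1} \<gamma> \<and>
        (\<forall>t\<in>{0<..<1}. vector_derivative \<gamma> (at t) \<noteq> 0) \<and>
        inj_on \<gamma> {0<..<1} \<and>
        filterlim \<gamma> P (at_right 0) \<and>
        filterlim \<gamma> Q (at_left 1) \<and>
        C = \<gamma> ` {0<..<1})"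

end

theory Submission
  imports Defs "HOL-Complex_Analysis.Complex_Analysis" "HOL-Real_Asymp.Real_Asymp"
begin

text \<open>
  For \<open>h(\<tau>) = \<tau> + 6 E6(\<tau>) / E6'(\<tau>)\<close> modularity of \<open>E6\<close> gives \<open>h(\<gamma>\<tau>) = \<gamma> h(\<tau>)\<close> for all
  \<open>\<gamma> \<in> SL(2,\<int>)\<close>, so \<open>\<tau>\<close> is equivalent under \<open>\<Gamma>0(2)\<close> to a critical point exactly if \<open>h(\<tau>)\<close> is \<open>\<infinity>\<close> or a
  fraction with even denominator. These are dense in \<open>\<real> \<union> {\<infinity>}\<close>, hence the closure of \<open>D0\<close> is the
  locus in \<open>F0\<close> where \<open>h\<close> is real or \<open>\<infinity>\<close>. The rotation \<open>\<tau> \<mapsto> 1 / (1 - \<tau>)\<close> of order three cuts \<open>F0\<close>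
  into three images of \<open>{0 \<le> Re \<tau> \<le> 1/2, \<bar>\<tau> - 1\<bar> \<ge> 1}\<close>, and the inversion \<open>\<tau> \<mapsto> 1 / cnj \<tau>\<close> reduces
  the study of that region to \<open>{0 \<le> Re \<tau> \<le> 1/2, \<bar>\<tau>\<bar> \<ge> 1}\<close>. There the q-expansion converges so fast
  that \<open>Im h < 0\<close> for \<open>Im \<tau> \<le> 37/40\<close> and \<open>Im h' < 0\<close> on the strip \<open>Im \<tau> \<ge> 37/40\<close>. The latter makes
  \<open>h\<close> injective on the strip and its real locus a curve along which \<open>h\<close> increases; the inverse of
  \<open>h\<close> parametrises the curve by \<open>(0, \<infinity>)\<close>.
\<close>

section \<open>Power series in the nome\<close>

text \<open>All numerical work rests on one term. With q = exp(2 pi \<i> \<tau>) and a =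
  \<open>eis_const\<close>, h = \<tau> + (3 \<i> / pi) (a / q - 1 - Z) with small Z, so Im h is
  close to Im \<tau> + (3 / pi) a exp(2 pi Im \<tau>) cos(2 pi Re \<tau>), and h' is dominated by 6
  a / q. The zero of the cosine at 1/4 is the asymptote of the curve. For 0 < Re \<tau> < 1/2 the
  number a / q lies in the lower half-plane while its real part changes sign, which is why Im h' is
  the quantity to control. Since Im h' tends to 0 at the vertical sides of the strip, errors must be
  bounded by multiples of Im q rather than by constants. The height 37/40 is a compromise: it is low
  enough that points with |\<tau>| >= 1 below it have a clearly negative cosine, and high enough
  that |q| <= 1/320 above it. The rotation of order three lies in SL(2,Z) but not in \<Gamma>0(2).
  It preserves the real locus of h but not \<open>D0\<close>, so density is shown on each of the
  three arcs with a different class of fractions modulo 2.\<close>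

definition pws :: "(nat \<Rightarrow> real) \<Rightarrow> complex \<Rightarrow> complex" where
  "pws c q = (\<Sum>n. of_real (c n) * q ^ n)"

definition disc_summable :: "(nat \<Rightarrow> real) \<Rightarrow> bool" where
  "disc_summable c \<longleftrightarrow> (\<forall>q::complex. norm q < 1 \<longrightarrow> summable (\<lambda>n. of_real (c n) * q ^ n))"

text \<open>The variable q of q-expansions; it is the square of the classical nome exp(pi \<i>
  \<tau>).\<close>

definition nome :: "complex \<Rightarrow> complex" where
  "nome \<tau> = exp (2 * of_real pi * \<i> * \<tau>)"

lemma disc_summable_abs:
  assumes "disc_summable c" "0 \<le> r" "r < 1"
  shows "summable (\<lambda>n. \<bar>c n\<bar> * r ^ n)"
proof -
  obtain s where s: "r < s" "s < 1" using assms dense by blast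
  have "summable (\<lambda>n. of_real (c n) * (of_real s :: complex) ^ n)"
    using assms s by (auto simp: disc_summable_def)
  then have "summable (\<lambda>n. norm (of_real (c n) * (of_real r :: complex) ^ n))"
    by (rule powser_insidea) (use s assms in auto)
  then show ?thesis using assms by (simp add: norm_mult norm_power)
qed

lemma disc_summable_comparison:
  assumes "disc_summable c" "\<And>n. \<bar>d n\<bar> \<le> c n"
  shows "disc_summable d"
  unfolding disc_summable_def
proof (intro allI impI)
  fix q :: complex assume q: "norm q < 1"
  show "summable (\<lambda>n. of_real (d n) * q ^ n)"
  proof (rule summable_comparison_test')
    show "summable (\<lambda>n. \<bar>c n\<bar> * norm q ^ n)" using disc_summable_abs[OF assms(1)] q by simp
    show "norm (of_real (d n) * q ^ n) \<le> \<bar>c n\<bar> * norm q ^ n" for n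
      using assms(2)[of n] by (simp add: norm_mult norm_power mult_right_mono)
  qed
qed

text \<open>The operator q d/dq multiplies the n-th coefficient by n. As d/d\<tau> = 2 pi \<i> q
  d/dq, derivatives in \<tau> remain series of the form \<open>pws\<close>.\<close>

lemma diffs_eq_times_n:
  assumes "disc_summable c" "norm q < 1"
  shows "summable (\<lambda>n. of_real (real n * c n) * q ^ n)"
    and "q * (\<Sum>n. diffs (\<lambda>n. complex_of_real (c n)) n * q ^ n) = pws (\<lambda>n. real n * c n) q"
proof -
  have sm: "summable (\<lambda>n. diffs (\<lambda>n. complex_of_real (c n)) n * q ^ n)"
    by (rule termdiff_converges[where K = 1]) (use assms in \<open>auto simp: disc_summable_def\<close>)
  have eq: "of_real (real (Suc n) * c (Suc n)) * q ^ Suc n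
            = q * (diffs (\<lambda>n. complex_of_real (c n)) n * q ^ n)" for n
    by (simp add: diffs_def algebra_simps)
  have "summable (\<lambda>n. of_real (real (Suc n) * c (Suc n)) * q ^ Suc n)"
    unfolding eq using sm by (rule summable_mult)
  then show 1: "summable (\<lambda>n. of_real (real n * c n) * q ^ n)"
    by (subst (asm) summable_Suc_iff)
  have "pws (\<lambda>n. real n * c n) q = (\<Sum>n. of_real (real (Suc n) * c (Suc n)) * q ^ Suc n)"
    unfolding pws_def using suminf_split_head[OF 1] by simp
  also have "\<dots> = q * (\<Sum>n. diffs (\<lambda>n. complex_of_real (c n)) n * q ^ n)"
    unfolding eq using sm by (rule suminf_mult)
  finally show "q * (\<Sum>n. diffs (\<lambda>n. complex_of_real (c n)) n * q ^ n) = pws (\<lambda>n. real n * c n) q" ..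
qed

lemma disc_summable_times_n: "disc_summable c \<Longrightarrow> disc_summable (\<lambda>n. real n * c n)"
  using diffs_eq_times_n(1) by (auto simp: disc_summable_def)

lemma disc_summable_power: "disc_summable (\<lambda>n. real n ^ p)"
proof (induction p)
  case 0
  then show ?case by (auto simp: disc_summable_def intro!: summable_geometric)
next
  case (Suc p)
  then show ?case using disc_summable_times_n by fastforce
qed

lemma norm_nome: "norm (nome \<tau>) = exp (- (2 * pi * Im \<tau>))"
  by (simp add: nome_def norm_exp_eq_Re)

lemma norm_nome_less_1: "Im \<tau> > 0 \<Longrightarrow> norm (nome \<tau>) < 1"
  by (simp add: norm_nome)

lemma nome_nonzero [simp]: "nome \<tau> \<noteq> 0"
  by (simp add: nome_def)

lemma has_field_derivative_pws_nome:
  assumes "disc_summable c" "Im \<tau> > 0"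
  shows "((\<lambda>\<tau>. pws c (nome \<tau>)) has_field_derivative
           2 * of_real pi * \<i> * pws (\<lambda>n. real n * c n) (nome \<tau>)) (at \<tau>)"
proof -
  have 1: "((\<lambda>q. pws c q) has_field_derivative
          (\<Sum>n. diffs (\<lambda>n. complex_of_real (c n)) n * nome \<tau> ^ n)) (at (nome \<tau>))"
    unfolding pws_def
    by (rule termdiffs_strong'[where K = 1])
      (use assms norm_nome_less_1 in \<open>auto simp: disc_summable_def\<close>)
  have 2: "(nome has_field_derivative nome \<tau> * (2 * of_real pi * \<i>)) (at \<tau>)"
    unfolding nome_def by (auto intro!: derivative_eq_intros)
  from DERIV_chain2[OF 1 2] show ?thesis
    unfolding diffs_eq_times_n(2)[OF assms(1) norm_nome_less_1[OF assms(2)], symmetric]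
    by (simp only: mult_ac)
qed

text \<open>The q-expansion of the cotangent and its derivatives: the reflection formula of
  \<open>Gamma\<close> gives \<open>j = 0\<close>, differentiating both sides gives the induction
  step. The term \<open>of_bool (j = 0) / 2\<close> is the constant 1/2 of the cotangent expansion,
  which the first differentiation removes.\<close>

lemma Polygamma_reflection_nome:
  assumes "Im z > 0"
  shows "Polygamma j z - (-1) ^ j * Polygamma j (1 - z)
         = (2 * of_real pi * \<i>) ^ Suc j * (pws (\<lambda>n. real n ^ j) (nome z) - of_bool (j = 0) / 2)"
  using assms
proof (induction j arbitrary: z)
  case 0
  have nz: "w \<notin> \<int>" "1 - w \<notin> \<int>" if "Im w > 0" for w
    using that by (auto elim!: Ints_cases simp: complex_eq_iff)
  have nz': "w \<notin> \<int>\<^sub>\<le>\<^sub>0" "1 - w \<notin> \<int>\<^sub>\<le>\<^sub>0" if "Im w > 0" for w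
    using nz[OF that] nonpos_Ints_Int by blast+
  have sinnz: "sin (of_real pi * w) \<noteq> 0" if "Im w > 0" for w :: complex
  proof
    assume "sin (of_real pi * w) = 0"
    then obtain n :: int where "of_real pi * w = of_real (of_int n * pi)" 
      by (auto simp: sin_eq_0)
    then have "Im (of_real pi * w) = 0" by (metis Im_complex_of_real)
    then show False using that by simp
  qed
  \<comment> \<open>Since Gamma' = Gamma * Polygamma 0, comparing this derivative of the product
    with that of pi / sin yields the cotangent.\<close>
  have d1: "((\<lambda>w. Gamma w * Gamma (1 - w)) has_field_derivative
        Gamma z * Gamma (1 - z) * (Polygamma 0 z - Polygamma 0 (1 - z))) (at z)"
    using nz'[OF 0] by (auto intro!: derivative_eq_intros simp: algebra_simps)
  have d2: "((\<lambda>w. of_real pi / sin (of_real pi * w)) has_field_derivative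
        - (of_real pi * (cos (of_real pi * z) * of_real pi)) / (sin (of_real pi * z)) ^ 2) (at z)"
    using sinnz[OF 0] by (auto intro!: derivative_eq_intros simp: power2_eq_square divide_simps)
  have ev: "eventually (\<lambda>w. Gamma w * Gamma (1 - w) = of_real pi / sin (of_real pi * w)) (nhds z)"
    by (simp add: Gamma_reflection_complex)
  from d1 have "((\<lambda>w. of_real pi / sin (of_real pi * w)) has_field_derivative
        Gamma z * Gamma (1 - z) * (Polygamma 0 z - Polygamma 0 (1 - z))) (at z)"
    by (subst (asm) DERIV_cong_ev[OF refl ev refl])
  from DERIV_unique[OF this d2]
  have "Polygamma 0 z - Polygamma 0 (1 - z)
     = - of_real pi * (cos (of_real pi * z) / sin (of_real pi * z))"
  proof -
    have alg: "A = - p * (c / s)"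
      if "p / s * A = - (p * (c * p)) / s ^ 2" "p \<noteq> 0" "s \<noteq> 0" for p s c A :: complex
    proof -
      have "A = s / p * (p / s * A)" using that(2,3) by simp
      also have "\<dots> = - p * (c / s)"
        unfolding that(1) using that(2,3) by (simp add: power2_eq_square)
      finally show ?thesis .
    qed
    show ?thesis
      using \<open>Gamma z * Gamma (1 - z) * _ = _\<close> sinnz[OF 0]
      unfolding Gamma_reflection_complex by (intro alg) auto
  qed
  also have "\<dots> = 2 * of_real pi * \<i> * (1 / (1 - nome z) - 1 / 2)"
  proof -
    define e where "e = exp (\<i> * of_real pi * z)"
    have e: "e \<noteq> 0" "nome z = e ^ 2" "exp (- (\<i> * of_real pi * z)) = 1 / e"
      by (auto simp: e_def nome_def exp_minus field_simps power2_eq_square simp flip: exp_add)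
    have n1: "nome z \<noteq> 1" using norm_nome_less_1[OF 0] by auto
    have s: "sin (of_real pi * z) = (e - 1 / e) / (2 * \<i>)" 
      using e by (simp add: sin_exp_eq e_def mult_ac)
    have c: "cos (of_real pi * z) = (e + 1 / e) / 2" 
      using e by (simp add: cos_exp_eq e_def mult_ac)
    have "e ^ 2 \<noteq> 1" using n1 e by simp
    then show ?thesis unfolding s c e(2) using e(1)
      by (simp add: divide_simps power2_eq_square) (simp add: algebra_simps)
  qed
  \<comment> \<open>The geometric series; its term n = 0 counts because 0 ^ 0 = 1.\<close>
  also have "1 / (1 - nome z) = pws (\<lambda>n. real n ^ 0) (nome z)"
    using suminf_geometric[OF norm_nome_less_1[OF 0]] by (simp add: pws_def)
  finally show ?case by simp
next
  case (Suc j)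
  have nz': "w \<notin> \<int>\<^sub>\<le>\<^sub>0" "1 - w \<notin> \<int>\<^sub>\<le>\<^sub>0" if "Im w > 0" for w
    using that by (auto elim!: nonpos_Ints_cases simp: complex_eq_iff)
  have d1: "((\<lambda>w. Polygamma j w - (-1) ^ j * Polygamma j (1 - w)) has_field_derivative
      Polygamma (Suc j) z - (-1) ^ Suc j * Polygamma (Suc j) (1 - z)) (at z)"
    using nz'[OF Suc.prems] by (auto intro!: derivative_eq_intros)
  have d2: "((\<lambda>w. (2 * of_real pi * \<i>) ^ Suc j * (pws (\<lambda>n. real n ^ j) (nome w) - of_bool (j = 0) / 2))
      has_field_derivative (2 * of_real pi * \<i>) ^ Suc j *
        (2 * of_real pi * \<i> * pws (\<lambda>n. real n ^ Suc j) (nome z))) (at z)"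
    using has_field_derivative_pws_nome[OF disc_summable_power[of j] Suc.prems]
    by (auto intro!: derivative_eq_intros)
  have "open {w::complex. Im w > 0}" by (simp add: open_halfspace_Im_gt)
  then have ev: "eventually (\<lambda>w. Im w > 0) (nhds z)"
    using Suc.prems eventually_nhds_in_open by fastforce
  have evP: "eventually (\<lambda>w. Polygamma j w - (-1) ^ j * Polygamma j (1 - w) =
     (2 * of_real pi * \<i>) ^ Suc j * (pws (\<lambda>n. real n ^ j) (nome w) - of_bool (j = 0) / 2)) (nhds z)"
    using ev by (rule eventually_mono) (rule Suc.IH)
  from d1 have "((\<lambda>w. (2 * of_real pi * \<i>) ^ Suc j * (pws (\<lambda>n. real n ^ j) (nome w) - of_bool (j = 0) / 2))
      has_field_derivative Polygamma (Suc j) z - (-1) ^ Suc j * Polygamma (Suc j) (1 - z)) (at z)"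
    by (subst (asm) DERIV_cong_ev[OF refl evP refl])
  from DERIV_unique[OF this d2] show ?case by (simp add: mult_ac)
qed

section \<open>The q-expansion and the modularity of E6\<close>

definition sigma5 :: "nat \<Rightarrow> real" where
  "sigma5 n = (\<Sum>d | d dvd n. real d ^ 5)"

lemma sigma5_0 [simp]: "sigma5 0 = 0"
  by (simp add: sigma5_def)

lemma sigma5_nonneg: "sigma5 n \<ge> 0"
  by (simp add: sigma5_def sum_nonneg)

lemma sigma5_le: "sigma5 n \<le> real n ^ 6"
proof (cases "n = 0")
  case False
  have sub: "{d. d dvd n} \<subseteq> {1..n}"
    using False by (auto intro!: dvd_imp_le Nat.gr0I)
  have "sigma5 n \<le> (\<Sum>d\<in>{1..n}. real d ^ 5)"
    unfolding sigma5_def by (rule sum_mono2) (use sub in auto)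
  also have "\<dots> \<le> (\<Sum>d\<in>{1..n}. real n ^ 5)"
    by (intro sum_mono power_mono) auto
  also have "\<dots> = real n ^ 6" by (simp add: eval_nat_numeral)
  finally show ?thesis .
qed simp

lemma disc_summable_sigma5: "disc_summable sigma5"
  by (rule disc_summable_comparison[OF disc_summable_power[of 6]])
    (use sigma5_le sigma5_nonneg in \<open>auto simp: abs_of_nonneg\<close>)

section \<open>Absolute convergence of the lattice sum of weight 6\<close>

lemma summable_on_int_inverse_square: "(\<lambda>m::int. 1 / (1 + real_of_int m ^ 2)) summable_on UNIV"
proof -
  have s: "summable (\<lambda>n::nat. 1 / (1 + real n ^ 2))"
  proof (rule summable_comparison_test')
    show "summable (\<lambda>n. inverse (real n ^ 2))" by (rule inverse_power_summable) simp
    show "norm (1 / (1 + real n ^ 2)) \<le> inverse (real n ^ 2)" if "n \<ge> 1" for n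
      using that by (simp add: divide_simps add_nonneg_nonneg not_less)
  qed
  then have s': "(\<lambda>n::nat. 1 / (1 + real n ^ 2)) summable_on UNIV"
    by (intro norm_summable_imp_summable_on) auto
  have 1: "(\<lambda>m::int. 1 / (1 + real_of_int m ^ 2)) summable_on (range int)"
    by (subst summable_on_reindex) (use s' in \<open>auto simp: o_def inj_def\<close>)
  have 2: "(\<lambda>m::int. 1 / (1 + real_of_int m ^ 2)) summable_on (range (\<lambda>n. - int n))"
    by (subst summable_on_reindex) (use s' in \<open>auto simp: o_def inj_def\<close>)
  have "range int \<union> range (\<lambda>n. - int n) = UNIV"
    by (auto simp: image_iff) (metis int_cases2)
  with summable_on_union[OF 1 2] show ?thesis by simp
qed

text \<open>A majorant in product form, which reduces the double series to one-dimensional ones. It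
  comes from the equivalence of the quadratic form \<open>L\<close> = |m \<tau> + n|^2 with
  \<open>R\<close> = m^2 + n^2 and from (1 + m^2) (1 + n^2) <= 3 R^3.\<close>

lemma lattice_term_bound:
  assumes "Im \<tau> > 0"
  obtains K where "K > 0"
    "\<And>m n. (m, n) \<noteq> (0::int, 0::int) \<Longrightarrow>
       norm (1 / (of_int m * \<tau> + of_int n) ^ 6)
         \<le> K * (1 / (1 + real_of_int m ^ 2) * (1 / (1 + real_of_int n ^ 2)))"
proof
  \<comment> \<open>The bound N^2 <= 2 (M x + N)^2 + 2 (M x)^2 leaves \<open>R\<close> with
    coefficient 2 at (M x + N)^2 and (2 x^2 + 1) / y^2 at (M y)^2; \<open>c\<close> is the sum of
    the two.\<close>
  define c where "c = 2 + (2 * Re \<tau> ^ 2 + 1) / Im \<tau> ^ 2"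
  have c: "c > 0" unfolding c_def by (smt (verit) divide_nonneg_nonneg zero_le_power2)
  show "3 * c ^ 3 > 0" using c by simp
  fix m n :: int assume mn: "(m, n) \<noteq> (0, 0)"
  define x y where "x = Re \<tau>" and "y = Im \<tau>"
  define M N where "M = real_of_int m" and "N = real_of_int n"
  define R where "R = M ^ 2 + N ^ 2"
  define L where "L = (M * x + N) ^ 2 + (M * y) ^ 2"
  have y: "y > 0" using assms by (simp add: y_def)
  have R1: "R \<ge> 1"
  proof -
    have "m ^ 2 + n ^ 2 \<ge> 1" using mn
      by (metis less_le not_less not_sum_power2_lt_zero one_add_one
          prod.inject sum_power2_eq_zero_iff zero_less_one zless_add1_eq int_one_le_iff_zero_less)
    then have "real_of_int (m ^ 2 + n ^ 2) \<ge> 1" by (simp only: of_int_1_le_iff)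
    then show ?thesis by (simp add: R_def M_def N_def)
  qed
  have RL: "R \<le> c * L"
  proof -
    have "N ^ 2 = (M * x + N - M * x) ^ 2" by simp
    also have "\<dots> \<le> 2 * (M * x + N) ^ 2 + 2 * (M * x) ^ 2"
      using sum_squares_bound[of "M * x + N" "- (M * x)"] zero_le_power2[of "M * x + N + M * x"]
      by (simp add: power2_eq_square algebra_simps)
    finally have "R \<le> 2 * (M * x + N) ^ 2 + (2 * x ^ 2 + 1) * M ^ 2"
      by (simp add: R_def power_mult_distrib algebra_simps)
    also have "(2 * x ^ 2 + 1) * M ^ 2 = (2 * x ^ 2 + 1) / y ^ 2 * (M * y) ^ 2"
      using y by (simp add: power_mult_distrib)
    also have "2 * (M * x + N) ^ 2 + (2 * x ^ 2 + 1) / y ^ 2 * (M * y) ^ 2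
        \<le> c * (M * x + N) ^ 2 + c * (M * y) ^ 2"
      by (intro add_mono mult_right_mono) (auto simp: c_def x_def y_def)
    finally show ?thesis by (simp add: L_def algebra_simps)
  qed
  have L0: "L > 0" using RL R1 c by (metis less_le_trans mult.commute zero_less_mult_pos2 zero_less_one)
  have nrm: "norm (of_int m * \<tau> + of_int n) ^ 2 = L"
    by (simp add: cmod_power2 L_def M_def N_def x_def y_def)
  have "norm ((of_int m * \<tau> + of_int n) ^ 6) = (norm (of_int m * \<tau> + of_int n) ^ 2) ^ 3"
    by (simp add: norm_power flip: power_mult)
  then have nL: "norm ((of_int m * \<tau> + of_int n) ^ 6) = L ^ 3" by (simp add: nrm)
  have "(1 + M ^ 2) * (1 + N ^ 2) = 1 + R + M ^ 2 * N ^ 2"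
    by (simp add: R_def algebra_simps)
  also have "M ^ 2 * N ^ 2 \<le> R * R" unfolding R_def by (intro mult_mono) auto
  also have "1 + R + R * R \<le> 3 * R ^ 3"
  proof -
    have "R * R \<le> R ^ 3" "R \<le> R ^ 3" "1 \<le> R ^ 3"
      using R1 power_increasing[of 2 3 R] power_increasing[of 1 3 R] by (auto simp: power2_eq_square)
    then show ?thesis by linarith
  qed
  also have "R ^ 3 \<le> (c * L) ^ 3" using RL R1 by (intro power_mono) auto
  finally have main: "(1 + M ^ 2) * (1 + N ^ 2) \<le> 3 * c ^ 3 * L ^ 3"
    by (simp add: power_mult_distrib)
  have pos: "(1 + M ^ 2) * (1 + N ^ 2) > 0" by (simp add: add_pos_nonneg)
  have "1 / L ^ 3 \<le> 3 * c ^ 3 * (1 / ((1 + M ^ 2) * (1 + N ^ 2)))"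
    using main pos L0 by (simp add: field_simps del: mult_pos_pos)
  then show "norm (1 / (of_int m * \<tau> + of_int n) ^ 6)
     \<le> 3 * c ^ 3 * (1 / (1 + real_of_int m ^ 2) * (1 / (1 + real_of_int n ^ 2)))"
    by (simp add: norm_divide nL M_def N_def)
qed

lemma lattice_summable:
  assumes "Im \<tau> > 0"
  shows "(\<lambda>(m, n). 1 / (of_int m * \<tau> + of_int n) ^ 6) summable_on (UNIV - {(0::int, 0::int)})"
proof -
  obtain K where K: "K > 0"
    "\<And>m n. (m, n) \<noteq> (0::int, 0::int) \<Longrightarrow>
       norm (1 / (of_int m * \<tau> + of_int n) ^ 6)
         \<le> K * (1 / (1 + real_of_int m ^ 2) * (1 / (1 + real_of_int n ^ 2)))"
    using lattice_term_bound[OF assms] by blast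
  define S where "S = (\<Sum>\<^sub>\<infinity>m::int. 1 / (1 + real_of_int m ^ 2))"
  have hs: "((\<lambda>m::int. 1 / (1 + real_of_int m ^ 2)) has_sum S) UNIV"
    unfolding S_def using summable_on_int_inverse_square by (rule has_sum_infsum)
  have "(\<lambda>(m::int, n::int). 1 / (1 + real_of_int m ^ 2) * (1 / (1 + real_of_int n ^ 2)))
      summable_on Sigma UNIV (\<lambda>_. UNIV)"
  proof (rule summable_on_SigmaI)
    show "((\<lambda>y. case (x, y) of (m::int, n::int) \<Rightarrow> 1 / (1 + real_of_int m ^ 2) * (1 / (1 + real_of_int n ^ 2)))
      has_sum 1 / (1 + real_of_int x ^ 2) * S) UNIV" for x :: int
      using has_sum_cmult_right[OF hs, of "1 / (1 + real_of_int x ^ 2)"] by simp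
    show "(\<lambda>x::int. 1 / (1 + real_of_int x ^ 2) * S) summable_on UNIV"
      by (rule summable_on_cmult_left[OF summable_on_int_inverse_square])
  qed auto
  then have "(\<lambda>p. K * (case p of (m::int, n::int) \<Rightarrow> 1 / (1 + real_of_int m ^ 2) * (1 / (1 + real_of_int n ^ 2))))
      summable_on UNIV"
    by (intro summable_on_cmult_right) simp
  then have "Infinite_Sum.abs_summable_on (\<lambda>p. K * (case p of (m::int, n::int) \<Rightarrow> 1 / (1 + real_of_int m ^ 2) * (1 / (1 + real_of_int n ^ 2)))) (UNIV - {(0, 0)})"
    by (intro summable_on_iff_abs_summable_on_real[THEN iffD1]) (rule summable_on_subset_banach, auto)
  then have "Infinite_Sum.abs_summable_on (\<lambda>(m, n). 1 / (of_int m * \<tau> + of_int n) ^ 6) (UNIV - {(0::int, 0::int)})"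
  proof (rule Infinite_Sum.abs_summable_on_comparison_test)
    fix p :: "int \<times> int" assume p: "p \<in> UNIV - {(0, 0)}"
    obtain m n where mn: "p = (m, n)" by (cases p)
    show "norm (case p of (m, n) \<Rightarrow> 1 / (of_int m * \<tau> + of_int n) ^ 6)
      \<le> norm (K * (case p of (m::int, n::int) \<Rightarrow> 1 / (1 + real_of_int m ^ 2) * (1 / (1 + real_of_int n ^ 2))))"
      using K(2)[of m n] p unfolding mn by (metis (lifting) DiffD2 case_prod_conv
          insertCI norm_ge_zero order_trans real_norm_def abs_ge_self)
  qed
  then show ?thesis by (rule Infinite_Sum.abs_summable_summable)
qed

section \<open>Summation of the lattice by rows: Lipschitz formula and Lambert series\<close>

lemma summable_on_translates:
  assumes "Im z > 0"
  shows "(\<lambda>n::int. 1 / (z + of_int n) ^ 6) summable_on UNIV"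
proof -
  have "(\<lambda>(m, n). 1 / (of_int m * z + of_int n) ^ 6) summable_on ((\<lambda>n. (1, n)) ` UNIV)"
    using lattice_summable[OF assms] by (rule summable_on_subset_banach) auto
  then show ?thesis
    by (subst (asm) summable_on_reindex) (auto simp: inj_def o_def)
qed

text \<open>The halves n >= 0 and n <= -1 of the sum are the series of \<open>Polygamma 5\<close> at
  \<open>z\<close> and at \<open>1 - z\<close>, up to 5! = 120. As j = 5 is odd, the difference in
  the reflection formula is the sum of the two values.\<close>

lemma Lipschitz_formula_6:
  assumes "Im z > 0"
  shows "((\<lambda>n::int. 1 / (z + of_int n) ^ 6) has_sum
           (2 * of_real pi * \<i>) ^ 6 / 120 * pws (\<lambda>n. real n ^ 5) (nome z)) UNIV"
proof -
  define f where "f = (\<lambda>n::int. 1 / (z + of_int n) ^ 6)"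
  have sm: "f summable_on UNIV" unfolding f_def by (rule summable_on_translates[OF assms])
  have z: "z \<noteq> 0" "1 - z \<noteq> 0" using assms by (auto simp: complex_eq_iff)
  have sa: "f summable_on range int" "f summable_on range (\<lambda>n. - 1 - int n)"
    using sm by (auto intro: summable_on_subset_banach)
  have 1: "(f has_sum (Polygamma 5 z / 120)) (range int)"
  proof -
    have "(\<lambda>k. inverse ((z + of_nat k) ^ Suc 5)) sums ((-1) ^ Suc 5 * Polygamma 5 z / fact 5)"
      by (rule Polygamma_LIMSEQ) (use z in auto)
    then have s: "(f \<circ> int) sums (Polygamma 5 z / 120)"
      by (simp add: f_def o_def field_simps fact_numeral)
    have "(f \<circ> int) summable_on UNIV"
      using sa(1) by (subst (asm) summable_on_reindex) (auto simp: inj_def)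
    then have "((f \<circ> int) has_sum infsum (f \<circ> int) UNIV) UNIV" by (rule has_sum_infsum)
    moreover from has_sum_imp_sums[OF this] s have "infsum (f \<circ> int) UNIV = Polygamma 5 z / 120"
      using sums_unique2 by blast
    ultimately show ?thesis by (subst has_sum_reindex) (auto simp: inj_def)
  qed
  have 2: "(f has_sum (Polygamma 5 (1 - z) / 120)) (range (\<lambda>n. - 1 - int n))"
  proof -
    have "(\<lambda>k. inverse ((1 - z + of_nat k) ^ Suc 5)) sums ((-1) ^ Suc 5 * Polygamma 5 (1 - z) / fact 5)"
      by (rule Polygamma_LIMSEQ) (use z in auto)
    \<comment> \<open>For n = -1 - k the base is -(1 - z + k), and the even exponent removes the
      sign.\<close>
    moreover have "(f \<circ> (\<lambda>n. - 1 - int n)) k = inverse ((1 - z + of_nat k) ^ Suc 5)" for k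
    proof -
      have "(z + of_int (- 1 - int k)) ^ 6 = (1 - z + of_nat k) ^ 6"
        using power_minus_even[of 6 "1 - z + of_nat k"] by (simp add: algebra_simps)
      then show ?thesis by (simp only: f_def o_def) (simp add: field_simps)
    qed
    ultimately have s: "(f \<circ> (\<lambda>n. - 1 - int n)) sums (Polygamma 5 (1 - z) / 120)"
      by (simp add: fact_numeral o_def)
    have "(f \<circ> (\<lambda>n. - 1 - int n)) summable_on UNIV"
      using sa(2) by (subst (asm) summable_on_reindex) (auto simp: inj_def)
    then have "((f \<circ> (\<lambda>n. - 1 - int n)) has_sum infsum (f \<circ> (\<lambda>n. - 1 - int n)) UNIV) UNIV" by (rule has_sum_infsum)
    moreover from has_sum_imp_sums[OF this] s have "infsum (f \<circ> (\<lambda>n. - 1 - int n)) UNIV = Polygamma 5 (1 - z) / 120"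
      using sums_unique2 by blast
    ultimately show ?thesis by (subst has_sum_reindex) (auto simp: inj_def)
  qed
  have un: "range int \<union> range (\<lambda>n. - 1 - int n) = UNIV"
  proof -
    have "k \<in> range int \<union> range (\<lambda>n. - 1 - int n)" for k
      by (cases k rule: int_cases) (auto simp: image_iff intro: exI[of _ "nat (-1 - k)"])
    then show ?thesis by auto
  qed
  have "(f has_sum (Polygamma 5 z / 120 + Polygamma 5 (1 - z) / 120)) (range int \<union> range (\<lambda>n. - 1 - int n))"
    using 1 2 by (rule has_sum_Un_disjoint) auto
  moreover have "Polygamma 5 z / 120 + Polygamma 5 (1 - z) / 120
      = (2 * of_real pi * \<i>) ^ 6 / 120 * pws (\<lambda>n. real n ^ 5) (nome z)"
    using Polygamma_reflection_nome[OF assms, of 5] by (simp add: field_simps eval_nat_numeral)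
  ultimately show ?thesis unfolding un f_def by simp
qed

text \<open>Summing k^5 q^(m k) over all m, k >= 1 by rows gives the left side, and grouping by the
  product m k gives the divisor sums. The index m = 0 is excluded: there q^m = 1 lies outside the
  open disc.\<close>

lemma has_sum_sigma5_Lambert:
  assumes "norm q < 1"
  shows "((\<lambda>m. pws (\<lambda>n. real n ^ 5) (q ^ m)) has_sum pws sigma5 q) {1..}"
proof -
  define f where "f = (\<lambda>(m::nat, k::nat). of_real (real k ^ 5) * q ^ (m * k))"
  define r where "r = norm q"
  have r: "0 \<le> r" "r < 1" using assms by (auto simp: r_def)
  have sr: "summable (\<lambda>k. real k ^ 5 * r ^ k)" 
    using disc_summable_abs[OF disc_summable_power[of 5] r] by simp
  have sr': "summable (\<lambda>k. r ^ k)" using r by (intro summable_geometric) auto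
  have "(\<lambda>(m::nat, k::nat). r ^ (m - 1) * (real k ^ 5 * r ^ k)) summable_on ({1..} \<times> {1..})"
  proof (rule summable_on_SigmaI)
    have "((\<lambda>k. real k ^ 5 * r ^ k) has_sum infsum (\<lambda>k. real k ^ 5 * r ^ k) {1..}) {1..}"
      using sr r by (intro has_sum_infsum summable_on_subset_banach[OF norm_summable_imp_summable_on]) auto
    then show "((\<lambda>y. case (x, y) of (m, k) \<Rightarrow> r ^ (m - 1) * (real k ^ 5 * r ^ k)) has_sum
        r ^ (x - 1) * infsum (\<lambda>k. real k ^ 5 * r ^ k) {1..}) {1..}" for x
      by (simp add: has_sum_cmult_right)
    have "(\<lambda>k. r ^ k) summable_on UNIV"
      using sr' r by (intro norm_summable_imp_summable_on) auto
    also have "?this \<longleftrightarrow> (\<lambda>m. r ^ (m - 1)) summable_on {1..}"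
      by (rule summable_on_reindex_bij_witness[of _ "\<lambda>m. m - 1" Suc]) auto
    finally show "(\<lambda>m. r ^ (m - 1) * infsum (\<lambda>k. real k ^ 5 * r ^ k) {1..}) summable_on {1..}"
      by (rule summable_on_cmult_left)
  qed (use r in auto)
  then have "Infinite_Sum.abs_summable_on (\<lambda>(m::nat, k::nat). r ^ (m - 1) * (real k ^ 5 * r ^ k)) ({1..} \<times> {1..})"
    by (rule summable_on_iff_abs_summable_on_real[THEN iffD1])
  then have "Infinite_Sum.abs_summable_on f ({1..} \<times> {1..})"
  proof (rule Infinite_Sum.abs_summable_on_comparison_test)
    fix p :: "nat \<times> nat" assume p: "p \<in> {1..} \<times> {1..}"
    obtain m k where mk: "p = (m, k)" by (cases p)
    have "m \<ge> 1" "k \<ge> 1" using p mk by auto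
    then obtain m' k' where "m = Suc m'" "k = Suc k'" by (metis Suc_le_D One_nat_def)
    \<comment> \<open>This separates the variables: the majorant is a geometric series in m times
      the series of k^5 r^k.\<close>
    then have "m - 1 + k \<le> m * k" by simp
    then have "r ^ (m * k) \<le> r ^ (m - 1 + k)" using r by (intro power_decreasing) auto
    then have "real k ^ 5 * r ^ (m * k) \<le> real k ^ 5 * (r ^ (m - 1) * r ^ k)"
      by (intro mult_left_mono) (auto simp: power_add)
    then show "norm (f p) \<le> norm (case p of (m, k) \<Rightarrow> r ^ (m - 1) * (real k ^ 5 * r ^ k))"
      using r by (simp add: mk f_def norm_mult norm_power abs_mult mult_ac flip: r_def)
  qed
  then have fs: "f summable_on ({1..} \<times> {1..})" by (rule Infinite_Sum.abs_summable_summable)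
  define S where "S = infsum f ({1..} \<times> {1..})"
  have S: "(f has_sum S) ({1..} \<times> {1..})" unfolding S_def using fs by (rule has_sum_infsum)
  have rows: "(pws (\<lambda>n. real n ^ 5) (q ^ m) = infsum (\<lambda>k. f (m, k)) {1..})
     \<and> (\<lambda>k. f (m, k)) summable_on {1..}" if "m \<ge> 1" for m
  proof -
    have qm: "norm (q ^ m) < 1" using that r by (simp add: norm_power power_less_one_iff flip: r_def)
    have "summable (\<lambda>k. norm (of_real (real k ^ 5) * (q ^ m) ^ k))"
      using disc_summable_abs[OF disc_summable_power[of 5], of "norm (q ^ m)"] qm
      by (simp add: norm_mult norm_power)
    moreover have "(\<lambda>k. of_real (real k ^ 5) * (q ^ m) ^ k) sums pws (\<lambda>n. real n ^ 5) (q ^ m)"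
      using disc_summable_power[of 5] qm unfolding disc_summable_def pws_def by (simp add: summable_sums)
    ultimately have "((\<lambda>k. of_real (real k ^ 5) * (q ^ m) ^ k) has_sum pws (\<lambda>n. real n ^ 5) (q ^ m)) UNIV"
      by (rule norm_summable_imp_has_sum)
    also have "?this \<longleftrightarrow> ((\<lambda>k. f (m, k)) has_sum pws (\<lambda>n. real n ^ 5) (q ^ m)) {1..}"
      by (rule has_sum_cong_neutral) (auto simp: f_def power_mult not_le)
    finally show ?thesis by (auto simp: infsumI summable_on_def)
  qed
  have rowsum: "((\<lambda>m. pws (\<lambda>n. real n ^ 5) (q ^ m)) has_sum S) {1..}"
    using S by (rule has_sum_SigmaD) (use rows in \<open>auto intro: has_sum_infsum\<close>)
  have "(f has_sum S) ({1..} \<times> {1..}) \<longleftrightarrow>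
        ((\<lambda>(n, d). of_real (real d ^ 5) * q ^ n) has_sum S) (Sigma {1..} (\<lambda>n. {d. d dvd n}))"
    by (rule has_sum_reindex_bij_witness[of _ "\<lambda>(n, d). (n div d, d)" "\<lambda>(m, k). (m * k, k)"])
      (auto simp: f_def Suc_le_eq dvd_div_eq_0_iff intro!: Nat.gr0I)
  with S have S2: "((\<lambda>(n, d). of_real (real d ^ 5) * q ^ n) has_sum S) (Sigma {1..} (\<lambda>n. {d. d dvd n}))"
    by simp
  have "((\<lambda>n. of_real (sigma5 n) * q ^ n) has_sum S) {1..}"
    using S2
  proof (rule has_sum_SigmaD)
    fix n :: nat assume "n \<in> {1..}"
    then have "finite {d. d dvd n}" by simp
    then show "((\<lambda>d. case (n, d) of (n, d) \<Rightarrow> of_real (real d ^ 5) * q ^ n) has_sum of_real (sigma5 n) * q ^ n)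
        {d. d dvd n}"
      by (intro has_sum_finiteI) (auto simp: sigma5_def sum_distrib_right)
  qed
  also have "?this \<longleftrightarrow> ((\<lambda>n. of_real (sigma5 n) * q ^ n) has_sum S) UNIV"
    by (rule has_sum_cong_neutral) (auto simp: not_le)
  finally have "S = pws sigma5 q" unfolding pws_def by (auto dest!: has_sum_imp_sums simp: sums_iff)
  with rowsum show ?thesis by simp
qed

lemma nome_of_nat_mult: "nome (of_nat m * \<tau>) = nome \<tau> ^ m"
  by (simp add: nome_def flip: exp_of_nat_mult) (simp add: mult_ac)

text \<open>The row m = 0 gives the constant; the rows m and -m agree, whence the factor 2; each row
  m > 0 is a Lipschitz sum, and these rows add up to a Lambert series.\<close>

lemma lattice_sum_6:
  assumes "Im \<tau> > 0"
  shows "infsum (\<lambda>(m, n). 1 / (of_int m * \<tau> + of_int n) ^ 6) (UNIV - {(0::int, 0::int)})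
    = infsum (\<lambda>n::int. 1 / of_int n ^ 6) (- {0})
      + 2 * ((2 * of_real pi * \<i>) ^ 6 / 120 * pws sigma5 (nome \<tau>))"
proof -
  define f where "f = (\<lambda>(m::int, n::int). 1 / (of_int m * \<tau> + of_int n) ^ 6)"
  define B :: complex where "B = (2 * of_real pi * \<i>) ^ 6 / 120"
  have sm: "f summable_on (UNIV - {(0, 0)})" unfolding f_def by (rule lattice_summable[OF assms])
  have s: "f summable_on ({0} \<times> (- {0}))" "f summable_on ({1..} \<times> UNIV)" "f summable_on ({..-1} \<times> UNIV)"
    using sm by (auto intro: summable_on_subset_banach)
  have un: "UNIV - {(0, 0)} = ({0::int} \<times> (- {0::int})) \<union> (({1..} \<times> UNIV) \<union> ({..-1} \<times> UNIV))"
    by auto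
  have "infsum f (UNIV - {(0, 0)}) = infsum f ({0} \<times> (- {0})) + (infsum f ({1..} \<times> UNIV) + infsum f ({..-1} \<times> UNIV))"
    unfolding un using s by (subst infsum_Un_disjoint, (force intro!: summable_on_Un_disjoint)+)+
  also have "infsum f ({..-1} \<times> UNIV) = infsum f ({1..} \<times> UNIV)"
  proof (rule infsum_reindex_bij_witness[of _ "\<lambda>(m, n). (-m, -n)" "\<lambda>(m, n). (-m, -n)"])
    fix a :: "int \<times> int"
    obtain m n where a: "a = (m, n)" by (cases a)
    have "(- (of_int m * \<tau>) - of_int n) ^ 6 = (of_int m * \<tau> + of_int n) ^ 6"
      using power_minus_even[of 6 "of_int m * \<tau> + of_int n"] by simp
    then show "f (case a of (m, n) \<Rightarrow> (-m, -n)) = f a"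
      unfolding a f_def prod.case of_int_minus by (simp only: mult_minus_left diff_conv_add_uminus)
  qed auto
  also have "infsum f ({0} \<times> (- {0})) = infsum (\<lambda>n::int. 1 / of_int n ^ 6) (- {0})"
    by (rule infsum_reindex_bij_witness[of _ "\<lambda>n. (0, n)" snd]) (auto simp: f_def)
  also have "infsum f ({1..} \<times> UNIV) = B * pws sigma5 (nome \<tau>)"
  proof -
    have "((\<lambda>m::int. B * pws (\<lambda>n. real n ^ 5) (nome (of_int m * \<tau>))) has_sum infsum f ({1..} \<times> UNIV)) {1..}"
      using has_sum_infsum[OF s(2)]
    proof (rule has_sum_SigmaD)
      fix m :: int assume "m \<in> {1..}"
      then have "Im (of_int m * \<tau>) > 0" using assms by simp
      from Lipschitz_formula_6[OF this]
      show "((\<lambda>n. f (m, n)) has_sum B * pws (\<lambda>n. real n ^ 5) (nome (of_int m * \<tau>))) UNIV"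
        by (simp add: f_def B_def)
    qed
    also have "?this \<longleftrightarrow> ((\<lambda>m::nat. B * pws (\<lambda>n. real n ^ 5) (nome \<tau> ^ m)) has_sum infsum f ({1..} \<times> UNIV)) {1..}"
      by (rule has_sum_reindex_bij_witness[of _ int nat]) (auto simp flip: nome_of_nat_mult)
    finally show ?thesis
      using has_sum_cmult_right[OF has_sum_sigma5_Lambert[OF norm_nome_less_1[OF assms]], of B]
      by (metis has_sum_unique)
  qed
  finally show ?thesis by (simp add: f_def B_def)
qed

text \<open>\<open>K\<close> and \<open>a\<close> stay unevaluated: the factor \<open>K\<close>
  affects neither the critical points nor h, and \<open>a\<close> is found later from the zero of
  \<open>E6\<close> at \<i>.\<close>

theorem E6_q_expansion:
  obtains K a :: complex where "K \<noteq> 0" "\<And>\<tau>. Im \<tau> > 0 \<Longrightarrow> E6 \<tau> = K * (a - pws sigma5 (nome \<tau>))"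
proof
  define B :: complex where "B = (2 * of_real pi * \<i>) ^ 6 / 120"
  define A :: complex where "A = infsum (\<lambda>n::int. 1 / of_int n ^ 6) (- {0})"
  define c where "c = complex_of_real (27 / (8 * pi ^ 6)) * 140"
  have B: "B \<noteq> 0" "c \<noteq> 0" by (auto simp: B_def c_def)
  then show "- 2 * B * c \<noteq> 0" by simp
  show "E6 \<tau> = - 2 * B * c * (- A / (2 * B) - pws sigma5 (nome \<tau>))" if "Im \<tau> > 0" for \<tau>
    unfolding E6_def g3_def lattice_sum_6[OF that] A_def[symmetric] B_def[symmetric] c_def[symmetric]
    using B by (simp add: c_def field_simps)
qed

text \<open>With j = c \<tau> + d, each term at the transformed point is j^6 times the term at
  \<tau> with index (m a + n c, m b + n d), and determinant 1 makes this substitution a permutation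
  of the nonzero pairs.\<close>

lemma E6_modular:
  fixes a b c d :: int
  assumes "a * d - b * c = 1" "Im \<tau> > 0"
  shows "E6 ((of_int a * \<tau> + of_int b) / (of_int c * \<tau> + of_int d)) = (of_int c * \<tau> + of_int d) ^ 6 * E6 \<tau>"
proof -
  define j where "j = of_int c * \<tau> + of_int d"
  have j: "j \<noteq> 0"
  proof
    assume "j = 0"
    then have "of_int c * Im \<tau> = 0" "of_int c * Re \<tau> + of_int d = 0" by (auto simp: j_def complex_eq_iff)
    with assms have "c = 0" "d = 0" by auto
    with assms show False by simp
  qed
  have "infsum (\<lambda>(m, n). 1 / (of_int m * ((of_int a * \<tau> + of_int b) / j) + of_int n) ^ 6) (UNIV - {(0::int, 0::int)})
      = infsum (\<lambda>(m, n). j ^ 6 * (1 / (of_int m * \<tau> + of_int n) ^ 6)) (UNIV - {(0::int, 0::int)})"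
  proof (rule infsum_reindex_bij_witness[of _ "\<lambda>(m, n). (m * d - n * c, n * a - m * b)"
          "\<lambda>(m, n). (m * a + n * c, m * b + n * d)"], goal_cases)
    case (1 x)
    have *: "(m * a + n * c) * d - (m * b + n * d) * c = m" "(m * b + n * d) * a - (m * a + n * c) * b = n" for m n
      using assms(1) by algebra+
    show ?case by (cases x) (simp only: prod.case *)
  next
    case (2 x)
    have *: "(m * a + n * c) * d - (m * b + n * d) * c = m" "(m * b + n * d) * a - (m * a + n * c) * b = n" for m n
      using assms(1) by algebra+
    obtain m n where x: "x = (m, n)" by (cases x)
    have "m = 0 \<and> n = 0" if "m * a + n * c = 0 \<and> m * b + n * d = 0"
      using *[of m n] that by (metis mult_zero_left diff_zero)
    then show ?case using 2 unfolding x prod.case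
      by (metis DiffD2 DiffI UNIV_I singletonD singletonI prod.inject)
  next
    case (3 x)
    have *: "(m * d - n * c) * a + (n * a - m * b) * c = m" "(m * d - n * c) * b + (n * a - m * b) * d = n" for m n
      using assms(1) by algebra+
    show ?case by (cases x) (simp only: prod.case *)
  next
    case (4 x)
    have *: "(m * d - n * c) * a + (n * a - m * b) * c = m" "(m * d - n * c) * b + (n * a - m * b) * d = n" for m n
      using assms(1) by algebra+
    obtain m n where x: "x = (m, n)" by (cases x)
    have "m = 0 \<and> n = 0" if "m * d - n * c = 0 \<and> n * a - m * b = 0"
      using *[of m n] that by (metis mult_zero_left add_0)
    then show ?case using 4 unfolding x prod.case
      by (metis DiffD2 DiffI UNIV_I singletonD singletonI prod.inject)
  next
    case (5 x)
    obtain m n where x: "x = (m, n)" by (cases x)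
    have "of_int m * ((of_int a * \<tau> + of_int b) / j) + of_int n
       = (of_int (m * a + n * c) * \<tau> + of_int (m * b + n * d)) / j"
      using j by (simp add: field_simps) (simp add: j_def algebra_simps)
    then show ?case by (simp add: x power_divide)
  qed
  also have "\<dots> = infsum (\<lambda>p. j ^ 6 * (case p of (m, n) \<Rightarrow> 1 / (of_int m * \<tau> + of_int n) ^ 6)) (UNIV - {(0::int, 0::int)})"
    by (rule infsum_cong) (simp add: case_prod_unfold)
  also have "\<dots> = j ^ 6 * infsum (\<lambda>(m, n). 1 / (of_int m * \<tau> + of_int n) ^ 6) (UNIV - {(0::int, 0::int)})"
    by (rule infsum_cmult_right')
  finally show ?thesis unfolding E6_def g3_def j_def[symmetric] by (simp only: mult_ac)
qed

section \<open>Estimates of the Eisenstein series at a small nome\<close>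

text \<open>Lets the imaginary part of a real power series be bounded term by term by a multiple of
  \<open>Im q\<close>.\<close>

lemma abs_Im_power_le: "\<bar>Im (q ^ n)\<bar> \<le> real n * norm q ^ (n - 1) * \<bar>Im q\<bar>"
proof (induction n)
  case (Suc n)
  have "\<bar>Im (q ^ Suc n)\<bar> \<le> \<bar>Re q\<bar> * \<bar>Im (q ^ n)\<bar> + \<bar>Im q\<bar> * \<bar>Re (q ^ n)\<bar>"
    using abs_triangle_ineq[of "Re q * Im (q ^ n)" "Im q * Re (q ^ n)"] by (simp add: abs_mult)
  also have "\<dots> \<le> norm q * (real n * norm q ^ (n - 1) * \<bar>Im q\<bar>) + \<bar>Im q\<bar> * norm q ^ n"
    using abs_Re_le_cmod[of "q ^ n"]
    by (intro add_mono mult_mono Suc abs_Re_le_cmod order_refl) (auto simp: norm_power)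
  also have "\<dots> = real (Suc n) * norm q ^ (Suc n - 1) * \<bar>Im q\<bar>"
    by (cases n) (auto simp: algebra_simps)
  finally show ?case .
qed simp

text \<open>Isolates three terms and bounds the rest by a geometric series of ratio 6 |q|,
  respectively its derivative. The radius 1/225 covers Im \<tau> >= sqrt 3 / 2, hence the standard
  region |\<tau>| >= 1, |Re \<tau>| <= 1/2 in the upper half-plane.\<close>

lemma pws_tail:
  fixes q :: complex
  assumes c: "disc_summable c" "c 0 = 0" "\<And>n. \<bar>c (n + 4)\<bar> \<le> C * 6 ^ n"
    and q: "norm q \<le> 1 / 225"
  obtains T where
    "pws c q = of_real (c 1) * q + of_real (c 2) * q ^ 2 + of_real (c 3) * q ^ 3 + q ^ 4 * T"
    "norm T \<le> C * 1.0275" "\<bar>Im T\<bar> \<le> C * 6.4 * \<bar>Im q\<bar>"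
proof
  define r where "r = norm q"
  have r: "0 \<le> r" "r \<le> 1 / 225" using q by (auto simp: r_def)
  define T where "T = (\<Sum>n. of_real (c (n + 4)) * q ^ n)"
  have C: "C \<ge> 0" using c(3)[of 0] abs_ge_zero[of "c (0 + 4)"] by simp
  have sm: "summable (\<lambda>n. of_real (c n) * q ^ n)"
    using c(1) q by (auto simp: disc_summable_def)
  then have sm4: "summable (\<lambda>n. of_real (c (n + 4)) * q ^ (n + 4))"
    using summable_iff_shift[of "\<lambda>n. of_real (c n) * q ^ n" 4] by simp
  have g: "(\<lambda>n. (6 * r) ^ n) sums (1 / (1 - 6 * r))" using r by (intro geometric_sums) auto
  have b: "norm (of_real (c (n + 4)) * q ^ n) \<le> C * (6 * r) ^ n" for n
    using mult_right_mono[OF c(3), of "r ^ n" n] r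
    by (simp add: norm_mult norm_power power_mult_distrib mult_ac flip: r_def)
  have gC: "(\<lambda>n. C * (6 * r) ^ n) sums (C * (1 / (1 - 6 * r)))" using g by (rule sums_mult)
  have smT: "summable (\<lambda>n. of_real (c (n + 4)) * q ^ n)"
    by (rule summable_comparison_test'[OF sums_summable[OF gC]]) (rule b)
  have "norm T \<le> (\<Sum>n. C * (6 * r) ^ n)"
    unfolding T_def by (rule norm_suminf_le[OF b sums_summable[OF gC]])
  also have "\<dots> = C * (1 / (1 - 6 * r))" using gC by (simp add: sums_iff)
  \<comment> \<open>For |q| <= 1/225 the factor 1 / (1 - 6 r) is at most 225 / 219.\<close>
  also have "\<dots> \<le> C * 1.0275" using C r by (intro mult_left_mono) (auto simp: divide_simps)
  finally show "norm T \<le> C * 1.0275" .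
  have g': "(\<lambda>n. real (Suc n) * (6 * r) ^ n) sums (1 / (1 - 6 * r) ^ 2)"
    using r by (intro geometric_deriv_sums) auto
  then have g2: "(\<lambda>n. C * 6 * \<bar>Im q\<bar> * (real (Suc n) * (6 * r) ^ n)) sums (C * 6 * \<bar>Im q\<bar> * (1 / (1 - 6 * r) ^ 2))"
    by (rule sums_mult)
  have smI: "summable (\<lambda>n. Im (of_real (c (n + 4)) * q ^ n))" using smT by (rule summable_Im)
  have b2: "norm (Im (of_real (c (n + 4)) * q ^ n)) \<le> C * \<bar>Im q\<bar> * 6 ^ n * (real n * r ^ (n - 1))" for n
  proof -
    have "norm (Im (of_real (c (n + 4)) * q ^ n)) = \<bar>c (n + 4)\<bar> * \<bar>Im (q ^ n)\<bar>"
      by (simp add: abs_mult)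
    also have "\<dots> \<le> (C * 6 ^ n) * (real n * r ^ (n - 1) * \<bar>Im q\<bar>)"
      unfolding r_def using C by (intro mult_mono c abs_Im_power_le) auto
    finally show ?thesis by (simp add: mult_ac)
  qed
  have "(\<Sum>n. Im (of_real (c (n + 4)) * q ^ n)) = (\<Sum>n. Im (of_real (c (Suc n + 4)) * q ^ Suc n))"
    using suminf_split_head[OF smI] by simp
  also have "norm \<dots> \<le> (\<Sum>n. C * 6 * \<bar>Im q\<bar> * (real (Suc n) * (6 * r) ^ n))"
  proof (rule norm_suminf_le[OF _ sums_summable[OF g2]])
    fix n
    show "norm (Im (of_real (c (Suc n + 4)) * q ^ Suc n)) \<le> C * 6 * \<bar>Im q\<bar> * (real (Suc n) * (6 * r) ^ n)"
      using b2[of "Suc n"] by (simp add: power_mult_distrib mult_ac)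
  qed
  also have "\<dots> = C * 6 * \<bar>Im q\<bar> * (1 / (1 - 6 * r) ^ 2)" using g2 by (simp add: sums_iff)
  also have "\<dots> \<le> C * 6 * \<bar>Im q\<bar> * 1.06"
  proof (intro mult_left_mono)
    have "(1 - 6 * r) ^ 2 \<ge> (1 - 6 / 225) ^ 2" using r by (intro power_mono) auto
    then show "1 / (1 - 6 * r) ^ 2 \<le> 1.06" using r by (simp add: divide_simps power2_eq_square)
  qed (use C in auto)
  also have "\<dots> \<le> C * 6.4 * \<bar>Im q\<bar>" using mult_nonneg_nonneg[OF C abs_ge_zero[of "Im q"]] by simp
  finally show "\<bar>Im T\<bar> \<le> C * 6.4 * \<bar>Im q\<bar>"
    unfolding T_def using sums_Im[OF summable_sums[OF smT]] by (simp add: sums_iff)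
  have "pws c q = (\<Sum>n. of_real (c (n + 4)) * q ^ (n + 4)) + (\<Sum>n<4. of_real (c n) * q ^ n)"
    unfolding pws_def by (rule suminf_split_initial_segment[OF sm])
  also have "(\<Sum>n. of_real (c (n + 4)) * q ^ (n + 4)) = (\<Sum>n. q ^ 4 * (of_real (c (n + 4)) * q ^ n))"
    by (simp add: power_add mult_ac)
  also have "\<dots> = q ^ 4 * T" unfolding T_def by (rule suminf_mult[OF smT])
  also have "(\<Sum>n<4. of_real (c n) * q ^ n) = of_real (c 1) * q + of_real (c 2) * q ^ 2 + of_real (c 3) * q ^ 3"
    using c(2) by (simp add: eval_nat_numeral)
  finally show "pws c q = of_real (c 1) * q + of_real (c 2) * q ^ 2 + of_real (c 3) * q ^ 3 + q ^ 4 * T"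
    by simp
qed

lemma sigma5_values: "sigma5 1 = 1" "sigma5 2 = 33" "sigma5 3 = 244"
proof -
  have d: "{d::nat. d dvd 1} = {1}" "{d::nat. d dvd 2} = {1, 2}" "{d::nat. d dvd 3} = {1, 3}"
    using prime_nat_iff[of 2] prime_nat_iff[of 3] by auto
  show "sigma5 1 = 1" "sigma5 2 = 33" "sigma5 3 = 244" unfolding sigma5_def d by auto
qed

text \<open>The growth factor 6 dominates (5/4)^8, the largest quotient of consecutive values of (n
  + 4)^p for p <= 8. The exponent 8 occurs because n^2 sigma5(n) <= n^8.\<close>

lemma shifted_power_le:
  assumes "p \<le> 8"
  shows "real (n + 4) ^ p \<le> 4 ^ p * 6 ^ n"
proof (induction n)
  case (Suc n)
  have "real (Suc n + 4) \<le> 5 / 4 * real (n + 4)" by simp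
  then have "real (Suc n + 4) ^ p \<le> (5 / 4 * real (n + 4)) ^ p" by (intro power_mono) auto
  also have "\<dots> = (5 / 4) ^ p * real (n + 4) ^ p" by (simp only: power_mult_distrib)
  also have "\<dots> \<le> 6 * (4 ^ p * 6 ^ n)"
  proof (intro mult_mono Suc)
    have "(5 / 4 :: real) ^ p \<le> (5 / 4) ^ 8" using assms by (intro power_increasing) auto
    also have "\<dots> \<le> 6" by (simp add: power_divide)
    finally show "(5 / 4 :: real) ^ p \<le> 6" .
  qed auto
  finally show ?case by simp
qed simp

text \<open>The series of \<open>E6\<close> without its constant term and its first two images under
  q d/dq; up to constant factors \<open>v_series\<close> and \<open>w_series\<close> are the first
  and second derivative of \<open>E6\<close>.\<close>

definition u_series :: "complex \<Rightarrow> complex" where "u_series = pws sigma5"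
definition v_series :: "complex \<Rightarrow> complex" where "v_series = pws (\<lambda>n. real n * sigma5 n)"
definition w_series :: "complex \<Rightarrow> complex" where "w_series = pws (\<lambda>n. real n * (real n * sigma5 n))"

lemma series_expansions:
  assumes q: "norm q \<le> 1 / 225"
  obtains Tu Tv Tw where
    "u_series q = q * (1 + 33 * q + 244 * q ^ 2 + q ^ 3 * Tu)" "norm Tu \<le> 4300" "\<bar>Im Tu\<bar> \<le> 26300 * \<bar>Im q\<bar>"
    "v_series q = q * (1 + 66 * q + 732 * q ^ 2 + q ^ 3 * Tv)" "norm Tv \<le> 17000" "\<bar>Im Tv\<bar> \<le> 105000 * \<bar>Im q\<bar>"
    "w_series q = q * (1 + 132 * q + 2196 * q ^ 2 + q ^ 3 * Tw)" "norm Tw \<le> 67500" "\<bar>Im Tw\<bar> \<le> 420000 * \<bar>Im q\<bar>"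
proof -
  have b: "\<bar>real n ^ p * sigma5 n\<bar> \<le> real n ^ (p + 6)" for n p
    using mult_left_mono[OF sigma5_le, of "real n ^ p"] sigma5_nonneg[of n]
    by (simp add: power_add)
  have b6: "\<bar>real (n + 4) ^ p * sigma5 (n + 4)\<bar> \<le> 4 ^ (p + 6) * 6 ^ n" if "p \<le> 2" for n p
    using b[of "n + 4" p] shifted_power_le[of "p + 6" n] that by linarith
  have d0: "disc_summable sigma5" by (rule disc_summable_sigma5)
  have d1: "disc_summable (\<lambda>n. real n * sigma5 n)" using disc_summable_times_n[OF d0] .
  have d2: "disc_summable (\<lambda>n. real n * (real n * sigma5 n))" using disc_summable_times_n[OF d1] .
  \<comment> \<open>The constants 4096, 16384 and 65536 are 4^6, 4^7 and 4^8, from n^p sigma5(n) <=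
    n^(p + 6) and \<open>shifted_power_le\<close>.\<close>
  obtain Tu where Tu: "u_series q = of_real (sigma5 1) * q + of_real (sigma5 2) * q ^ 2 + of_real (sigma5 3) * q ^ 3 + q ^ 4 * Tu"
    "norm Tu \<le> 4096 * 1.0275" "\<bar>Im Tu\<bar> \<le> 4096 * 6.4 * \<bar>Im q\<bar>"
    unfolding u_series_def by (rule pws_tail[OF d0 _ _ q, of 4096]) (use b6[of 0] in auto)
  obtain Tv where Tv: "v_series q = of_real (1 * sigma5 1) * q + of_real (2 * sigma5 2) * q ^ 2 + of_real (3 * sigma5 3) * q ^ 3 + q ^ 4 * Tv"
    "norm Tv \<le> 16384 * 1.0275" "\<bar>Im Tv\<bar> \<le> 16384 * 6.4 * \<bar>Im q\<bar>"
    unfolding v_series_def by (rule pws_tail[OF d1 _ _ q, of 16384]) (use b6[of 1] in auto)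
  obtain Tw where Tw: "w_series q = of_real (1 * (1 * sigma5 1)) * q + of_real (2 * (2 * sigma5 2)) * q ^ 2 + of_real (3 * (3 * sigma5 3)) * q ^ 3 + q ^ 4 * Tw"
    "norm Tw \<le> 65536 * 1.0275" "\<bar>Im Tw\<bar> \<le> 65536 * 6.4 * \<bar>Im q\<bar>"
    unfolding w_series_def by (rule pws_tail[OF d2 _ _ q, of 65536]) (use b6[of 2] in \<open>auto simp: power2_eq_square mult_ac\<close>)
  have weaken: "x \<le> B' * \<bar>Im q\<bar>" if "x \<le> B * \<bar>Im q\<bar>" "B \<le> B'" for x B B'
    using that by (meson abs_ge_zero mult_right_mono order_trans)
  show ?thesis
  proof (rule that)
    show "u_series q = q * (1 + 33 * q + 244 * q ^ 2 + q ^ 3 * Tu)"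
      unfolding Tu(1) sigma5_values by (simp add: algebra_simps eval_nat_numeral)
    show "v_series q = q * (1 + 66 * q + 732 * q ^ 2 + q ^ 3 * Tv)"
      unfolding Tv(1) sigma5_values by (simp add: algebra_simps eval_nat_numeral)
    show "w_series q = q * (1 + 132 * q + 2196 * q ^ 2 + q ^ 3 * Tw)"
      unfolding Tw(1) sigma5_values by (simp add: algebra_simps eval_nat_numeral)
    show "norm Tu \<le> 4300" "norm Tv \<le> 17000" "norm Tw \<le> 67500"
      using Tu(2) Tv(2) Tw(2) by simp_all
    show "\<bar>Im Tu\<bar> \<le> 26300 * \<bar>Im q\<bar>" by (rule weaken[OF Tu(3)]) simp
    show "\<bar>Im Tv\<bar> \<le> 105000 * \<bar>Im q\<bar>" by (rule weaken[OF Tv(3)]) simp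
    show "\<bar>Im Tw\<bar> \<le> 420000 * \<bar>Im q\<bar>" by (rule weaken[OF Tw(3)]) simp
  qed
qed

text \<open>The quantities below are power series in \<open>q\<close> with real coefficients. Measuring their imaginary
  parts relative to \<open>Im q\<close> gives sign information that remains valid as \<open>q\<close> approaches the real axis.\<close>

definition im_bound :: "complex \<Rightarrow> real \<Rightarrow> real \<Rightarrow> complex \<Rightarrow> bool" where
  "im_bound q A B z \<longleftrightarrow> norm z \<le> A \<and> \<bar>Im z\<bar> \<le> B * \<bar>Im q\<bar>"

lemma im_bound_weaken: "im_bound q A B z \<Longrightarrow> A \<le> A' \<Longrightarrow> B \<le> B' \<Longrightarrow> im_bound q A' B' z"
  unfolding im_bound_def by (meson abs_ge_zero mult_right_mono order_trans)

lemma im_bound_real: "\<bar>c\<bar> \<le> A \<Longrightarrow> im_bound q A 0 (of_real c)"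
  by (simp add: im_bound_def)

lemma im_bound_numeral: "im_bound q (numeral n) 0 (numeral n)" "im_bound q 1 0 1"
  by (simp_all add: im_bound_def)

lemma im_bound_self: "norm q \<le> A \<Longrightarrow> im_bound q A 1 q"
  by (simp add: im_bound_def)

lemma im_bound_add: "im_bound q A B z \<Longrightarrow> im_bound q A' B' z' \<Longrightarrow> im_bound q (A + A') (B + B') (z + z')"
  unfolding im_bound_def by (auto simp: algebra_simps intro: norm_triangle_mono)

lemma im_bound_diff: "im_bound q A B z \<Longrightarrow> im_bound q A' B' z' \<Longrightarrow> im_bound q (A + A') (B + B') (z - z')"
  unfolding im_bound_def using norm_triangle_ineq4[of z z'] by (auto simp: algebra_simps)

text \<open>The second bound follows the Leibniz rule, as if it bounded a derivative, because Im (z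
  z') = Re z Im z' + Im z Re z'.\<close>

lemma im_bound_mult:
  assumes "im_bound q A B z" "im_bound q A' B' z'"
  shows "im_bound q (A * A') (A * B' + B * A') (z * z')"
  unfolding im_bound_def
proof
  have b: "norm z \<le> A" "norm z' \<le> A'" "\<bar>Im z\<bar> \<le> B * \<bar>Im q\<bar>" "\<bar>Im z'\<bar> \<le> B' * \<bar>Im q\<bar>"
    using assms by (auto simp: im_bound_def)
  have A: "A \<ge> 0" "A' \<ge> 0" using b norm_ge_zero order_trans by blast+
  have R: "\<bar>Re z\<bar> \<le> A" "\<bar>Re z'\<bar> \<le> A'" using b abs_Re_le_cmod order_trans by blast+
  show "norm (z * z') \<le> A * A'" unfolding norm_mult using b A by (intro mult_mono) auto
  have "\<bar>Im (z * z')\<bar> \<le> \<bar>Re z\<bar> * \<bar>Im z'\<bar> + \<bar>Im z\<bar> * \<bar>Re z'\<bar>"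
    using abs_triangle_ineq[of "Re z * Im z'" "Im z * Re z'"] by (simp add: abs_mult)
  also have "\<dots> \<le> A * (B' * \<bar>Im q\<bar>) + (B * \<bar>Im q\<bar>) * A'"
    using b A R by (intro add_mono mult_mono) auto
  finally show "\<bar>Im (z * z')\<bar> \<le> (A * B' + B * A') * \<bar>Im q\<bar>" by (simp add: algebra_simps)
qed

lemma im_bound_inverse:
  assumes "im_bound q A B z" "norm z \<ge> m" "m > 0"
  shows "im_bound q (1 / m) (B / m ^ 2) (1 / z)"
  unfolding im_bound_def
proof
  have z: "z \<noteq> 0" using assms by auto
  show "norm (1 / z) \<le> 1 / m" using assms by (simp add: norm_divide frac_le)
  have "\<bar>Im (1 / z)\<bar> = \<bar>Im z\<bar> / norm z ^ 2"
    by (simp add: Im_divide cmod_power2 abs_divide)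
  also have "\<dots> \<le> B * \<bar>Im q\<bar> / m ^ 2"
    using assms by (intro frac_le power_mono) (auto simp: im_bound_def intro: order_trans[OF abs_ge_zero])
  finally show "\<bar>Im (1 / z)\<bar> \<le> B / m ^ 2 * \<bar>Im q\<bar>" by simp
qed

text \<open>exp(-2 pi) is the value of q at \<i>; exp(-37 pi / 20) and exp(-sqrt 3 pi) are the
  largest values of |q| for Im \<tau> >= 37/40 and for Im \<tau> >= sqrt 3 / 2.\<close>

lemma exp_2pi_le: "exp (2 * pi) \<le> 5000 / 9"
  and exp_185pi_ge: "exp (37 / 20 * pi) \<ge> 320"
  and exp_sqrt3_pi_ge: "exp (sqrt 3 * pi) \<ge> 225"
  and exp_2pi_ge: "exp (2 * pi) \<ge> 530"
proof -
  have e1: "exp 1 \<le> (2.7182819::real)" "exp 1 \<ge> (2.718::real)"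
    using e_approx_32 unfolding abs_le_iff by (simp_all add: field_simps)
  have pow: "exp (real n) = exp 1 ^ n" for n
    using exp_of_nat_mult[of n "1::real"] by simp
  have "2 * pi \<le> 6 + 0.2832" using pi_approx by simp
  then have "exp (2 * pi) \<le> exp (real 6 + 0.2832)" by simp
  also have "\<dots> = exp 1 ^ 6 * exp 0.2832" unfolding exp_add pow ..
  also have "\<dots> \<le> 2.7182819 ^ 6 * (1 + 0.2832 + 0.2832 ^ 2)"
    by (intro mult_mono power_mono e1 exp_bound) auto
  also have "\<dots> \<le> 5000 / 9" by (simp add: eval_nat_numeral)
  finally show "exp (2 * pi) \<le> 5000 / 9" .
  \<comment> \<open>The quadratic Taylor bound is applied at x / 2 and squared; applied at x = 0.81
    itself it would not reach 320.\<close>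
  have lower: "exp (5 + x) \<ge> 2.718 ^ 5 * (1 + x / 2 + (x / 2) ^ 2 / 2) ^ 2" if "x \<ge> 0" for x :: real
  proof -
    have "exp (5 + x) = exp 1 ^ 5 * exp (x / 2) ^ 2"
      using pow[of 5] exp_of_nat_mult[of 2 "x / 2"] by (simp add: exp_add)
    moreover have "2.718 ^ 5 * (1 + x / 2 + (x / 2) ^ 2 / 2) ^ 2 \<le> exp 1 ^ 5 * exp (x / 2) ^ 2"
      using that by (intro mult_mono power_mono e1 exp_lower_Taylor_quadratic) auto
    ultimately show ?thesis by simp
  qed
  have "320 \<le> exp (5 + 0.81 :: real)" 
    by (rule order_trans[OF _ lower]) (auto simp: eval_nat_numeral)
  also have "\<dots> \<le> exp (37 / 20 * pi)" using pi_approx by simp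
  finally show "exp (37 / 20 * pi) \<ge> 320" .
  have s3: "sqrt 3 \<ge> 1.732" by (rule real_le_rsqrt) (simp add: power2_eq_square)
  have "225 \<le> exp (5 + 0.44 :: real)" 
    by (rule order_trans[OF _ lower]) (auto simp: eval_nat_numeral)
  also have "\<dots> \<le> exp (sqrt 3 * pi)"
  proof -
    have "1.732 * 3.1415 \<le> sqrt 3 * pi" using s3 pi_approx by (intro mult_mono) auto
    then show ?thesis by simp
  qed
  finally show "exp (sqrt 3 * pi) \<ge> 225" .
  have "530 \<le> (2.718::real) ^ 6 * (1 + 0.1415 + 0.1415 ^ 2 / 2) ^ 2" by (simp add: eval_nat_numeral)
  also have "\<dots> \<le> exp 1 ^ 6 * exp 0.1415 ^ 2"
    by (intro mult_mono power_mono e1 exp_lower_Taylor_quadratic) auto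
  also have "\<dots> = exp (real 6 + real 2 * 0.1415)"
    unfolding exp_add pow exp_of_nat_mult ..
  also have "\<dots> \<le> exp (2 * pi)" using pi_approx by simp
  finally show "exp (2 * pi) \<ge> 530" .
qed

text \<open>The constant term of \<open>E6\<close> relative to its other coefficients is read off from \<open>E6(\<i>) = 0\<close>
  (its exact value is \<open>1/504\<close>); this makes the value of \<open>\<zeta>(6)\<close> unnecessary.\<close>

definition eis_const :: real where
  "eis_const = Re (u_series (nome \<i>))"

lemma eis_const_bounds: "0.0018 \<le> eis_const" "eis_const \<le> 0.0021"
  and eis_const_complex: "of_real eis_const = u_series (nome \<i>)"
proof -
  define e where "e = exp (- (2 * pi))"
  have e: "e > 0" "e \<ge> 9 / 5000" "e \<le> 1 / 530"
    unfolding e_def exp_minus using exp_2pi_le exp_2pi_ge by (auto simp: field_simps)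
  have q: "nome \<i> = of_real e" by (simp add: nome_def e_def mult.assoc flip: exp_of_real)
  have "u_series (nome \<i>) = of_real (\<Sum>n. sigma5 n * e ^ n)"
  proof -
    have "summable (\<lambda>n. sigma5 n * e ^ n)"
      using disc_summable_abs[OF disc_summable_sigma5, of e] e sigma5_nonneg by (simp add: abs_of_nonneg)
    then have "(\<lambda>n. complex_of_real (sigma5 n * e ^ n)) sums complex_of_real (\<Sum>n. sigma5 n * e ^ n)"
      by (intro sums_of_real summable_sums)
    then show ?thesis
      by (simp add: u_series_def pws_def q sums_iff flip: of_real_power)
  qed
  then show "of_real eis_const = u_series (nome \<i>)" by (simp add: eis_const_def)
  obtain Tu where Tu: "u_series (nome \<i>) = nome \<i> * (1 + 33 * nome \<i> + 244 * nome \<i> ^ 2 + nome \<i> ^ 3 * Tu)"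
     "norm Tu \<le> 4300"
    using series_expansions[of "nome \<i>"] e by (auto simp: q)
  have "eis_const = e * (1 + 33 * e + 244 * e ^ 2 + e ^ 3 * Re Tu)"
    unfolding eis_const_def Tu(1) unfolding q
    by (simp add: eval_nat_numeral)
  moreover have "\<bar>e ^ 3 * Re Tu\<bar> \<le> (1 / 530) ^ 3 * 4300"
    unfolding abs_mult using e Tu(2) abs_Re_le_cmod[of Tu]
    by (intro mult_mono) (auto intro!: power_mono)
  then have t: "e ^ 3 * Re Tu \<le> 1 / 30000" "e ^ 3 * Re Tu \<ge> - (1 / 30000)"
    unfolding abs_le_iff by (simp_all add: eval_nat_numeral)
  have sq: "e ^ 2 \<ge> 0" by simp
  have "e ^ 2 \<le> (1 / 530) ^ 2" using e by (intro power_mono) auto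
  then have sq': "e ^ 2 \<le> 0.0000036" by (simp add: power2_eq_square)
  \<comment> \<open>With e = exp(-2 pi) between 9/5000 and 1/530, \<open>eis_const\<close> is e
    times a factor \<open>X\<close> slightly above 1.\<close>
  define X where "X = 1 + 33 * e + 244 * e ^ 2 + e ^ 3 * Re Tu"
  have "1 \<le> X" unfolding X_def using e t sq by linarith
  moreover have "X \<le> 1.065" unfolding X_def using e t sq' by simp
  ultimately have X: "eis_const = e * X" "1 \<le> X" "X \<le> 1.065" by (simp_all add: X_def)
  show "0.0018 \<le> eis_const" using mult_mono[of "9/5000" e 1 X] e X by simp
  show "eis_const \<le> 0.0021" using mult_mono[of e "1/530" X "1.065"] e X by simp
qed

theorem E6_expansion:
  obtains K where "K \<noteq> 0" "\<And>\<tau>. Im \<tau> > 0 \<Longrightarrow> E6 \<tau> = K * (of_real eis_const - u_series (nome \<tau>))"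
proof -
  obtain K a :: complex where K: "K \<noteq> 0" "\<And>\<tau>. Im \<tau> > 0 \<Longrightarrow> E6 \<tau> = K * (a - pws sigma5 (nome \<tau>))"
    using E6_q_expansion by blast
  \<comment> \<open>\<i> is fixed by -1 / \<tau>, whose automorphy factor there is \<i>^6 = -1, so
    \<open>E6\<close> vanishes.\<close>
  have "E6 \<i> = \<i> ^ 6 * E6 \<i>" using E6_modular[of 0 0 "-1" 1 \<i>] by simp
  moreover have "\<i> ^ 6 = -1" by (simp add: eval_nat_numeral)
  ultimately have "E6 \<i> = 0" by simp
  with K(2)[of \<i>] K(1) have "a = u_series (nome \<i>)" by (simp add: u_series_def)
  with K show ?thesis by (intro that[of K]) (auto simp: eis_const_complex u_series_def)
qed

text \<open>Both quotients are a / q plus a correction. From a >= 0.0018 and |q| <= 1/320 one has Im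
  (a / q) <= -180 Im q, while the corrections have imaginary parts of at most 35 + 98 and 85 times
  Im q, respectively. The second claim controls h', the third the sign of Re h.\<close>

lemma Im_quotient_neg:
  assumes q: "norm q \<le> 1 / 320" "Im q > 0"
  shows "v_series q \<noteq> 0"
    and "Im ((of_real eis_const - u_series q) * w_series q / v_series q ^ 2) < 0"
    and "Im ((of_real eis_const - u_series q) / v_series q) < 0"
proof -
  define a where "a = eis_const"
  have a: "0.0018 \<le> a" "a \<le> 0.0021" using eis_const_bounds by (auto simp: a_def)
  obtain Tu Tv Tw where T:
    "u_series q = q * (1 + 33 * q + 244 * q ^ 2 + q ^ 3 * Tu)" "norm Tu \<le> 4300" "\<bar>Im Tu\<bar> \<le> 26300 * \<bar>Im q\<bar>"
    "v_series q = q * (1 + 66 * q + 732 * q ^ 2 + q ^ 3 * Tv)" "norm Tv \<le> 17000" "\<bar>Im Tv\<bar> \<le> 105000 * \<bar>Im q\<bar>"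
    "w_series q = q * (1 + 132 * q + 2196 * q ^ 2 + q ^ 3 * Tw)" "norm Tw \<le> 67500" "\<bar>Im Tw\<bar> \<le> 420000 * \<bar>Im q\<bar>"
    using series_expansions[of q] q by auto
  have bu: "im_bound q 4300 26300 Tu" and bv: "im_bound q 17000 105000 Tv" and bw: "im_bound q 67500 420000 Tw"
    using T by (auto simp: im_bound_def)
  have bq: "im_bound q (1/320) 1 q" using q by (intro im_bound_self) auto
  have ba: "im_bound q 0.0021 0 (of_real a)" using a by (intro im_bound_real) auto
  have q0: "q \<noteq> 0" using q by auto
  note ar = im_bound_add im_bound_diff im_bound_mult im_bound_numeral
  \<comment> \<open>\<open>U\<close>, \<open>V\<close> and \<open>W\<close> are the three series
    divided by q; Horner form keeps the bounds accumulated by the \<open>im_bound\<close> rules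
    small.\<close>
  define U where "U = 1 + q * (33 + q * (244 + q * Tu))"
  define V1 where "V1 = 66 + q * (732 + q * Tv)"
  define V where "V = 1 + q * V1"
  define W where "W = 1 + q * (132 + q * (2196 + q * Tw))"
  define D where "D = - 3624 + q * ((Tw - 96624 - 2 * Tv) - q * ((535824 + 132 * Tv) + q * (1464 * Tv + q * (Tv * Tv))))"
  define X where "X = - 33 + q * (- 488 + q * (Tu - Tv))"
  have uq: "u_series q = q * U" and vq: "v_series q = q * V" and wq: "w_series q = q * W"
    unfolding T U_def V_def V1_def W_def by (auto simp: algebra_simps eval_nat_numeral)
  \<comment> \<open>The linear terms of \<open>W\<close> and \<open>V\<^sup>2\<close> agree, which keeps the correction to \<open>a / q - U\<close> small.\<close>
  have WV: "W = V ^ 2 + q ^ 2 * D"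
    unfolding W_def V_def V1_def D_def by (simp add: algebra_simps eval_nat_numeral)
  have UV: "U = V + q * X"
    unfolding U_def V_def V1_def X_def by (simp add: algebra_simps eval_nat_numeral)
  \<comment> \<open>The rules \<open>ar\<close> compute a pair of bounds for the expression;
    \<open>auto\<close> then compares it with the claimed pair.\<close>
  have bU: "im_bound q 1.11 35 U" unfolding U_def
    by (rule im_bound_weaken, (rule ar bq bu)+) auto
  have bV1: "im_bound q 68.6 850 V1" unfolding V1_def
    by (rule im_bound_weaken, (rule ar bq bv)+) auto
  have bV: "im_bound q 1.22 71.3 V" unfolding V_def
    by (rule im_bound_weaken, (rule ar bq bV1)+) auto
  have nV: "norm V \<ge> 0.785"
  proof -
    have "norm (q * V1) \<le> 1 / 320 * 68.6" unfolding norm_mult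
      using q bV1 by (intro mult_mono) (auto simp: im_bound_def)
    then show ?thesis using norm_triangle_ineq2[of 1 "- (q * V1)"] by (simp add: V_def)
  qed
  then have V0: "V \<noteq> 0" by auto
  then show "v_series q \<noteq> 0" using q0 by (simp add: vq)
  have bV': "im_bound q 1.275 116 (1 / V)"
    by (rule im_bound_weaken[OF im_bound_inverse[OF bV nV]]) (auto simp: eval_nat_numeral)
  have bm: "im_bound q A B (- z)" if "im_bound q A B z" for A B z using that by (auto simp: im_bound_def)
  have bD: "im_bound q 4280 219000 D" unfolding D_def
    by (rule im_bound_weaken, (rule ar bm bq bv bw)+) auto
  have bX: "im_bound q 34.8 640 X" unfolding X_def
    by (rule im_bound_weaken, (rule ar bm bq bu bv)+) auto
  \<comment> \<open>By \<open>WV\<close> the quotient is (a - q U) / q times 1 + q^2 D / V^2;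
    \<open>Y\<close> is the contribution of the second summand.\<close>
  define Y where "Y = (of_real a - q * U) * ((q * D) * ((1 / V) * (1 / V)))"
  have bY: "im_bound q 1 98 Y" unfolding Y_def
    by (rule im_bound_weaken, (rule ar bq ba bD bU bV')+) auto
  \<comment> \<open>Obtained from 1 / V = 1 - q V1 / V and U / V = 1 + q X / V.\<close>
  define Z where "Z = of_real a * (V1 * (1 / V)) + q * (X * (1 / V))"
  have bZ: "im_bound q 1 85 Z" unfolding Z_def
    by (rule im_bound_weaken, (rule ar bq ba bX bV1 bV')+) auto
  have Ima: "Im (of_real a / q) \<le> - 180 * Im q"
  proof -
    have "norm q ^ 2 \<le> (1 / 320) ^ 2" using q by (intro power_mono) auto
    then have "180 * norm q ^ 2 \<le> a" using a by (simp add: power2_eq_square)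
    then have "180 * (norm q ^ 2) * Im q \<le> a * Im q" using q by (intro mult_right_mono) auto
    then have "180 * Im q \<le> a * Im q / norm q ^ 2" using q0 by (simp add: field_simps)
    then show ?thesis by (simp add: Im_divide cmod_power2)
  qed
  have "(of_real eis_const - u_series q) * w_series q / v_series q ^ 2 = of_real a / q - U + Y"
    using q0 V0 unfolding uq vq wq WV Y_def a_def[symmetric]
    by (simp add: field_simps) (simp add: algebra_simps eval_nat_numeral)?
  moreover have "\<bar>Im U\<bar> \<le> 35 * Im q" "\<bar>Im Y\<bar> \<le> 98 * Im q" using bU bY q by (auto simp: im_bound_def)
  ultimately show "Im ((of_real eis_const - u_series q) * w_series q / v_series q ^ 2) < 0"
    using Ima q by simp
  have "(of_real eis_const - u_series q) / v_series q = of_real a / q - 1 - Z"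
    using q0 V0 unfolding uq vq Z_def a_def[symmetric] UV
    by (simp add: field_simps) (simp add: V_def algebra_simps)?
  moreover have "\<bar>Im Z\<bar> \<le> 85 * Im q" using bZ q by (auto simp: im_bound_def)
  ultimately show "Im ((of_real eis_const - u_series q) / v_series q) < 0"
    using Ima q by simp
qed

section \<open>The equivariant function\<close>

text \<open>On the upper half-plane this is \<open>E6\<close> divided by the constant
  \<open>K\<close> of \<open>E6_expansion\<close>.\<close>

definition nE6 :: "complex \<Rightarrow> complex" where
  "nE6 \<tau> = of_real eis_const - u_series (nome \<tau>)"

definition nE6' :: "complex \<Rightarrow> complex" where
  "nE6' \<tau> = - (2 * of_real pi * \<i>) * v_series (nome \<tau>)"

text \<open>The numerator of h over the denominator \<open>nE6'\<close>. The pair is kept apart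
  because it transforms linearly under SL(2,Z) and includes the critical points, where h is
  \<infinity>.\<close>

definition eqN :: "complex \<Rightarrow> complex" where
  "eqN \<tau> = \<tau> * nE6' \<tau> + 6 * nE6 \<tau>"

text \<open>At a critical point the value is the default 0 of division by zero, not
  \<infinity>.\<close>

definition eqh :: "complex \<Rightarrow> complex" where
  "eqh \<tau> = eqN \<tau> / nE6' \<tau>"

text \<open>This is h' = 7 - 6 E E'' / E'^2 for E = \<open>nE6\<close>, with E' and E'' expressed by
  \<open>v_series\<close> and \<open>w_series\<close>.\<close>

definition eqh' :: "complex \<Rightarrow> complex" where
  "eqh' \<tau> = 7 + 6 * (nE6 \<tau> * w_series (nome \<tau>) / v_series (nome \<tau>) ^ 2)"

text \<open>The set where h is real or \<infinity>, in homogeneous form: for M nonzero, N / M is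
  real exactly if N cnj M is, and M = 0 is included.\<close>

definition real_locus :: "complex set" where
  "real_locus = {\<tau>. Im \<tau> > 0 \<and> Im (eqN \<tau> * cnj (nE6' \<tau>)) = 0}"

lemma has_field_derivative_nE6:
  assumes "Im \<tau> > 0"
  shows "(nE6 has_field_derivative nE6' \<tau>) (at \<tau>)"
proof -
  have "((\<lambda>\<tau>. u_series (nome \<tau>)) has_field_derivative 2 * of_real pi * \<i> * v_series (nome \<tau>)) (at \<tau>)"
    unfolding u_series_def v_series_def by (rule has_field_derivative_pws_nome[OF disc_summable_sigma5 assms])
  then show ?thesis unfolding nE6_def[abs_def] nE6'_def by (auto intro!: derivative_eq_intros)
qed

lemma has_field_derivative_nE6':
  assumes "Im \<tau> > 0"
  shows "(nE6' has_field_derivative - ((2 * of_real pi * \<i>) ^ 2) * w_series (nome \<tau>)) (at \<tau>)"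
proof -
  have "((\<lambda>\<tau>. v_series (nome \<tau>)) has_field_derivative 2 * of_real pi * \<i> * w_series (nome \<tau>)) (at \<tau>)"
    unfolding v_series_def w_series_def
    by (rule has_field_derivative_pws_nome[OF disc_summable_times_n[OF disc_summable_sigma5] assms])
  from DERIV_cmult[OF this, of "- (2 * of_real pi * \<i>)"] show ?thesis
    unfolding nE6'_def[abs_def] by (simp add: power2_eq_square mult.assoc)
qed

lemma has_field_derivative_eqh:
  assumes "Im \<tau> > 0" "nE6' \<tau> \<noteq> 0"
  shows "(eqh has_field_derivative eqh' \<tau>) (at \<tau>)"
proof -
  have v: "v_series (nome \<tau>) \<noteq> 0" using assms by (auto simp: nE6'_def)
  have "(eqh has_field_derivative
      ((1 * nE6' \<tau> + - ((2 * of_real pi * \<i>) ^ 2) * w_series (nome \<tau>) * \<tau> + 6 * nE6' \<tau>) * nE6' \<tau>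
        - eqN \<tau> * (- ((2 * of_real pi * \<i>) ^ 2) * w_series (nome \<tau>))) / (nE6' \<tau> * nE6' \<tau>)) (at \<tau>)"
    unfolding eqh_def[abs_def] eqN_def[abs_def]
    by (intro DERIV_divide DERIV_add DERIV_mult DERIV_cmult DERIV_ident
        has_field_derivative_nE6 has_field_derivative_nE6' assms)
  also have "((1 * nE6' \<tau> + - ((2 * of_real pi * \<i>) ^ 2) * w_series (nome \<tau>) * \<tau> + 6 * nE6' \<tau>) * nE6' \<tau>
        - eqN \<tau> * (- ((2 * of_real pi * \<i>) ^ 2) * w_series (nome \<tau>))) / (nE6' \<tau> * nE6' \<tau>)
      = 7 + 6 * ((2 * of_real pi * \<i>) ^ 2 * nE6 \<tau> * w_series (nome \<tau>)) / (nE6' \<tau> * nE6' \<tau>)"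
    using assms(2) unfolding eqN_def by (simp add: field_simps)
  also have "\<dots> = eqh' \<tau>"
    using v by (simp add: eqh'_def nE6'_def power2_eq_square)
  finally show ?thesis .
qed

lemma eqh_eq:
  assumes "nE6' \<tau> \<noteq> 0"
  shows "eqh \<tau> = \<tau> + 3 * \<i> / of_real pi * (nE6 \<tau> / v_series (nome \<tau>))"
proof -
  have v: "v_series (nome \<tau>) \<noteq> 0" using assms by (auto simp: nE6'_def)
  show ?thesis using assms v
    by (simp add: eqh_def eqN_def add_divide_distrib) (simp add: nE6'_def field_simps)
qed

lemma E6_critical_iff:
  assumes "Im \<tau> > 0"
  shows "(E6 has_field_derivative 0) (at \<tau>) \<longleftrightarrow> nE6' \<tau> = 0"
proof -
  obtain K where K: "K \<noteq> 0" "\<And>\<tau>. Im \<tau> > 0 \<Longrightarrow> E6 \<tau> = K * nE6 \<tau>"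
    using E6_expansion unfolding nE6_def by metis
  have "eventually (\<lambda>w. Im w > 0) (nhds \<tau>)"
    using assms by (intro eventually_nhds_in_open[of "{w. Im w > 0}", simplified]) (auto simp: open_halfspace_Im_gt)
  then have ev: "eventually (\<lambda>w. E6 w = K * nE6 w) (nhds \<tau>)"
    by (rule eventually_mono) (rule K(2))
  have "((\<lambda>w. K * nE6 w) has_field_derivative K * nE6' \<tau>) (at \<tau>)"
    by (rule DERIV_cmult[OF has_field_derivative_nE6[OF assms]])
  then have d: "(E6 has_field_derivative K * nE6' \<tau>) (at \<tau>)"
    by (subst DERIV_cong_ev[OF refl ev refl])
  show ?thesis
  proof
    assume "(E6 has_field_derivative 0) (at \<tau>)"
    from DERIV_unique[OF this d] show "nE6' \<tau> = 0" using K(1) by simp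
  qed (use d in simp)
qed

section \<open>Equivariance under the modular group and under reflection\<close>

lemma moebius_denominator_nonzero:
  fixes a b c d :: int
  assumes "a * d - b * c = 1" "Im \<tau> > 0"
  shows "of_int c * \<tau> + of_int d \<noteq> 0"
proof
  assume "of_int c * \<tau> + of_int d = 0"
  then have "of_int c * Im \<tau> = 0" "of_int c * Re \<tau> + of_int d = 0" by (auto simp: complex_eq_iff)
  with assms have "c = 0" "d = 0" by auto
  with assms show False by simp
qed

lemma Im_moebius:
  fixes a b c d :: int
  assumes "a * d - b * c = 1"
  shows "Im ((of_int a * \<tau> + of_int b) / (of_int c * \<tau> + of_int d))
     = Im \<tau> / norm (of_int c * \<tau> + of_int d) ^ 2"
proof -
  have 1: "of_int a * of_int d = 1 + of_int b * (of_int c :: real)"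
    using assms by (metis add.commute diff_add_cancel of_int_1 of_int_add of_int_mult)
  have "Im (of_int a * \<tau> + of_int b) * Re (of_int c * \<tau> + of_int d)
      - Re (of_int a * \<tau> + of_int b) * Im (of_int c * \<tau> + of_int d) = (of_int a * of_int d - of_int b * of_int c) * Im \<tau>"
    by (simp add: algebra_simps)
  also have "\<dots> = Im \<tau>" by (simp add: 1)
  finally show ?thesis by (simp add: Im_divide cmod_power2)
qed

text \<open>The equivariance of h without division: the vector of \<open>eqN\<close> and
  \<open>nE6'\<close> is multiplied by the matrix and by j^7. It results from differentiating
  E6(\<gamma> \<tau>) = j^6 E6(\<tau>), where \<gamma> has derivative j^(-2); the weight 6 is the
  origin of the factor 6 in \<open>eqN\<close>.\<close>

lemma nE6_moebius:
  fixes a b c d :: int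
  assumes "a * d - b * c = 1" "Im \<tau> > 0"
  defines "j \<equiv> of_int c * \<tau> + of_int d" and "\<tau>' \<equiv> (of_int a * \<tau> + of_int b) / (of_int c * \<tau> + of_int d)"
  shows "nE6' \<tau>' = j ^ 7 * (of_int c * eqN \<tau> + of_int d * nE6' \<tau>)"
    and "eqN \<tau>' = j ^ 7 * (of_int a * eqN \<tau> + of_int b * nE6' \<tau>)"
proof -
  define m where "m = (\<lambda>\<tau>. (of_int a * \<tau> + of_int b) / (of_int c * \<tau> + of_int d :: complex))"
  have m: "\<tau>' = m \<tau>" by (simp add: m_def \<tau>'_def)
  have im: "Im (m w) > 0" if "Im w > 0" for w
    unfolding m_def Im_moebius[OF assms(1)] using that moebius_denominator_nonzero[OF assms(1) that] by simp
  obtain K where K: "K \<noteq> 0" "\<And>\<tau>. Im \<tau> > 0 \<Longrightarrow> E6 \<tau> = K * nE6 \<tau>"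
    using E6_expansion unfolding nE6_def by metis
  have md: "nE6 (m w) = (of_int c * w + of_int d) ^ 6 * nE6 w" if "Im w > 0" for w
    using E6_modular[OF assms(1) that] K(2)[OF that] K(2)[OF im[OF that]] K(1) by (simp add: m_def)
  have j: "j \<noteq> 0" unfolding j_def by (rule moebius_denominator_nonzero[OF assms(1,2)])
  have det: "of_int a * of_int d - of_int b * of_int c = (1::complex)"
    using assms(1) by (metis of_int_1 of_int_diff of_int_mult)
  have dm: "(m has_field_derivative 1 / j ^ 2) (at \<tau>)"
  proof -
    have "(m has_field_derivative ((of_int a * 1 + 0) * j - (of_int a * \<tau> + of_int b) * (of_int c * 1 + 0)) / (j * j)) (at \<tau>)"
      unfolding m_def j_def
      by (intro DERIV_divide DERIV_add DERIV_cmult DERIV_ident DERIV_const) (use j in \<open>simp add: j_def\<close>)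
    also have "((of_int a * 1 + 0) * j - (of_int a * \<tau> + of_int b) * (of_int c * 1 + 0)) = 1"
      using det by (simp add: j_def algebra_simps)
    finally show ?thesis by (simp add: power2_eq_square)
  qed
  have d1: "((\<lambda>w. nE6 (m w)) has_field_derivative nE6' (m \<tau>) * (1 / j ^ 2)) (at \<tau>)"
    by (rule DERIV_chain2[OF has_field_derivative_nE6[OF im[OF assms(2)]] dm])
  have d2: "((\<lambda>w. (of_int c * w + of_int d) ^ 6 * nE6 w) has_field_derivative
      6 * of_int c * j ^ 5 * nE6 \<tau> + j ^ 6 * nE6' \<tau>) (at \<tau>)"
    unfolding j_def using has_field_derivative_nE6[OF assms(2)]
    by (auto intro!: derivative_eq_intros)
  have "eventually (\<lambda>w. Im w > 0) (nhds \<tau>)"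
    using assms by (intro eventually_nhds_in_open[of "{w. Im w > 0}", simplified]) (auto simp: open_halfspace_Im_gt)
  then have ev: "eventually (\<lambda>w. nE6 (m w) = (of_int c * w + of_int d) ^ 6 * nE6 w) (nhds \<tau>)"
    by (rule eventually_mono) (rule md)
  have "((\<lambda>w. nE6 (m w)) has_field_derivative 6 * of_int c * j ^ 5 * nE6 \<tau> + j ^ 6 * nE6' \<tau>) (at \<tau>)"
    using d2 by (subst DERIV_cong_ev[OF refl ev refl])
  from DERIV_unique[OF d1 this]
  have "nE6' (m \<tau>) = j ^ 2 * (6 * of_int c * j ^ 5 * nE6 \<tau> + j ^ 6 * nE6' \<tau>)"
    using j by (simp add: field_simps)
  also have "\<dots> = j ^ 7 * (6 * of_int c * nE6 \<tau> + j * nE6' \<tau>)"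
    by (simp add: algebra_simps eval_nat_numeral)
  also have "6 * of_int c * nE6 \<tau> + j * nE6' \<tau> = of_int c * eqN \<tau> + of_int d * nE6' \<tau>"
    by (simp add: eqN_def j_def algebra_simps)
  finally show M: "nE6' \<tau>' = j ^ 7 * (of_int c * eqN \<tau> + of_int d * nE6' \<tau>)" by (simp add: m)
  have mj: "m \<tau> * j = of_int a * \<tau> + of_int b" using j by (simp add: m_def j_def)
  have "eqN \<tau>' = j ^ 6 * ((m \<tau> * j) * (of_int c * eqN \<tau> + of_int d * nE6' \<tau>) + 6 * nE6 \<tau>)"
    unfolding eqN_def[of \<tau>'] M md[OF assms(2), folded m j_def]
    by (simp add: m algebra_simps eval_nat_numeral)
  also have "(m \<tau> * j) * (of_int c * eqN \<tau> + of_int d * nE6' \<tau>) + 6 * nE6 \<tau> =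
     j * (of_int a * eqN \<tau> + of_int b * nE6' \<tau>)"
  proof -
    have "(of_int a * \<tau> + of_int b) * (of_int c * eqN \<tau> + of_int d * nE6' \<tau>) - j * (of_int a * eqN \<tau> + of_int b * nE6' \<tau>)
      = (of_int a * of_int d - of_int b * of_int c) * (\<tau> * nE6' \<tau> - eqN \<tau>)"
      unfolding j_def by (simp add: algebra_simps)
    also have "\<dots> = - 6 * nE6 \<tau>" unfolding det by (simp add: eqN_def)
    finally show ?thesis unfolding mj by (simp add: algebra_simps)
  qed
  finally show "eqN \<tau>' = j ^ 7 * (of_int a * eqN \<tau> + of_int b * nE6' \<tau>)"
    by (simp add: mult.assoc[symmetric] power_Suc2[symmetric] del: power_Suc)
qed

text \<open>A real matrix preserves the real projective line: Im (N cnj M) is multiplied by the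
  determinant and by |j^7|^2.\<close>

lemma real_locus_moebius:
  fixes a b c d :: int
  assumes "a * d - b * c = 1" "Im \<tau> > 0"
  shows "(of_int a * \<tau> + of_int b) / (of_int c * \<tau> + of_int d) \<in> real_locus \<longleftrightarrow> \<tau> \<in> real_locus"
proof -
  define j where "j = of_int c * \<tau> + of_int d"
  have j: "j \<noteq> 0" unfolding j_def by (rule moebius_denominator_nonzero[OF assms])
  define N M where "N = eqN \<tau>" and "M = nE6' \<tau>"
  have 1: "of_int a * of_int d = 1 + of_int b * (of_int c :: real)"
    using assms by (metis add.commute diff_add_cancel of_int_1 of_int_add of_int_mult)
  have *: "Im ((j ^ 7 * (of_int a * N + of_int b * M)) * cnj (j ^ 7 * (of_int c * N + of_int d * M)))
     = norm (j ^ 7) ^ 2 * Im (N * cnj M)"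
  proof -
    have "(j ^ 7 * (of_int a * N + of_int b * M)) * cnj (j ^ 7 * (of_int c * N + of_int d * M))
      = (j ^ 7 * cnj (j ^ 7)) * ((of_int a * N + of_int b * M) * cnj (of_int c * N + of_int d * M))"
      by simp
    also have "j ^ 7 * cnj (j ^ 7) = of_real (norm (j ^ 7) ^ 2)" by (metis complex_norm_square)
    also have "Im (of_real (norm (j ^ 7) ^ 2) * ((of_int a * N + of_int b * M) * cnj (of_int c * N + of_int d * M)))
      = norm (j ^ 7) ^ 2 * Im ((of_int a * N + of_int b * M) * cnj (of_int c * N + of_int d * M))"
      by (simp only: times_complex.sel Re_complex_of_real Im_complex_of_real mult_zero_left add_0_right)
    also have "Im ((of_int a * N + of_int b * M) * cnj (of_int c * N + of_int d * M))
       = (of_int a * of_int d - of_int b * of_int c) * Im (N * cnj M)"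
      by (simp add: algebra_simps)
    also have "\<dots> = Im (N * cnj M)" by (simp add: 1)
    finally show ?thesis .
  qed
  define \<tau>' where "\<tau>' = (of_int a * \<tau> + of_int b) / (of_int c * \<tau> + of_int d)"
  have "Im \<tau>' > 0"
    unfolding \<tau>'_def Im_moebius[OF assms(1)] using j assms(2) by (simp flip: j_def)
  moreover have "eqN \<tau>' * cnj (nE6' \<tau>') =
      (j ^ 7 * (of_int a * N + of_int b * M)) * cnj (j ^ 7 * (of_int c * N + of_int d * M))"
    unfolding \<tau>'_def nE6_moebius[OF assms] j_def N_def M_def ..
  ultimately show ?thesis
    unfolding real_locus_def mem_Collect_eq \<tau>'_def[symmetric] using j assms(2) * 
    by (simp only: N_def[symmetric] M_def[symmetric] mult_eq_0_iff) simp
qed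

lemma pws_cnj: "disc_summable c \<Longrightarrow> norm q < 1 \<Longrightarrow> pws c (cnj q) = cnj (pws c q)"
proof -
  assume "disc_summable c" "norm q < 1"
  then have "(\<lambda>n. of_real (c n) * q ^ n) sums pws c q"
    unfolding disc_summable_def pws_def by (simp add: summable_sums)
  then have "(\<lambda>n. cnj (of_real (c n) * q ^ n)) sums cnj (pws c q)" by (simp only: sums_cnj)
  then show ?thesis unfolding pws_def by (simp add: sums_iff)
qed

lemma nome_reflect: "nome (- cnj \<tau>) = cnj (nome \<tau>)"
  by (simp add: nome_def exp_cnj)

text \<open>The coefficients are real, and q at -cnj \<tau> is the conjugate of q at \<tau>.\<close>

lemma nE6_reflect:
  assumes "Im \<tau> > 0"
  shows "nE6 (- cnj \<tau>) = cnj (nE6 \<tau>)" "nE6' (- cnj \<tau>) = - cnj (nE6' \<tau>)" "eqN (- cnj \<tau>) = cnj (eqN \<tau>)"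
    and "eqh' (- cnj \<tau>) = cnj (eqh' \<tau>)"
proof -
  have q: "norm (nome \<tau>) < 1" by (rule norm_nome_less_1[OF assms])
  note d = disc_summable_sigma5 disc_summable_times_n[OF disc_summable_sigma5]
    disc_summable_times_n[OF disc_summable_times_n[OF disc_summable_sigma5]]
  show 1: "nE6 (- cnj \<tau>) = cnj (nE6 \<tau>)" "nE6' (- cnj \<tau>) = - cnj (nE6' \<tau>)"
    unfolding nE6_def nE6'_def nome_reflect u_series_def v_series_def using pws_cnj[OF _ q] d by auto
  show "eqN (- cnj \<tau>) = cnj (eqN \<tau>)" unfolding eqN_def 1 by simp
  show "eqh' (- cnj \<tau>) = cnj (eqh' \<tau>)"
    unfolding eqh'_def 1 nome_reflect v_series_def w_series_def using pws_cnj[OF _ q] d by auto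
qed

text \<open>1 / cnj \<tau> is -1 / \<sigma> at the reflected point \<sigma> = -cnj \<tau>. Numerator
  and denominator trade places, so h becomes 1 / cnj h.\<close>

lemma eqN_inversion:
  assumes "Im \<tau> > 0"
  shows "eqN (inverse (cnj \<tau>)) = - (cnj \<tau> ^ 7 * cnj (nE6' \<tau>))"
    and "nE6' (inverse (cnj \<tau>)) = - (cnj \<tau> ^ 7 * cnj (eqN \<tau>))"
proof -
  have i: "Im (- cnj \<tau>) > 0" using assms by simp
  have e: "(of_int 0 * (- cnj \<tau>) + of_int (-1)) / (of_int 1 * (- cnj \<tau>) + of_int 0) = inverse (cnj \<tau>)"
    by (simp add: field_simps)
  note m = nE6_moebius[of 0 0 "-1" 1 "- cnj \<tau>", OF _ i, unfolded e nE6_reflect[OF assms]]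
  show "eqN (inverse (cnj \<tau>)) = - (cnj \<tau> ^ 7 * cnj (nE6' \<tau>))"
    "nE6' (inverse (cnj \<tau>)) = - (cnj \<tau> ^ 7 * cnj (eqN \<tau>))"
    using m by simp_all
qed

section \<open>The equivariant function near the cusp\<close>

text \<open>The remainder after the main term a / q, for all arguments of q. On the larger disc the
  part of \<open>Z\<close> carrying the factor a has nonnegative real part, so only q X / V counts
  against the lower bound for \<open>Re Z\<close>.\<close>

lemma quotient_expansion:
  assumes q: "norm q \<le> 1 / 225" "q \<noteq> 0"
  obtains Z where "v_series q \<noteq> 0"
    "(of_real eis_const - u_series q) / v_series q = of_real eis_const / q - 1 - Z"
    "Re Z \<ge> - (23/100)" "norm q \<le> 1 / 320 \<Longrightarrow> norm Z \<le> (33/100)"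
proof -
  define a where "a = eis_const"
  have a: "(9/5000) \<le> a" "a \<le> (21/10000)" using eis_const_bounds by (auto simp: a_def)
  obtain Tu Tv where T:
    "u_series q = q * (1 + 33 * q + 244 * q ^ 2 + q ^ 3 * Tu)" "norm Tu \<le> 4300"
    "v_series q = q * (1 + 66 * q + 732 * q ^ 2 + q ^ 3 * Tv)" "norm Tv \<le> 17000"
    using series_expansions[OF q(1)] by metis
  define E where "E = q * (732 + q * Tv)"
  define V where "V = 1 + q * (66 + E)"
  define X where "X = - 33 + q * (- 488 + q * (Tu - Tv))"
  define Z where "Z = of_real a * ((66 + E) / V) + q * X / V"
  have uq: "u_series q = q * (V + q * X)" and vq: "v_series q = q * V"
    unfolding T V_def X_def E_def by (auto simp: algebra_simps eval_nat_numeral)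
  have bnd: "norm E \<le> r * (732 + r * 17000) \<and> norm X \<le> 33 + r * (488 + r * 21300)
      \<and> norm (V - 1) \<le> r * (66 + r * (732 + r * 17000))" if r: "norm q \<le> r" for r
  proof -
    have r0: "r \<ge> 0" using r norm_ge_zero order_trans by blast
    have 1: "norm (732 + q * Tv) \<le> 732 + r * 17000"
      using norm_triangle_ineq[of 732 "q * Tv"] mult_mono[OF r T(4)] r0 by (simp add: norm_mult)
    then have E: "norm E \<le> r * (732 + r * 17000)"
      unfolding E_def norm_mult using r r0 by (intro mult_mono) auto
    then have "norm (66 + E) \<le> 66 + r * (732 + r * 17000)" using norm_triangle_ineq[of 66 E] by simp
    then have V: "norm (V - 1) \<le> r * (66 + r * (732 + r * 17000))"
      unfolding V_def using r r0 by (auto simp: norm_mult intro!: mult_mono)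
    have "norm (Tu - Tv) \<le> 21300" using norm_triangle_ineq4[of Tu Tv] T by simp
    then have "norm (q * (Tu - Tv)) \<le> r * 21300" unfolding norm_mult using r r0 by (intro mult_mono) auto
    then have "norm (- 488 + q * (Tu - Tv)) \<le> 488 + r * 21300"
      using norm_triangle_ineq[of "- 488" "q * (Tu - Tv)"] by simp
    then have "norm (q * (- 488 + q * (Tu - Tv))) \<le> r * (488 + r * 21300)" 
      unfolding norm_mult using r r0 by (intro mult_mono) auto
    then have "norm X \<le> 33 + r * (488 + r * 21300)"
      unfolding X_def using norm_triangle_ineq[of "- 33" "q * (- 488 + q * (Tu - Tv))"] by simp
    with E V show ?thesis by simp
  qed
  note b = bnd[OF q(1)]
  have nE: "norm E \<le> (18/5)" and nX: "norm X \<le> (178/5)" and nV1: "norm (V - 1) \<le> (619/2000)"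
    using b by auto
  have nV: "norm V \<ge> (1381/2000)" using nV1 norm_triangle_ineq2[of 1 "1 - V"] by (simp add: norm_minus_commute)
  have V0: "V \<noteq> 0" using nV by auto
  show ?thesis
  proof (rule that[of Z])
    show "v_series q \<noteq> 0" using V0 q by (simp add: vq)
    show "(of_real eis_const - u_series q) / v_series q = of_real eis_const / q - 1 - Z"
      using q V0 unfolding uq vq Z_def a_def[symmetric]
      by (simp add: field_simps) (simp add: V_def algebra_simps)?
    have ReV: "Re V \<ge> (69/100)" using nV1 abs_Re_le_cmod[of "V - 1"] by simp
    have nV': "norm V \<le> (131/100)" using nV1 norm_triangle_ineq[of 1 "V - 1"] by simp
    \<comment> \<open>The real part of (66 + E) / V has the sign of that of (66 + E) cnj V, where 66
      Re V > 45 outweighs an error of at most 4.72.\<close>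
    have "\<bar>Re (E * cnj V)\<bar> \<le> (18/5) * (131/100)"
      using abs_Re_le_cmod[of "E * cnj V"] mult_mono[OF nE nV'] by (simp add: norm_mult)
    moreover have "(18/5) * (131/100) \<le> ((118/25) :: real)" by simp
    ultimately have "Re (E * cnj V) \<ge> - (118/25)" by linarith
    moreover have "Re ((66 + E) * cnj V) = 66 * Re V + Re (E * cnj V)" by (simp add: algebra_simps)
    ultimately have "Re ((66 + E) * cnj V) \<ge> 0" using ReV by linarith
    then have "Re ((66 + E) / V) \<ge> 0" by (simp add: Re_complex_div_ge_0)
    then have "Re (of_real a * ((66 + E) / V)) \<ge> 0" using a by (simp del: times_divide_eq_right)
    moreover have "norm (q * X / V) \<le> (1 / 225 * (178/5)) / (1381/2000)"
      unfolding norm_divide norm_mult using q nX nV by (intro frac_le mult_mono) auto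
    then have "Re (q * X / V) \<ge> - (23/100)" using abs_Re_le_cmod[of "q * X / V"] by simp
    ultimately show "Re Z \<ge> - (23/100)" unfolding Z_def plus_complex.sel by linarith
    assume q': "norm q \<le> 1 / 320"
    note b = bnd[OF q']
    have nE: "norm E \<le> (13/5)" and nX: "norm X \<le> (174/5)" and nV1: "norm (V - 1) \<le> (43/200)"
      using b by auto
    have nV: "norm V \<ge> (157/200)" using nV1 norm_triangle_ineq2[of 1 "1 - V"] by (simp add: norm_minus_commute)
    have n66: "norm (66 + E) \<le> (343/5)" using norm_triangle_ineq[of 66 E] nE by simp
    have "norm (of_real a * ((66 + E) / V)) \<le> (21/10000) * ((343/5) / (157/200))"
      unfolding norm_divide norm_mult using a nV n66 by (intro frac_le mult_mono) auto
    moreover have "norm (q * X / V) \<le> (1 / 320 * (174/5)) / (157/200)"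
      unfolding norm_divide norm_mult using q' nX nV by (intro frac_le mult_mono) auto
    ultimately show "norm Z \<le> (33/100)"
      unfolding Z_def using norm_triangle_ineq[of "of_real a * ((66 + E) / V)" "q * X / V"] by simp
  qed
qed

lemma Im_nome: "Im (nome \<tau>) = exp (- (2 * pi * Im \<tau>)) * sin (2 * pi * Re \<tau>)"
  by (simp add: nome_def Im_exp)

lemma Re_inverse_nome: "Re (of_real a / nome \<tau>) = a * exp (2 * pi * Im \<tau>) * cos (2 * pi * Re \<tau>)"
proof -
  have "of_real a / nome \<tau> = of_real a * exp (- (2 * of_real pi * \<i> * \<tau>))"
    by (simp add: nome_def exp_minus field_simps)
  then show ?thesis by (simp add: Re_exp)
qed

lemma norm_nome_le:
  assumes "Im \<tau> \<ge> (37/40)"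
  shows "norm (nome \<tau>) \<le> 1 / 320"
proof -
  have "320 \<le> exp (2 * pi * Im \<tau>)"
    by (rule order_trans[OF exp_185pi_ge]) (use assms in simp)
  then show ?thesis unfolding norm_nome exp_minus by (simp add: field_simps)
qed

text \<open>For 0 < Re \<tau> < 1/2 the point q lies in the open upper half-plane, so
  \<open>Im_quotient_neg\<close> applies.\<close>

lemma eqh_strip:
  assumes "Im \<tau> \<ge> (37/40)" "0 < Re \<tau>" "Re \<tau> < 1 / 2"
  shows "nE6' \<tau> \<noteq> 0" "Im (eqh' \<tau>) < 0" "Re (eqh \<tau>) > 0"
proof -
  have "sin (2 * pi * Re \<tau>) > 0" using assms by (intro sin_gt_zero) auto
  then have "Im (nome \<tau>) > 0" by (simp add: Im_nome)
  note I = Im_quotient_neg[OF norm_nome_le[OF assms(1)] this]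
  show n: "nE6' \<tau> \<noteq> 0" using I(1) by (simp add: nE6'_def)
  show "Im (eqh' \<tau>) < 0" 
  proof -
    define z where "z = nE6 \<tau> * w_series (nome \<tau>) / v_series (nome \<tau>) ^ 2"
    have "Im z < 0" using I(2) by (simp add: z_def nE6_def)
    then show ?thesis unfolding eqh'_def z_def[symmetric] by simp
  qed
  have "Re (eqh \<tau>) = Re \<tau> - 3 / pi * Im (nE6 \<tau> / v_series (nome \<tau>))"
  proof -
    have 1: "3 * \<i> / complex_of_real pi = of_real (3 / pi) * \<i>" by simp
    have 2: "Re (of_real c * \<i> * z) = - c * Im z" for c z by simp
    show ?thesis unfolding eqh_eq[OF n] 1 plus_complex.sel 2 by simp
  qed
  moreover have "3 / pi * Im (nE6 \<tau> / v_series (nome \<tau>)) < 0"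
    using I(3) unfolding nE6_def by (intro mult_pos_neg) auto
  ultimately show "Re (eqh \<tau>) > 0" using assms by simp
qed

lemma Im_eqh_eq:
  assumes "Im \<tau> \<ge> sqrt 3 / 2"
  obtains Z where "nE6' \<tau> \<noteq> 0"
    "eqh \<tau> = \<tau> + 3 * \<i> / of_real pi * (of_real eis_const / nome \<tau> - 1 - Z)"
    "Im (eqh \<tau>) = Im \<tau> + 3 / pi * (eis_const * exp (2 * pi * Im \<tau>) * cos (2 * pi * Re \<tau>) - 1 - Re Z)"
    "Re Z \<ge> - (23/100)" "Im \<tau> \<ge> (37/40) \<Longrightarrow> norm Z \<le> (33/100)"
proof -
  have "225 \<le> exp (2 * pi * Im \<tau>)"
    by (rule order_trans[OF exp_sqrt3_pi_ge]) (use assms in simp)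
  then have q: "norm (nome \<tau>) \<le> 1 / 225" unfolding norm_nome exp_minus by (simp add: field_simps)
  obtain Z where Z: "v_series (nome \<tau>) \<noteq> 0"
    "(of_real eis_const - u_series (nome \<tau>)) / v_series (nome \<tau>) = of_real eis_const / nome \<tau> - 1 - Z"
    "Re Z \<ge> - (23/100)" "norm (nome \<tau>) \<le> 1 / 320 \<Longrightarrow> norm Z \<le> (33/100)"
    using quotient_expansion[OF q nome_nonzero] by blast
  have n: "nE6' \<tau> \<noteq> 0" using Z(1) by (simp add: nE6'_def)
  have e: "eqh \<tau> = \<tau> + 3 * \<i> / of_real pi * (of_real eis_const / nome \<tau> - 1 - Z)"
    unfolding eqh_eq[OF n] nE6_def Z(2) ..
  have 1: "3 * \<i> / complex_of_real pi = of_real (3 / pi) * \<i>" by simp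
  have 2: "Im (of_real c * \<i> * z) = c * Re z" for c z by simp
  have "Im (eqh \<tau>) = Im \<tau> + 3 / pi * Re (of_real eis_const / nome \<tau> - 1 - Z)"
    unfolding e 1 plus_complex.sel 2 ..
  then have "Im (eqh \<tau>) = Im \<tau> + 3 / pi * (eis_const * exp (2 * pi * Im \<tau>) * cos (2 * pi * Re \<tau>) - 1 - Re Z)"
    unfolding minus_complex.sel Re_inverse_nome by simp
  with n e Z(3,4) norm_nome_le show ?thesis by (intro that[of Z]) auto
qed

lemma three_div_pi_bounds: "3 / pi \<ge> (9549/10000)" "3 / pi \<le> (191/200)"
  using pi_approx by (simp_all add: field_simps)

text \<open>Below height 37/40 a point with |\<tau>| >= 1 has Re \<tau> >= 3/8, so the cosine is at
  most -0.7 and the exponential term is negative. The bracket in the formula for Im h is then at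
  most -1.05, and (3 / pi) 1.05 > 1 exceeds Im \<tau>.\<close>

lemma Im_eqh_neg_low:
  assumes "Im \<tau> > 0" "0 \<le> Re \<tau>" "Re \<tau> \<le> 1 / 2" "norm \<tau> \<ge> 1" "Im \<tau> \<le> (37/40)"
  shows "Im \<tau> \<ge> sqrt 3 / 2" "Im (eqh \<tau>) < 0"
proof -
  have n: "Re \<tau> ^ 2 + Im \<tau> ^ 2 \<ge> 1"
    using assms(4) power_mono[OF assms(4), of 2] by (simp add: cmod_power2)
  have "Re \<tau> ^ 2 \<le> (1 / 2) ^ 2" using assms by (intro power_mono) auto
  then have "(sqrt 3 / 2) ^ 2 \<le> Im \<tau> ^ 2" using n by (simp add: power_divide)
  then show y: "Im \<tau> \<ge> sqrt 3 / 2" by (rule power2_le_imp_le) (rule less_imp_le[OF assms(1)])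
  have "Im \<tau> ^ 2 \<le> (37/40) ^ 2" using assms by (intro power_mono) auto
  then have "(3 / 8) ^ 2 \<le> Re \<tau> ^ 2" using n by (simp add: power2_eq_square)
  then have x: "Re \<tau> \<ge> 3 / 8" by (rule power2_le_imp_le) (rule assms(2))
  obtain Z where Z: "Im (eqh \<tau>) = Im \<tau> + 3 / pi * (eis_const * exp (2 * pi * Im \<tau>) * cos (2 * pi * Re \<tau>) - 1 - Re Z)"
    "Re Z \<ge> - (23/100)" using Im_eqh_eq[OF y] by metis
  have "cos (2 * pi * Re \<tau>) \<le> cos (pi / 4 + pi / 2)"
    using x assms by (intro cos_monotone_0_pi_le) auto
  also have "cos (pi / 4 + pi / 2) = - (sqrt 2 / 2)" by (simp only: cos_add) (simp add: sin_45)
  also have "\<dots> \<le> - (7/10)"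
  proof -
    have "sqrt 2 \<ge> (7/5)" by (rule real_le_rsqrt) (simp add: power2_eq_square)
    then show ?thesis by simp
  qed
  finally have c: "cos (2 * pi * Re \<tau>) \<le> - (7/10)" .
  have "225 \<le> exp (2 * pi * Im \<tau>)"
    by (rule order_trans[OF exp_sqrt3_pi_ge]) (use y in simp)
  then have "(9/5000) * 225 \<le> eis_const * exp (2 * pi * Im \<tau>)"
    using eis_const_bounds by (intro mult_mono) auto
  then have "eis_const * exp (2 * pi * Im \<tau>) * cos (2 * pi * Re \<tau>) \<le> eis_const * exp (2 * pi * Im \<tau>) * (- (7/10))"
    using c eis_const_bounds by (intro mult_left_mono) auto
  also have "\<dots> \<le> - (567/2000)" using \<open>(9/5000) * 225 \<le> _\<close> by simp
  finally have "eis_const * exp (2 * pi * Im \<tau>) * cos (2 * pi * Re \<tau>) - 1 - Re Z \<le> - (21/20)"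
    using Z(2) by simp
  then have "3 / pi * (eis_const * exp (2 * pi * Im \<tau>) * cos (2 * pi * Re \<tau>) - 1 - Re Z) \<le> 3 / pi * - (21/20)"
    by (intro mult_left_mono) auto
  also have "\<dots> \<le> - 1" using pi_approx by (simp add: field_simps)
  finally show "Im (eqh \<tau>) < 0" unfolding Z(1) using assms(5) by linarith
qed

lemma sqrt3_half_le: "sqrt 3 / 2 \<le> (37/40)"
proof -
  have "sqrt 3 \<le> (37/20)" by (rule real_le_lsqrt) (auto simp: power2_eq_square)
  then show ?thesis by simp
qed

text \<open>On the imaginary axis the cosine is 1 and the exponential term is at least 0.0018 * 320
  = 0.576, against 1 + Re Z <= 1.33; the deficit is smaller than Im \<tau>.\<close>

lemma Im_eqh_pos_left:
  assumes "Re \<tau> = 0" "Im \<tau> \<ge> (37/40)"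
  shows "nE6' \<tau> \<noteq> 0" "Im (eqh \<tau>) > 0"
proof -
  have y: "Im \<tau> \<ge> sqrt 3 / 2" using assms sqrt3_half_le by linarith
  obtain Z where Z: "nE6' \<tau> \<noteq> 0" "Im (eqh \<tau>) = Im \<tau> + 3 / pi * (eis_const * exp (2 * pi * Im \<tau>) * cos (2 * pi * Re \<tau>) - 1 - Re Z)"
    "norm Z \<le> (33/100)" using Im_eqh_eq[OF y] assms(2) by metis
  show "nE6' \<tau> \<noteq> 0" by fact
  have "320 \<le> exp (2 * pi * Im \<tau>)"
    by (rule order_trans[OF exp_185pi_ge]) (use assms in simp)
  then have "(9/5000) * 320 \<le> eis_const * exp (2 * pi * Im \<tau>)"
    using eis_const_bounds by (intro mult_mono) auto
  then have "eis_const * exp (2 * pi * Im \<tau>) * cos (2 * pi * Re \<tau>) - 1 - Re Z \<ge> - (19/25)"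
    using assms Z(3) abs_Re_le_cmod[of Z] by simp
  then have "3 / pi * (eis_const * exp (2 * pi * Im \<tau>) * cos (2 * pi * Re \<tau>) - 1 - Re Z) \<ge> 3 / pi * - (19/25)"
    by (intro mult_left_mono) auto
  moreover have "3 / pi * - (19/25) \<ge> - (73/100)" using three_div_pi_bounds by simp
  ultimately show "Im (eqh \<tau>) > 0" unfolding Z(2) using assms(2) by linarith
qed

text \<open>The cosine is -1, but Im \<tau> is unbounded, so the exponential term must be seen to
  outgrow it; a bound linear in t = Im \<tau> - 37/40 is enough.\<close>

lemma Im_eqh_neg_right:
  assumes "Re \<tau> = 1 / 2" "Im \<tau> \<ge> (37/40)"
  shows "nE6' \<tau> \<noteq> 0" "Im (eqh \<tau>) < 0"
proof -
  have y: "Im \<tau> \<ge> sqrt 3 / 2" using assms sqrt3_half_le by linarith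
  obtain Z where Z: "nE6' \<tau> \<noteq> 0" "Im (eqh \<tau>) = Im \<tau> + 3 / pi * (eis_const * exp (2 * pi * Im \<tau>) * cos (2 * pi * Re \<tau>) - 1 - Re Z)"
    "Re Z \<ge> - (23/100)" using Im_eqh_eq[OF y] by metis
  show "nE6' \<tau> \<noteq> 0" by fact
  define t where "t = Im \<tau> - (37/40)"
  have t: "t \<ge> 0" using assms by (simp add: t_def)
  have c: "cos (2 * pi * Re \<tau>) = - 1" unfolding assms(1) by simp
  have "320 * (1 + 6 * t) \<le> exp (37 / 20 * pi) * exp (2 * pi * t)"
  proof (intro mult_mono exp_185pi_ge)
    have "6 * t \<le> 2 * pi * t" using t pi_gt3 by (intro mult_right_mono) auto
    then show "1 + 6 * t \<le> exp (2 * pi * t)" using exp_ge_add_one_self[of "2 * pi * t"] by linarith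
  qed (use t in auto)
  also have "\<dots> = exp (2 * pi * Im \<tau>)" by (simp add: t_def algebra_simps flip: exp_add)
  finally have "(9/5000) * (320 * (1 + 6 * t)) \<le> eis_const * exp (2 * pi * Im \<tau>)"
    using eis_const_bounds t by (intro mult_mono) auto
  then have "eis_const * exp (2 * pi * Im \<tau>) * cos (2 * pi * Re \<tau>) - 1 - Re Z \<le> - ((67/50) + 3 * t)"
    unfolding c using Z(3) t by simp
  then have "3 / pi * (eis_const * exp (2 * pi * Im \<tau>) * cos (2 * pi * Re \<tau>) - 1 - Re Z) \<le> 3 / pi * - ((67/50) + 3 * t)"
    by (intro mult_left_mono) auto
  also have "\<dots> \<le> (9549/10000) * - ((67/50) + 3 * t)" using three_div_pi_bounds t by (intro mult_right_mono_neg) auto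
  also have "(9549/10000) * - ((67/50) + 3 * t) < - (37/40) - t" using t by simp
  finally show "Im (eqh \<tau>) < 0" unfolding Z(2) t_def by linarith
qed

section \<open>The real locus as a graph\<close>

text \<open>Convex, as the mean value argument requires, unlike the part of 0 < Re \<tau> < 1/2 with
  |\<tau>| >= 1; its bottom therefore reaches into the unit disc.\<close>

definition strip :: "complex set" where
  "strip = {\<tau>. 0 < Re \<tau> \<and> Re \<tau> < 1 / 2 \<and> Im \<tau> \<ge> 37 / 40}"

lemma eqh_in_strip:
  assumes "\<tau> \<in> strip"
  shows "nE6' \<tau> \<noteq> 0" "Im (eqh' \<tau>) < 0" "Re (eqh \<tau>) > 0" "(eqh has_field_derivative eqh' \<tau>) (at \<tau>)"
  using eqh_strip[of \<tau>] has_field_derivative_eqh[of \<tau>] assms by (auto simp: strip_def)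

text \<open>The Noshiro--Warschawski argument: the derivative stays in a half-plane on a convex set.\<close>

lemma Im_eqh_difference_quotient:
  assumes "a \<in> strip" "b \<in> strip" "a \<noteq> b"
  shows "Im ((eqh b - eqh a) / (b - a)) < 0"
proof -
  define p where "p = (\<lambda>t::real. a + of_real t * (b - a))"
  have pin: "p t \<in> strip" if "0 \<le> t" "t \<le> 1" for t
  proof -
    have "convex strip"
    proof -
      have s: "strip = {\<tau>. Re \<tau> > 0} \<inter> {\<tau>. Re \<tau> < 1 / 2} \<inter> {\<tau>. Im \<tau> \<ge> 37 / 40}"
        by (auto simp: strip_def)
      show ?thesis unfolding s
        by (intro convex_Int convex_halfspace_Re_gt convex_halfspace_Re_lt convex_halfspace_Im_ge)
    qed
    from convexD[OF this assms(1,2), of "1 - t" t] that show ?thesis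
      by (simp add: p_def scaleR_conv_of_real algebra_simps)
  qed
  \<comment> \<open>Division by b - a cancels the chain rule factor, so the derivative of
    \<open>f\<close> is the imaginary part of \<open>eqh'\<close> itself.\<close>
  define f where "f = (\<lambda>t. Im (eqh (p t) / (b - a)))"
  have d: "(f has_real_derivative Im (eqh' (p t))) (at t)" if "0 \<le> t" "t \<le> 1" for t
  proof -
    have "(p has_vector_derivative (b - a)) (at t)"
      unfolding p_def by (auto intro!: derivative_eq_intros has_vector_derivative_of_real)
    from field_vector_diff_chain_at[OF this eqh_in_strip(4)[OF pin[OF that]]]
    have "((\<lambda>t. eqh (p t)) has_vector_derivative (b - a) * eqh' (p t)) (at t)"
      by (simp add: o_def)
    then have "((\<lambda>t. eqh (p t) / (b - a)) has_vector_derivative ((b - a) * eqh' (p t)) / (b - a)) (at t)"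
      by (rule has_vector_derivative_divide)
    from bounded_linear.has_vector_derivative[OF bounded_linear_Im this] show ?thesis
      unfolding f_def using assms(3) by (simp add: has_real_derivative_iff_has_vector_derivative)
  qed
  have "\<exists>z. 0 < z \<and> z < 1 \<and> f 1 - f 0 = (1 - 0) * Im (eqh' (p z))"
    by (rule MVT2) (use d in auto)
  then obtain z where "0 < z" "z < 1" "f 1 - f 0 = Im (eqh' (p z))" by auto
  then have "f 1 - f 0 < 0" using eqh_in_strip(2)[OF pin[of z]] by simp
  then show ?thesis by (simp add: f_def p_def diff_divide_distrib)
qed

lemma inj_on_eqh_strip: "inj_on eqh strip"
proof (rule inj_onI, rule ccontr)
  fix a b assume "a \<in> strip" "b \<in> strip" "eqh a = eqh b" "a \<noteq> b"
  with Im_eqh_difference_quotient[of a b] show False by simp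
qed

text \<open>When h b - h a is real, the difference quotient has imaginary part -(h b - h a) Im (b -
  a) / |b - a|^2, and this is negative.\<close>

lemma eqh_real_increasing:
  assumes "a \<in> strip" "b \<in> strip" "Im (eqh a) = 0" "Im (eqh b) = 0" "Im a < Im b"
  shows "Re (eqh a) < Re (eqh b)"
proof -
  have ab: "a \<noteq> b" using assms by auto
  have "eqh b - eqh a = of_real (Re (eqh b) - Re (eqh a))" using assms by (simp add: complex_eq_iff)
  with Im_eqh_difference_quotient[OF assms(1,2) ab]
  have "Im (of_real (Re (eqh b) - Re (eqh a)) / (b - a)) < 0" by simp
  also have "Im (of_real (Re (eqh b) - Re (eqh a)) / (b - a))
      = - ((Re (eqh b) - Re (eqh a)) * Im (b - a)) / norm (b - a) ^ 2"
    by (simp add: Im_divide cmod_power2)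
  finally have "(Re (eqh b) - Re (eqh a)) * Im (b - a) > 0"
    using ab by (simp add: zero_less_divide_iff)
  then show ?thesis using assms(5) by (simp add: zero_less_mult_iff)
qed

lemma Im_eqh_decreasing:
  assumes "a \<in> strip" "b \<in> strip" "Im a = Im b" "Re a < Re b"
  shows "Im (eqh b) < Im (eqh a)"
proof -
  have ab: "a \<noteq> b" using assms by auto
  have e: "b - a = of_real (Re b - Re a)" using assms by (simp add: complex_eq_iff)
  from Im_eqh_difference_quotient[OF assms(1,2) ab] have "Im (eqh b - eqh a) / (Re b - Re a) < 0"
    unfolding e by (simp only: Im_divide_of_real)
  then show ?thesis using assms(4) by (simp add: divide_less_0_iff)
qed

lemma isCont_eqh: "Im \<tau> > 0 \<Longrightarrow> nE6' \<tau> \<noteq> 0 \<Longrightarrow> isCont eqh \<tau>"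
  using has_field_derivative_eqh DERIV_isCont by blast

text \<open>Im h changes sign between the lines Re = 0 and Re = 1/2 and decreases along horizontal
  segments.\<close>

lemma ex1_graph:
  assumes "y \<ge> 37 / 40"
  shows "\<exists>!x. 0 < x \<and> x < 1 / 2 \<and> Im (eqh (Complex x y)) = 0"
proof -
  define f where "f = (\<lambda>x. Im (eqh (Complex x y)))"
  have f0: "f 0 > 0" unfolding f_def using assms by (intro Im_eqh_pos_left(2)) auto
  have f1: "f (1 / 2) < 0" unfolding f_def using assms by (intro Im_eqh_neg_right(2)) auto
  have "continuous_on {0..1 / 2} f"
    unfolding f_def
  proof (intro continuous_on_Im continuous_at_imp_continuous_on ballI)
    fix x :: real assume x: "x \<in> {0..1 / 2}"
    have "nE6' (Complex x y) \<noteq> 0"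
      using x assms Im_eqh_pos_left(1)[of "Complex x y"] Im_eqh_neg_right(1)[of "Complex x y"] eqh_strip(1)[of "Complex x y"]
      by (cases "x = 0 \<or> x = 1 / 2") auto
    then have "isCont eqh (Complex x y)" using assms by (intro isCont_eqh) auto
    moreover have "isCont (\<lambda>x. Complex x y) x" unfolding Complex_eq by (intro continuous_intros)
    ultimately show "isCont (\<lambda>x. eqh (Complex x y)) x" by (rule isCont_o2[rotated])
  qed
  then obtain x where x: "0 \<le> x" "x \<le> 1 / 2" "f x = 0"
    using IVT2'[of f "1 / 2" 0 0] f0 f1 by auto
  with f0 f1 have x': "0 < x" "x < 1 / 2" by (metis less_eq_real_def less_irrefl)+
  show ?thesis
  proof (rule ex1I[of _ x])
    show "0 < x \<and> x < 1 / 2 \<and> Im (eqh (Complex x y)) = 0" using x x' by (simp add: f_def)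
    fix x2 assume x2: "0 < x2 \<and> x2 < 1 / 2 \<and> Im (eqh (Complex x2 y)) = 0"
    have s: "Complex x y \<in> strip" "Complex x2 y \<in> strip" using x' x2 assms by (auto simp: strip_def)
    show "x2 = x"
      using Im_eqh_decreasing[OF s] Im_eqh_decreasing[OF s(2,1)] x x2
      by (cases x2 x rule: linorder_cases) (auto simp: f_def)
  qed
qed

definition graph_x :: "real \<Rightarrow> real" where
  "graph_x y = (THE x. 0 < x \<and> x < 1 / 2 \<and> Im (eqh (Complex x y)) = 0)"

definition graph_pt :: "real \<Rightarrow> complex" where
  "graph_pt y = Complex (graph_x y) y"

definition graph_h :: "real \<Rightarrow> real" where
  "graph_h y = Re (eqh (graph_pt y))"

lemma graph_x:
  assumes "y \<ge> 37 / 40"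
  shows "0 < graph_x y" "graph_x y < 1 / 2" "Im (eqh (graph_pt y)) = 0" "graph_pt y \<in> strip"
    and "eqh (graph_pt y) = of_real (graph_h y)"
proof -
  have "0 < graph_x y \<and> graph_x y < 1 / 2 \<and> Im (eqh (graph_pt y)) = 0"
    unfolding graph_pt_def graph_x_def by (rule theI'[OF ex1_graph[OF assms]])
  then show "0 < graph_x y" "graph_x y < 1 / 2" "Im (eqh (graph_pt y)) = 0" "graph_pt y \<in> strip"
    and "eqh (graph_pt y) = of_real (graph_h y)"
    using assms by (simp_all add: graph_pt_def strip_def graph_h_def complex_eq_iff)
qed

lemma graph_pt_sel [simp]: "Re (graph_pt y) = graph_x y" "Im (graph_pt y) = y"
  by (simp_all add: graph_pt_def)

lemma graph_pt_unique:
  assumes "\<tau> \<in> strip" "Im (eqh \<tau>) = 0"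
  shows "\<tau> = graph_pt (Im \<tau>)"
proof -
  have y: "Im \<tau> \<ge> 37 / 40" using assms by (simp add: strip_def)
  have "graph_x (Im \<tau>) = Re \<tau>"
    unfolding graph_x_def using assms
    by (intro the1_equality[OF ex1_graph[OF y]]) (auto simp: strip_def)
  then show ?thesis by (simp add: graph_pt_def)
qed

lemma graph_h_less: "37 / 40 \<le> y \<Longrightarrow> y < y' \<Longrightarrow> graph_h y < graph_h y'"
  unfolding graph_h_def by (rule eqh_real_increasing) (auto simp: graph_x)

text \<open>The signs of Im h at distance d to the left and right of the zero persist for nearby
  heights, and monotonicity along horizontals traps the new zero in between.\<close>

lemma continuous_graph_x: "continuous_on {37 / 40..} graph_x"
proof (rule continuous_onI)
  fix y e :: real assume y: "y \<in> {37 / 40..}" and e: "e > 0"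
  note g = graph_x[of y]
  obtain d where d: "d > 0" "d < e" "d < graph_x y" "d < 1 / 2 - graph_x y"
  proof -
    define m where "m = Min {e, graph_x y, 1 / 2 - graph_x y}"
    have "m > 0" "m \<le> e" "m \<le> graph_x y" "m \<le> 1 / 2 - graph_x y"
      using e g y by (auto simp: m_def)
    then show ?thesis by (intro that[of "m / 2"]) auto
  qed
  have c: "isCont (\<lambda>y'. Im (eqh (Complex x y'))) y" if "0 < x" "x < 1 / 2" for x
  proof -
    have "isCont eqh (Complex x y)"
      using that y by (intro isCont_eqh eqh_strip(1)) auto
    moreover have "isCont (\<lambda>y'. Complex x y') y" unfolding Complex_eq by (intro continuous_intros)
    ultimately have "isCont (\<lambda>y'. eqh (Complex x y')) y" by (rule isCont_o2[rotated])
    then show ?thesis by (rule continuous_Im)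
  qed
  define l r where "l = graph_x y - d" and "r = graph_x y + d"
  have lr: "0 < l" "l < graph_x y" "graph_x y < r" "r < 1 / 2" using d by (auto simp: l_def r_def)
  have st: "Complex x z \<in> strip" if "0 < x" "x < 1 / 2" "z \<ge> 37 / 40" for x z
    using that by (simp add: strip_def)
  have "Im (eqh (Complex l y)) > Im (eqh (graph_pt y))" "Im (eqh (Complex r y)) < Im (eqh (graph_pt y))"
    by (rule Im_eqh_decreasing; use st g y lr in simp)+
  then have l: "Im (eqh (Complex l y)) > 0" and r: "Im (eqh (Complex r y)) < 0" using g y by auto
  have "eventually (\<lambda>z. Im (eqh (Complex l z)) > 0) (at y)" "eventually (\<lambda>z. Im (eqh (Complex r z)) < 0) (at y)"
    using order_tendstoD(1)[OF c[unfolded isCont_def, of l] l] order_tendstoD(2)[OF c[unfolded isCont_def, of r] r] lr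
    by auto
  then have "eventually (\<lambda>z. Im (eqh (Complex l z)) > 0 \<and> Im (eqh (Complex r z)) < 0) (at y)"
    by (rule eventually_conj)
  then obtain \<delta> where \<delta>: "\<delta> > 0"
    "\<And>z. z \<noteq> y \<Longrightarrow> dist z y < \<delta> \<Longrightarrow> Im (eqh (Complex l z)) > 0 \<and> Im (eqh (Complex r z)) < 0"
    unfolding eventually_at by blast
  show "\<exists>d>0. \<forall>x'\<in>{37 / 40..}. dist x' y < d \<longrightarrow> dist (graph_x x') (graph_x y) \<le> e"
  proof (intro exI conjI ballI impI)
    fix z assume z: "z \<in> {37 / 40..}" "dist z y < \<delta>"
    have lz: "Im (eqh (Complex l z)) > 0 \<and> Im (eqh (Complex r z)) < 0"
      using \<delta>(2)[of z] z l r by (cases "z = y") auto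
    note gz = graph_x[of z]
    have "l < graph_x z"
    proof (rule ccontr)
      assume "\<not> l < graph_x z"
      then have "graph_x z < l \<or> graph_x z = l" by auto
      then show False
        using Im_eqh_decreasing[of "graph_pt z" "Complex l z"] gz z lz st[of l z] lr
        by (auto simp: graph_pt_def)
    qed
    moreover have "graph_x z < r"
    proof (rule ccontr)
      assume "\<not> graph_x z < r"
      then have "r < graph_x z \<or> graph_x z = r" by auto
      then show False
        using Im_eqh_decreasing[of "Complex r z" "graph_pt z"] gz z lz st[of r z] lr
        by (auto simp: graph_pt_def)
    qed
    ultimately show "dist (graph_x z) (graph_x y) \<le> e"
      using d by (auto simp: dist_real_def l_def r_def)
  qed (use \<delta> in auto)
qed

lemma continuous_graph_pt: "continuous_on {37 / 40..} graph_pt"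
  unfolding graph_pt_def Complex_eq by (intro continuous_intros continuous_graph_x)

lemma continuous_graph_h: "continuous_on {37 / 40..} graph_h"
proof -
  have "continuous_on strip eqh"
    using eqh_in_strip(4) DERIV_isCont by (intro continuous_at_imp_continuous_on) blast
  then have "continuous_on {37 / 40..} (\<lambda>y. eqh (graph_pt y))"
    by (rule continuous_on_compose2[OF _ continuous_graph_pt]) (auto simp: graph_x)
  then show ?thesis unfolding graph_h_def by (intro continuous_intros)
qed

text \<open>The inversion fixes the circle pointwise, so h = 1 / cnj h has modulus 1; being real and
  positive it is 1.\<close>

lemma eqh_eq_1_on_circle:
  assumes "\<tau> \<in> strip" "Im (eqh \<tau>) = 0" "norm \<tau> = 1"
  shows "eqh \<tau> = 1"
proof -
  note e = eqh_in_strip[OF assms(1)]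
  have i: "Im \<tau> > 0" using assms(1) by (auto simp: strip_def)
  have "\<tau> * cnj \<tau> = 1" using assms(3) by (simp add: complex_mult_cnj flip: cmod_power2)
  then have "inverse (cnj \<tau>) = \<tau>" by (metis inverse_unique mult.commute)
  with eqN_inversion(1)[OF i] have "eqN \<tau> = - (cnj \<tau> ^ 7 * cnj (nE6' \<tau>))" by simp
  then have "norm (eqN \<tau>) = norm (nE6' \<tau>)" using assms(3) by (simp add: norm_mult norm_power)
  then have "norm (eqh \<tau>) = 1" using e(1) by (simp add: eqh_def norm_divide)
  moreover have "eqh \<tau> = of_real (Re (eqh \<tau>))" using assms(2) by (simp add: complex_eq_iff)
  ultimately have "\<bar>Re (eqh \<tau>)\<bar> = 1" by (metis norm_of_real)
  then show ?thesis using e(3) assms(2) by (simp add: complex_eq_iff)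
qed

text \<open>\<open>graph_h\<close> is strictly increasing and equals 1 wherever the graph meets the
  unit circle, so there is only one crossing. The graph starts inside the disc, since Im h < 0 at
  height 37/40 where |\<tau>| >= 1, and is outside for y > 1.\<close>

lemma graph_crossing:
  obtains y0 where "y0 > 37 / 40" "graph_h y0 = 1" "norm (graph_pt y0) = 1"
    "\<And>y. y \<ge> 37 / 40 \<Longrightarrow> norm (graph_pt y) \<ge> 1 \<longleftrightarrow> y \<ge> y0"
proof -
  have cn: "continuous_on {a..b} (\<lambda>y. norm (graph_pt y))" if "a \<ge> 37 / 40" for a b
    using continuous_on_subset[OF continuous_graph_pt] that by (intro continuous_intros) auto
  have n1: "norm (graph_pt (37 / 40)) < 1"
  proof (rule ccontr)
    assume "\<not> norm (graph_pt (37 / 40)) < 1"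
    then have "Im (eqh (graph_pt (37 / 40))) < 0"
      using graph_x[of "37 / 40"] by (intro Im_eqh_neg_low(2)) auto
    then show False using graph_x(3)[of "37 / 40"] by simp
  qed
  have nbig: "norm (graph_pt y) > 1" if "y > 1" for y
    using abs_Im_le_cmod[of "graph_pt y"] that by simp
  have h1: "graph_h y = 1" if "y \<ge> 37 / 40" "norm (graph_pt y) = 1" for y
    using eqh_eq_1_on_circle[OF graph_x(4,3) that(2)] that by (simp add: graph_h_def)
  obtain y0 where y0: "37 / 40 \<le> y0" "norm (graph_pt y0) = 1"
    using IVT'[of "\<lambda>y. norm (graph_pt y)" "37 / 40" 1 2] cn n1 nbig[of 2] by auto
  have uniq: "y = y0" if "y \<ge> 37 / 40" "norm (graph_pt y) = 1" for y
    using graph_h_less[of y y0] graph_h_less[of y0 y] h1[OF that] h1[OF y0] that y0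
    by (cases y y0 rule: linorder_cases) auto
  show ?thesis
  proof (rule that[of y0])
    show "graph_h y0 = 1" "norm (graph_pt y0) = 1" using h1[OF y0] y0 by auto
    show "y0 > 37 / 40" using y0 n1 by (cases "y0 = 37 / 40") auto
    fix y :: real assume y: "y \<ge> 37 / 40"
    show "norm (graph_pt y) \<ge> 1 \<longleftrightarrow> y \<ge> y0"
    proof
      assume "norm (graph_pt y) \<ge> 1"
      then obtain y' where "37 / 40 \<le> y'" "y' \<le> y" "norm (graph_pt y') = 1"
        using IVT'[of "\<lambda>y. norm (graph_pt y)" "37 / 40" 1 y] cn n1 y by auto
      with uniq show "y \<ge> y0" by auto
    next
      assume yy: "y \<ge> y0"
      show "norm (graph_pt y) \<ge> 1"
      proof (rule ccontr)
        assume n: "\<not> norm (graph_pt y) \<ge> 1"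
        then obtain y' where "y \<le> y'" "norm (graph_pt y') = 1"
          using IVT'[of "\<lambda>y. norm (graph_pt y)" y 1 "y + 1"] cn[OF y] nbig[of "y + 1"] y by auto
        with uniq[of y'] y yy n show False by auto
      qed
    qed
  qed
qed

text \<open>Unboundedness of h along the graph, for the surjectivity onto [1, \<infinity>). Only the
  size of the dominant term a / q is estimated, as h is real and positive on the graph and thus
  equal to its modulus. The threshold 1000 lets a quadratic bound for exp suffice.\<close>

lemma graph_h_ge:
  assumes "y \<ge> 1000"
  shows "graph_h y \<ge> y"
proof -
  have y: "Im (graph_pt y) \<ge> sqrt 3 / 2" using assms sqrt3_half_le by simp
  have y2: "Im (graph_pt y) \<ge> 37 / 40" using assms by simp
  obtain Z where Z: "eqh (graph_pt y) = graph_pt y + 3 * \<i> / of_real pi * (of_real eis_const / nome (graph_pt y) - 1 - Z)"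
    "norm Z \<le> 33 / 100" using Im_eqh_eq[OF y] y2 by metis
  define q where "q = of_real eis_const / nome (graph_pt y)"
  have nq: "norm q = eis_const * exp (2 * pi * y)"
    using eis_const_bounds by (simp add: q_def norm_divide norm_nome exp_minus field_simps)
  have "9 / 5000 * (y ^ 2 * 18) \<le> eis_const * exp (2 * pi * y)"
  proof (intro mult_mono)
    have p: "2 * pi * y \<ge> 0" using assms by simp
    have "(6 * y) ^ 2 / 2 \<le> (2 * pi * y) ^ 2 / 2"
      using pi_gt3 assms by (intro divide_right_mono power_mono mult_right_mono) auto
    also have "\<dots> \<le> exp (2 * pi * y)" using exp_lower_Taylor_quadratic[OF p] p by linarith
    finally show "y ^ 2 * 18 \<le> exp (2 * pi * y)" by (simp add: power_mult_distrib mult_ac)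
  qed (use eis_const_bounds in auto)
  moreover have "y ^ 2 \<ge> 1000 * y" using assms by (simp add: power2_eq_square)
  \<comment> \<open>9/5000 * 18 * 1000 = 32.4.\<close>
  ultimately have nq': "norm q \<ge> 30 * y" using nq assms by linarith
  have "norm (q - 1 - Z) \<ge> 30 * y - 4 / 3"
    using norm_triangle_ineq2[of q "1 + Z"] norm_triangle_ineq[of 1 Z] Z(2) nq' by (simp add: diff_diff_eq)
  then have "norm (3 * \<i> / of_real pi * (q - 1 - Z)) \<ge> 1 / 2 * (30 * y - 4 / 3)"
    unfolding norm_mult using assms pi_less_4 by (intro mult_mono) (auto simp: norm_divide field_simps)
  moreover have "norm (graph_pt y) \<le> 1 / 2 + y"
    using cmod_le[of "graph_pt y"] graph_x[of y] assms by simp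
  ultimately have "norm (eqh (graph_pt y)) \<ge> y"
    unfolding Z(1) q_def[symmetric] using assms
      norm_triangle_ineq2[of "3 * \<i> / of_real pi * (q - 1 - Z)" "- graph_pt y"] by (simp add: add.commute)
  moreover have "graph_h y > 0" using eqh_in_strip(3)[OF graph_x(4)[of y]] assms by (simp add: graph_h_def)
  ultimately show ?thesis using graph_x(5)[of y] assms by simp
qed

text \<open>Im h = 0 equates a exp(2 pi y) cos(2 pi x) with a term of linear growth, so the cosine
  tends to 0; as 0 < x < 1/2, \<open>arccos\<close> recovers x.\<close>

lemma tendsto_graph_x: "(graph_x \<longlongrightarrow> 1 / 4) at_top"
proof -
  have "eventually (\<lambda>y. norm (cos (2 * pi * graph_x y)) \<le> 5000 / 9 * ((2 + 2 * y) / exp y)) at_top"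
  proof (rule eventually_at_top_linorderI)
    fix y :: real assume y1: "y \<ge> 1"
    have y: "Im (graph_pt y) \<ge> sqrt 3 / 2" using y1 sqrt3_half_le by simp
    have y2: "Im (graph_pt y) \<ge> 37 / 40" using y1 by simp
    obtain Z where Z: "Im (eqh (graph_pt y)) = Im (graph_pt y) + 3 / pi * (eis_const * exp (2 * pi * Im (graph_pt y)) * cos (2 * pi * Re (graph_pt y)) - 1 - Re Z)"
      "norm Z \<le> 33 / 100" using Im_eqh_eq[OF y] y2 by metis
    have "eis_const * exp (2 * pi * y) * cos (2 * pi * graph_x y) = 1 + Re Z - pi * y / 3"
      using Z(1) graph_x(3)[of y] y1 by (simp add: field_simps)
    moreover have "\<bar>1 + Re Z - pi * y / 3\<bar> \<le> 2 + 2 * y"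
    proof -
      have "pi * y / 3 \<le> 2 * y" using mult_right_mono[of pi 4 y] pi_less_4 y1 by simp
      moreover have "pi * y / 3 \<ge> 0" using y1 by simp
      ultimately show ?thesis using abs_Re_le_cmod[of Z] Z(2) by linarith
    qed
    ultimately have "\<bar>eis_const * exp (2 * pi * y) * cos (2 * pi * graph_x y)\<bar> \<le> 2 + 2 * y"
      by simp
    moreover have nn: "eis_const * exp (2 * pi * y) \<ge> 0" using eis_const_bounds by simp
    ultimately have "eis_const * exp (2 * pi * y) * \<bar>cos (2 * pi * graph_x y)\<bar> \<le> 2 + 2 * y"
      unfolding abs_mult[of "eis_const * exp (2 * pi * y)"] abs_of_nonneg[OF nn] by blast
    moreover have "9 / 5000 * exp y * \<bar>cos (2 * pi * graph_x y)\<bar> \<le> eis_const * exp (2 * pi * y) * \<bar>cos (2 * pi * graph_x y)\<bar>"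
    proof (intro mult_mono)
      show "exp y \<le> exp (2 * pi * y)" using y1 mult_right_mono[of 1 "2 * pi" y] pi_gt3 by simp
    qed (use eis_const_bounds in auto)
    ultimately have "9 / 5000 * exp y * \<bar>cos (2 * pi * graph_x y)\<bar> \<le> 2 + 2 * y" by linarith
    then show "norm (cos (2 * pi * graph_x y)) \<le> 5000 / 9 * ((2 + 2 * y) / exp y)"
      by (simp add: field_simps)
  qed
  moreover have "((\<lambda>y::real. 5000 / 9 * ((2 + 2 * y) / exp y)) \<longlongrightarrow> 0) at_top" by real_asymp
  ultimately have "((\<lambda>y. cos (2 * pi * graph_x y)) \<longlongrightarrow> 0) at_top"
    by (rule Lim_null_comparison)
  then have "((\<lambda>y. arccos (cos (2 * pi * graph_x y)) / (2 * pi)) \<longlongrightarrow> arccos 0 / (2 * pi)) at_top"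
    by (intro tendsto_intros isCont_tendsto_compose[OF isCont_arccos]) auto
  also have "arccos 0 / (2 * pi) = 1 / 4" by simp
  finally have "((\<lambda>y. arccos (cos (2 * pi * graph_x y)) / (2 * pi)) \<longlongrightarrow> 1 / 4) at_top" .
  moreover have "eventually (\<lambda>y. arccos (cos (2 * pi * graph_x y)) / (2 * pi) = graph_x y) at_top"
  proof (rule eventually_at_top_linorderI)
    fix y :: real assume "y \<ge> 1"
    then show "arccos (cos (2 * pi * graph_x y)) / (2 * pi) = graph_x y"
      using graph_x[of y] by (subst arccos_cos) auto
  qed
  ultimately show ?thesis by (rule Lim_transform_eventually)
qed

section \<open>The real locus between the cusps 0 and infinity\<close>

definition wedge :: "complex set" where
  "wedge = {\<tau>. Im \<tau> > 0 \<and> 0 \<le> Re \<tau> \<and> Re \<tau> \<le> 1 / 2 \<and> norm (\<tau> - 1) \<ge> 1}"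

definition open_wedge :: "complex set" where
  "open_wedge = {\<tau>. Im \<tau> > 0 \<and> 0 < Re \<tau> \<and> Re \<tau> < 1 / 2 \<and> norm (\<tau> - 1) > 1}"

lemma Im_eqh_eq_0_iff:
  assumes "Im \<tau> > 0" "nE6' \<tau> \<noteq> 0"
  shows "\<tau> \<in> real_locus \<longleftrightarrow> Im (eqh \<tau>) = 0"
proof -
  have "eqN \<tau> * cnj (nE6' \<tau>) = eqh \<tau> * (nE6' \<tau> * cnj (nE6' \<tau>))"
    using assms(2) by (simp add: eqh_def)
  also have "\<dots> = eqh \<tau> * of_real (norm (nE6' \<tau>) ^ 2)" by (simp only: complex_norm_square)
  finally have eq: "Im (eqN \<tau> * cnj (nE6' \<tau>)) = Im (eqh \<tau>) * norm (nE6' \<tau>) ^ 2" by simp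
  show ?thesis using assms unfolding real_locus_def mem_Collect_eq eq by simp
qed

lemma Im_inversion: "Im (inverse (cnj \<tau>)) = Im \<tau> / norm \<tau> ^ 2"
  and Re_inversion: "Re (inverse (cnj \<tau>)) = Re \<tau> / norm \<tau> ^ 2"
  by (simp_all add: cmod_power2)

lemma eqh_inversion:
  assumes "Im \<tau> > 0"
  shows "eqh (inverse (cnj \<tau>)) = inverse (cnj (eqh \<tau>))"
proof -
  have "\<tau> \<noteq> 0" using assms by auto
  then show ?thesis unfolding eqh_def eqN_inversion[OF assms] by (simp add: field_simps)
qed

lemma real_locus_inversion:
  assumes "\<tau> \<in> real_locus"
  shows "inverse (cnj \<tau>) \<in> real_locus"
proof -
  have i: "Im \<tau> > 0" "Im (eqN \<tau> * cnj (nE6' \<tau>)) = 0" using assms by (auto simp: real_locus_def)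
  then have t: "\<tau> \<noteq> 0" by auto
  have "eqN (inverse (cnj \<tau>)) * cnj (nE6' (inverse (cnj \<tau>)))
      = (\<tau> ^ 7 * cnj (\<tau> ^ 7)) * (eqN \<tau> * cnj (nE6' \<tau>))"
    unfolding eqN_inversion[OF i(1)] by simp
  also have "\<tau> ^ 7 * cnj (\<tau> ^ 7) = of_real (norm (\<tau> ^ 7) ^ 2)" by (metis complex_norm_square)
  also have "Im (of_real (norm (\<tau> ^ 7) ^ 2) * (eqN \<tau> * cnj (nE6' \<tau>))) = norm (\<tau> ^ 7) ^ 2 * Im (eqN \<tau> * cnj (nE6' \<tau>))"
    by (simp only: times_complex.sel Re_complex_of_real Im_complex_of_real mult_zero_left add_0_right)
  finally show ?thesis
    using i t unfolding real_locus_def mem_Collect_eq Im_inversion by simp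
qed

text \<open>The sign of Im h rules out points below height 37/40 and on the two vertical lines, so
  the locus here is the graph from its point on the unit circle upwards; h is 1 at that point and
  increases.\<close>

lemma real_locus_top:
  assumes "\<tau> \<in> real_locus" "0 \<le> Re \<tau>" "Re \<tau> \<le> 1 / 2" "norm \<tau> \<ge> 1"
  shows "\<tau> \<in> strip" "Im (eqh \<tau>) = 0" "\<exists>y. \<tau> = graph_pt y \<and> y \<ge> 37 / 40"
    "Re (eqh \<tau>) \<ge> 1" "norm \<tau> \<noteq> 1 \<Longrightarrow> Re (eqh \<tau>) > 1"
proof -
  have i: "Im \<tau> > 0" using assms by (auto simp: real_locus_def)
  have y: "Im \<tau> > 37 / 40"
  proof (rule ccontr)
    assume "\<not> Im \<tau> > 37 / 40"
    then have low: "Im \<tau> \<ge> sqrt 3 / 2" "Im (eqh \<tau>) < 0" using Im_eqh_neg_low[of \<tau>] assms i by auto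
    have "nE6' \<tau> \<noteq> 0" using Im_eqh_eq[OF low(1)] by blast
    with Im_eqh_eq_0_iff[OF i] assms low show False by simp
  qed
  have "Re \<tau> \<noteq> 0" using Im_eqh_pos_left[of \<tau>] y Im_eqh_eq_0_iff[OF i] assms by force
  moreover have "Re \<tau> \<noteq> 1 / 2" using Im_eqh_neg_right[of \<tau>] y Im_eqh_eq_0_iff[OF i] assms by force
  ultimately show s: "\<tau> \<in> strip" using y assms by (auto simp: strip_def)
  show h: "Im (eqh \<tau>) = 0" using Im_eqh_eq_0_iff[OF i eqh_in_strip(1)[OF s]] assms by simp
  note g = graph_pt_unique[OF s h]
  then show "\<exists>y. \<tau> = graph_pt y \<and> y \<ge> 37 / 40" using y by (auto intro: less_imp_le)
  obtain y0 where y0: "y0 > 37 / 40" "graph_h y0 = 1" "norm (graph_pt y0) = 1"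
    "\<And>y. y \<ge> 37 / 40 \<Longrightarrow> norm (graph_pt y) \<ge> 1 \<longleftrightarrow> y \<ge> y0" using graph_crossing by blast
  have yy: "Im \<tau> \<ge> y0" using y0(4)[of "Im \<tau>"] y assms g by simp
  have hh: "Re (eqh \<tau>) = graph_h (Im \<tau>)" using g by (simp add: graph_h_def)
  show "Re (eqh \<tau>) \<ge> 1" using graph_h_less[of y0 "Im \<tau>"] y0 yy hh by (cases "Im \<tau> = y0") auto
  assume "norm \<tau> \<noteq> 1"
  then have "Im \<tau> \<noteq> y0" using y0 g by auto
  then show "Re (eqh \<tau>) > 1" using graph_h_less[of y0 "Im \<tau>"] y0 yy hh by auto
qed

lemma norm_minus_1_iff:
  "norm (\<tau> - 1) \<ge> 1 \<longleftrightarrow> 2 * Re \<tau> \<le> norm \<tau> ^ 2" "norm (\<tau> - 1) > 1 \<longleftrightarrow> 2 * Re \<tau> < norm \<tau> ^ 2"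
proof -
  have "norm (\<tau> - 1) ^ 2 = norm \<tau> ^ 2 - 2 * Re \<tau> + 1"
    unfolding cmod_power2 by (simp add: power2_eq_square algebra_simps)
  then show "norm (\<tau> - 1) \<ge> 1 \<longleftrightarrow> 2 * Re \<tau> \<le> norm \<tau> ^ 2" "norm (\<tau> - 1) > 1 \<longleftrightarrow> 2 * Re \<tau> < norm \<tau> ^ 2"
    using power_mono_iff[of 1 "norm (\<tau> - 1)" 2] power_mono_iff[of "norm (\<tau> - 1)" 1 2] by auto
qed

text \<open>The inversion preserves the line Re = 0 and exchanges Re = 1/2 with the circle |\<tau> -
  1| = 1.\<close>

lemma wedge_inversion:
  assumes "\<tau> \<in> wedge"
  shows "inverse (cnj \<tau>) \<in> wedge"
proof -
  have t: "norm \<tau> > 0" using assms by (auto simp: wedge_def)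
  have "norm (inverse (cnj \<tau>)) ^ 2 = 1 / norm \<tau> ^ 2" by (simp add: norm_inverse power_inverse inverse_eq_divide[of "norm \<tau> ^ 2"])
  then show ?thesis using assms t
    unfolding wedge_def mem_Collect_eq norm_minus_1_iff Re_inversion Im_inversion
    by (auto simp: field_simps)
qed

lemma open_wedge_inversion:
  assumes "\<tau> \<in> open_wedge"
  shows "inverse (cnj \<tau>) \<in> open_wedge"
proof -
  have t: "norm \<tau> > 0" using assms by (auto simp: open_wedge_def)
  have "norm (inverse (cnj \<tau>)) ^ 2 = 1 / norm \<tau> ^ 2" by (simp add: norm_inverse power_inverse inverse_eq_divide[of "norm \<tau> ^ 2"])
  then show ?thesis using assms t
    unfolding open_wedge_def mem_Collect_eq norm_minus_1_iff Re_inversion Im_inversion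
    by (auto simp: field_simps)
qed

lemma inverse_cnj_inverse_cnj: "inverse (cnj (inverse (cnj z))) = z"
  by simp

lemma real_locus_wedge_inversion:
  assumes "\<tau> \<in> real_locus" "\<tau> \<in> wedge" "norm \<tau> < 1"
  shows "inverse (cnj \<tau>) \<in> real_locus" "0 \<le> Re (inverse (cnj \<tau>))" "Re (inverse (cnj \<tau>)) \<le> 1 / 2"
    "norm (inverse (cnj \<tau>)) > 1"
proof -
  have t: "norm \<tau> > 0" using assms by (auto simp: wedge_def)
  show "inverse (cnj \<tau>) \<in> real_locus" by (rule real_locus_inversion[OF assms(1)])
  have "inverse (cnj \<tau>) \<in> wedge" by (rule wedge_inversion[OF assms(2)])
  then show "0 \<le> Re (inverse (cnj \<tau>))" "Re (inverse (cnj \<tau>)) \<le> 1 / 2" by (auto simp only: wedge_def mem_Collect_eq)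
  show "norm (inverse (cnj \<tau>)) > 1" using assms(3) t by (simp add: norm_inverse one_less_inverse)
qed

lemma strip_top_open_wedge:
  assumes "\<tau> \<in> strip" "norm \<tau> \<ge> 1"
  shows "\<tau> \<in> open_wedge"
proof -
  have "norm \<tau> ^ 2 \<ge> 1" using assms(2) by (rule one_le_power)
  then show ?thesis using assms(1) unfolding open_wedge_def strip_def mem_Collect_eq norm_minus_1_iff by auto
qed

text \<open>Inside the unit disc every claim is transported from \<sigma> = 1 / cnj \<tau>, where
  h(\<tau>) = 1 / h(\<sigma>). That the locus avoids the boundary of the wedge and that h' does not
  vanish on it serve the smooth parametrisation.\<close>

lemma real_locus_wedge:
  assumes "\<tau> \<in> real_locus" "\<tau> \<in> wedge"
  shows "\<tau> \<in> open_wedge" "nE6' \<tau> \<noteq> 0" "eqh' \<tau> \<noteq> 0" "Im (eqh \<tau>) = 0" "Re (eqh \<tau>) > 0"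
    "norm \<tau> < 1 \<Longrightarrow> Re (eqh \<tau>) < 1" "norm \<tau> \<ge> 1 \<Longrightarrow> Re (eqh \<tau>) \<ge> 1"
proof -
  have i: "Im \<tau> > 0" and x: "0 \<le> Re \<tau>" "Re \<tau> \<le> 1 / 2" using assms by (auto simp: wedge_def)
  have "\<tau> \<in> open_wedge \<and> nE6' \<tau> \<noteq> 0 \<and> eqh' \<tau> \<noteq> 0 \<and> Im (eqh \<tau>) = 0 \<and> Re (eqh \<tau>) > 0
    \<and> (norm \<tau> < 1 \<longrightarrow> Re (eqh \<tau>) < 1) \<and> (norm \<tau> \<ge> 1 \<longrightarrow> Re (eqh \<tau>) \<ge> 1)"
  proof (cases "norm \<tau> \<ge> 1")
    case True
    note R = real_locus_top[OF assms(1) x True]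
    show ?thesis using R strip_top_open_wedge[OF R(1) True] eqh_in_strip[OF R(1)] True by auto
  next
    case False
    define \<sigma> where "\<sigma> = inverse (cnj \<tau>)"
    have \<tau>: "\<tau> = inverse (cnj \<sigma>)" by (simp add: \<sigma>_def)
    have \<sigma>: "\<sigma> \<in> real_locus" "0 \<le> Re \<sigma>" "Re \<sigma> \<le> 1 / 2" "norm \<sigma> > 1"
      using real_locus_wedge_inversion[OF assms] False by (simp_all only: \<sigma>_def not_le)
    note R = real_locus_top[OF \<sigma>(1-3) less_imp_le[OF \<sigma>(4)]]
    note S = eqh_in_strip[OF R(1)]
    have im: "Im \<sigma> > 0" using R(1) by (auto simp: strip_def)
    have h\<sigma>: "eqh \<sigma> = of_real (Re (eqh \<sigma>))" using R(2) by (simp add: complex_eq_iff)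
    have h\<sigma>1: "Re (eqh \<sigma>) > 1" using R(5) \<sigma>(4) by auto
    have h: "eqh \<tau> = of_real (1 / Re (eqh \<sigma>))"
      unfolding \<tau> eqh_inversion[OF im] by (subst h\<sigma>) (simp add: inverse_eq_divide)
    have N: "eqN \<sigma> \<noteq> 0" using h\<sigma>1 by (auto simp: eqh_def)
    have M: "nE6' \<tau> \<noteq> 0" unfolding \<tau> eqN_inversion[OF im] using N im by auto
    have ow: "\<tau> \<in> open_wedge" unfolding \<tau>
      by (intro open_wedge_inversion strip_top_open_wedge R(1) less_imp_le[OF \<sigma>(4)])
    \<comment> \<open>The map 1 / cnj is not holomorphic, so the derivative is carried over by -1 /
      w, which sends \<tau> to -cnj \<sigma>.\<close>
    have d: "eqh' \<tau> \<noteq> 0"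
    proof -
      have inv: "eqh w = - 1 / eqh (- 1 / w)" if "Im w > 0" for w
      proof -
        define w' where "w' = - 1 / w"
        have e: "(of_int 0 * w + of_int (-1)) / (of_int 1 * w + of_int 0) = w'" by (simp add: w'_def)
        have w: "w \<noteq> 0" using that by auto
        have "nE6' w' = w ^ 7 * eqN w" "eqN w' = - (w ^ 7 * nE6' w)"
          using nE6_moebius[of 0 0 "-1" 1 w, OF _ that, unfolded e] by simp_all
        then show ?thesis
          using w unfolding eqh_def w'_def[symmetric] by simp
      qed
      have e: "- 1 / \<tau> = - cnj \<sigma>" unfolding \<tau> by (simp add: field_simps)
      have t0: "\<tau> \<noteq> 0" using i by auto
      have M': "nE6' (- cnj \<sigma>) \<noteq> 0" using S(1) by (simp add: nE6_reflect[OF im])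
      have H': "eqh (- cnj \<sigma>) \<noteq> 0" using N S(1) by (simp add: eqh_def nE6_reflect[OF im])
      have D': "eqh' (- cnj \<sigma>) \<noteq> 0" using S(2) by (auto simp: nE6_reflect[OF im])
      have "((\<lambda>w. - 1 / w) has_field_derivative 1 / \<tau> ^ 2) (at \<tau>)"
        using t0 by (auto intro!: derivative_eq_intros simp: power2_eq_square)
      moreover have "(eqh has_field_derivative eqh' (- cnj \<sigma>)) (at (- 1 / \<tau>))"
        unfolding e using im M' by (intro has_field_derivative_eqh) auto
      ultimately have "((\<lambda>w. eqh (- 1 / w)) has_field_derivative eqh' (- cnj \<sigma>) * (1 / \<tau> ^ 2)) (at \<tau>)"
        by (rule DERIV_chain2[rotated])
      then have 1: "((\<lambda>w. - 1 / eqh (- 1 / w)) has_field_derivative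
           eqh' (- cnj \<sigma>) * (1 / \<tau> ^ 2) / eqh (- cnj \<sigma>) ^ 2) (at \<tau>)"
        using H' e by (auto intro!: derivative_eq_intros simp: power2_eq_square)
      have ev: "eventually (\<lambda>w. eqh w = - 1 / eqh (- 1 / w)) (nhds \<tau>)"
      proof (rule eventually_mono)
        show "eventually (\<lambda>w. w \<in> {w. Im w > 0}) (nhds \<tau>)"
          using i by (intro eventually_nhds_in_open) (auto simp: open_halfspace_Im_gt)
      qed (rule inv, simp)
      have "(eqh has_field_derivative eqh' (- cnj \<sigma>) * (1 / \<tau> ^ 2) / eqh (- cnj \<sigma>) ^ 2) (at \<tau>)"
        using 1 by (subst DERIV_cong_ev[OF refl ev refl])
      from DERIV_unique[OF this has_field_derivative_eqh[OF i M]] show ?thesis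
        using D' H' t0 by auto
    qed
    show ?thesis using ow M d h h\<sigma>1 False by auto
  qed
  then show "\<tau> \<in> open_wedge" "nE6' \<tau> \<noteq> 0" "eqh' \<tau> \<noteq> 0" "Im (eqh \<tau>) = 0" "Re (eqh \<tau>) > 0"
    "norm \<tau> < 1 \<Longrightarrow> Re (eqh \<tau>) < 1" "norm \<tau> \<ge> 1 \<Longrightarrow> Re (eqh \<tau>) \<ge> 1" by blast+
qed

text \<open>The value of h tells whether a point lies inside the unit disc; the inversion moves that
  case into \<open>strip\<close>, where h is injective.\<close>

lemma inj_on_eqh_wedge: "inj_on eqh (real_locus \<inter> wedge)"
proof (rule inj_onI)
  fix a b assume a: "a \<in> real_locus \<inter> wedge" and b: "b \<in> real_locus \<inter> wedge" and ab: "eqh a = eqh b"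
  note A = real_locus_wedge[of a] and B = real_locus_wedge[of b]
  have x: "0 \<le> Re a" "Re a \<le> 1 / 2" "0 \<le> Re b" "Re b \<le> 1 / 2" "Im a > 0" "Im b > 0"
    using a b by (auto simp: wedge_def)
  have iff: "norm a < 1 \<longleftrightarrow> norm b < 1" using A(6,7) B(6,7) a b ab by force
  show "a = b"
  proof (cases "norm a < 1")
    case False
    then have "a \<in> strip" "b \<in> strip" using real_locus_top(1)[of a] real_locus_top(1)[of b] x iff a b by auto
    with inj_on_eqh_strip ab show ?thesis by (auto dest: inj_onD)
  next
    case True
    have "inverse (cnj a) \<in> strip"
      by (rule real_locus_top(1)) (use real_locus_wedge_inversion[of a] a True in auto)
    moreover have "inverse (cnj b) \<in> strip"
      by (rule real_locus_top(1)) (use real_locus_wedge_inversion[of b] b iff True in auto)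
    moreover have "eqh (inverse (cnj a)) = eqh (inverse (cnj b))"
      using ab x by (simp only: eqh_inversion)
    ultimately have "inverse (cnj a) = inverse (cnj b)"
      using inj_on_eqh_strip by (auto dest: inj_onD)
    then show ?thesis by (metis inverse_cnj_inverse_cnj)
  qed
qed

lemma graph_pt_in_wedge:
  assumes "y \<ge> 37 / 40" "norm (graph_pt y) \<ge> 1"
  shows "graph_pt y \<in> real_locus \<inter> wedge"
proof -
  note g = graph_x[OF assms(1)]
  have "graph_pt y \<in> real_locus"
    using g assms Im_eqh_eq_0_iff[of "graph_pt y"] eqh_in_strip(1)[OF g(4)] by simp
  moreover have "graph_pt y \<in> wedge"
    using strip_top_open_wedge[OF g(4) assms(2)] by (auto simp: open_wedge_def wedge_def)
  ultimately show ?thesis by simp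
qed

text \<open>Values s >= 1 are taken on the graph by continuity, values below 1 at inverted
  points.\<close>

lemma eqh_surj_wedge:
  assumes "s > 0"
  shows "\<exists>\<tau> \<in> real_locus \<inter> wedge. eqh \<tau> = of_real s"
proof -
  have ge1: "\<exists>\<tau> \<in> real_locus \<inter> wedge. eqh \<tau> = of_real s" if s1: "s \<ge> 1" for s :: real
  proof -
    obtain y0 where y0: "y0 > 37 / 40" "graph_h y0 = 1"
      "\<And>y. y \<ge> 37 / 40 \<Longrightarrow> norm (graph_pt y) \<ge> 1 \<longleftrightarrow> y \<ge> y0" using graph_crossing by metis
    have "graph_h (max 1000 s) \<ge> s" using graph_h_ge[of "max 1000 s"] by linarith
    moreover have "max 1000 s \<ge> y0"
      using y0(3)[of "max 1000 s"] abs_Im_le_cmod[of "graph_pt (max 1000 s)"] by (auto simp: le_max_iff_disj)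
    moreover have "continuous_on {y0..max 1000 s} graph_h"
      using y0 by (intro continuous_on_subset[OF continuous_graph_h]) auto
    ultimately obtain y where y: "y \<ge> y0" "graph_h y = s"
      using IVT'[of graph_h y0 s "max 1000 s"] y0(2) s1 by metis
    then show ?thesis
      using graph_pt_in_wedge[of y] graph_x(5)[of y] y0 by (intro bexI[of _ "graph_pt y"]) auto
  qed
  show ?thesis
  proof (cases "s \<ge> 1")
    case False
    then obtain \<tau> where \<tau>: "\<tau> \<in> real_locus \<inter> wedge" "eqh \<tau> = of_real (1 / s)"
      using ge1[of "1 / s"] assms by auto
    have "Im \<tau> > 0" using \<tau> by (auto simp: wedge_def)
    then have "eqh (inverse (cnj \<tau>)) = of_real s" using \<tau> by (simp only: eqh_inversion) simp
    then show ?thesis using \<tau> real_locus_inversion wedge_inversion by blast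
  qed (use ge1 in auto)
qed

section \<open>Parametrisation of the arc by the value of h\<close>

definition zeta_curve :: "real \<Rightarrow> complex" where
  "zeta_curve s = (THE \<tau>. \<tau> \<in> real_locus \<inter> wedge \<and> eqh \<tau> = of_real s)"

lemma zeta_curve_eqI:
  assumes "\<tau> \<in> real_locus" "\<tau> \<in> wedge" "eqh \<tau> = of_real s"
  shows "zeta_curve s = \<tau>"
  unfolding zeta_curve_def
  using assms inj_onD[OF inj_on_eqh_wedge] by (intro the_equality) auto

lemma zeta_curve:
  assumes "s > 0"
  shows "zeta_curve s \<in> real_locus" "zeta_curve s \<in> wedge" "eqh (zeta_curve s) = of_real s"
  using eqh_surj_wedge[OF assms] zeta_curve_eqI by auto

lemma real_locus_wedge_eq: "real_locus \<inter> wedge = zeta_curve ` {0<..}"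
proof (intro equalityI subsetI)
  fix \<tau> assume "\<tau> \<in> real_locus \<inter> wedge"
  then have \<tau>: "\<tau> \<in> real_locus" "\<tau> \<in> wedge" by auto
  have "eqh \<tau> = of_real (Re (eqh \<tau>))" using real_locus_wedge(4)[OF \<tau>] by (simp add: complex_eq_iff)
  then have "zeta_curve (Re (eqh \<tau>)) = \<tau>" by (rule zeta_curve_eqI[OF \<tau>])
  moreover have "Re (eqh \<tau>) > 0" by (rule real_locus_wedge(5)[OF \<tau>])
  ultimately
  show "\<tau> \<in> zeta_curve ` {0<..}" by (metis greaterThan_iff image_eqI)
qed (use zeta_curve in auto)

lemma zeta_curve_inverse:
  assumes "s > 0"
  shows "zeta_curve (inverse s) = inverse (cnj (zeta_curve s))"
proof (rule zeta_curve_eqI)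
  note z = zeta_curve[OF assms]
  have "Im (zeta_curve s) > 0" using z by (auto simp: wedge_def)
  then show "eqh (inverse (cnj (zeta_curve s))) = of_real (inverse s)"
    using z by (simp only: eqh_inversion) simp
qed (use zeta_curve[OF assms] real_locus_inversion wedge_inversion in auto)

lemma inj_on_zeta_curve: "inj_on zeta_curve {0<..}"
  by (rule inj_onI) (metis greaterThan_iff of_real_eq_iff zeta_curve(3))

lemma zeta_curve_graph:
  assumes "s \<ge> 1"
  shows "zeta_curve s = graph_pt (Im (zeta_curve s))" "Im (zeta_curve s) \<ge> 37 / 40"
    "graph_h (Im (zeta_curve s)) = s"
proof -
  have s: "s > 0" using assms by simp
  note z = zeta_curve[OF s]
  have "norm (zeta_curve s) \<ge> 1" using real_locus_wedge(6)[OF z(1,2)] z(3) assms by force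
  then obtain y where "zeta_curve s = graph_pt y" "y \<ge> 37 / 40"
    using real_locus_top(3)[of "zeta_curve s"] z by (auto simp: wedge_def)
  then show "zeta_curve s = graph_pt (Im (zeta_curve s))" "Im (zeta_curve s) \<ge> 37 / 40"
    "graph_h (Im (zeta_curve s)) = s" using z(3) by (simp_all add: graph_h_def)
qed

lemma Im_zeta_curve_at_top: "filterlim (\<lambda>s. Im (zeta_curve s)) at_top at_top"
  unfolding filterlim_at_top
proof
  fix Y :: real
  define Y' where "Y' = max Y (37 / 40)"
  show "eventually (\<lambda>s. Y \<le> Im (zeta_curve s)) at_top"
  proof (rule eventually_at_top_linorderI)
    fix s assume "s \<ge> max 1 (graph_h Y')"
    then have s: "s \<ge> 1" "s \<ge> graph_h Y'" by auto
    note z = zeta_curve_graph[OF s(1)]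
    have "\<not> Im (zeta_curve s) < Y'"
      using graph_h_less[OF z(2), of Y'] z(3) s by auto
    then show "Y \<le> Im (zeta_curve s)" by (simp add: Y'_def)
  qed
qed

lemma zeta_curve_at_top: "filterlim zeta_curve (at_i_infinity (1 / 4)) at_top"
proof -
  have "((\<lambda>s. graph_x (Im (zeta_curve s))) \<longlongrightarrow> 1 / 4) at_top"
    by (rule filterlim_compose[OF tendsto_graph_x Im_zeta_curve_at_top])
  moreover have "eventually (\<lambda>s. graph_x (Im (zeta_curve s)) = Re (zeta_curve s)) at_top"
    by (rule eventually_at_top_linorderI[of 1]) (metis zeta_curve_graph(1) graph_pt_sel(1))
  ultimately have "((\<lambda>s. Re (zeta_curve s)) \<longlongrightarrow> 1 / 4) at_top" by (rule Lim_transform_eventually)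
  then show ?thesis
    unfolding at_i_infinity_def using Im_zeta_curve_at_top
    by (simp add: filterlim_inf filterlim_filtercomap_iff o_def)
qed

lemma inverse_zeta_curve_at_0:
  "eventually (\<lambda>s. zeta_curve s = inverse (cnj (zeta_curve (inverse s)))) (at_right 0)"
proof (rule eventually_mono[OF eventually_at_right_less[of 0]])
  fix s :: real assume "0 < s"
  then show "zeta_curve s = inverse (cnj (zeta_curve (inverse s)))"
    using zeta_curve_inverse[of "inverse s"] by simp
qed

text \<open>The inversion exchanges the two ends of the arc, so this is the end at \<infinity> seen
  from 0.\<close>

lemma zeta_curve_at_0: "(zeta_curve \<longlongrightarrow> 0) (at_right 0)"
proof -
  have "filterlim (\<lambda>s::real. Im (zeta_curve (inverse s))) at_top (at_right 0)"
    by (rule filterlim_compose[OF Im_zeta_curve_at_top filterlim_inverse_at_top_right])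
  then have 1: "((\<lambda>s::real. inverse (Im (zeta_curve (inverse s)))) \<longlongrightarrow> 0) (at_right 0)"
    by (rule tendsto_inverse_0_at_top)
  have "eventually (\<lambda>s. norm (zeta_curve s) \<le> inverse (Im (zeta_curve (inverse s)))) (at_right 0)"
    using inverse_zeta_curve_at_0 eventually_at_right_less[of 0]
  proof eventually_elim
    case (elim s)
    have "Im (zeta_curve (inverse s)) > 0" using zeta_curve(2)[of "inverse s"] elim by (auto simp: wedge_def)
    moreover have "norm (zeta_curve s) = inverse (norm (zeta_curve (inverse s)))"
      by (subst elim(1)) (simp add: norm_inverse)
    ultimately show ?case using abs_Im_le_cmod[of "zeta_curve (inverse s)"] by (simp add: le_imp_inverse_le)
  qed
  from Lim_null_comparison[OF this 1] show ?thesis .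
qed

text \<open>Near a point of the arc the curve is a local holomorphic inverse of h restricted to real
  arguments. As the arc lies in the open wedge, this inverse stays in the wedge, and by uniqueness
  its values at real s are \<open>zeta_curve s\<close>.\<close>

lemma zeta_curve_holomorphic_extension:
  assumes "s0 > 0"
  obtains e \<phi> where "e > 0" "\<phi> holomorphic_on ball (of_real s0) e" "deriv \<phi> (of_real s0) \<noteq> 0"
    "\<And>s. \<bar>s - s0\<bar> < e \<Longrightarrow> s > 0 \<and> zeta_curve s = \<phi> (of_real s)"
proof -
  define \<tau>0 where "\<tau>0 = zeta_curve s0"
  note z = zeta_curve[OF assms, folded \<tau>0_def]
  note w = real_locus_wedge[OF z(1,2)]
  have oH: "open {\<tau>::complex. Im \<tau> > 0}" by (simp add: open_halfspace_Im_gt)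
  have ow: "open open_wedge"
  proof -
    have s: "open_wedge = {\<tau>. Im \<tau> > 0} \<inter> {\<tau>. Re \<tau> > 0} \<inter> {\<tau>. Re \<tau> < 1 / 2} \<inter> - cball 1 1"
      by (auto simp: open_wedge_def dist_norm norm_minus_commute)
    show ?thesis unfolding s
      by (intro open_Int open_halfspace_Im_gt open_halfspace_Re_gt open_halfspace_Re_lt open_Compl closed_cball)
  qed
  have c: "continuous_on {\<tau>. Im \<tau> > 0} nE6'"
    using has_field_derivative_nE6' DERIV_isCont by (intro continuous_at_imp_continuous_on) blast
  have "open ({\<tau>. Im \<tau> > 0} \<inter> nE6' -` (- {0}))"
    using continuous_open_preimage[OF c oH open_Compl[OF closed_singleton[of 0]]] .
  define U where "U = open_wedge \<inter> ({\<tau>. Im \<tau> > 0} \<inter> nE6' -` (- {0}))"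
  have oU: "open U" unfolding U_def by (rule open_Int[OF ow]) fact
  have U: "\<tau>0 \<in> U" using w by (auto simp: U_def open_wedge_def)
  have dU: "(eqh has_field_derivative eqh' \<tau>) (at \<tau>)" if "\<tau> \<in> U" for \<tau>
    using that by (intro has_field_derivative_eqh) (auto simp: U_def)
  have hol: "eqh holomorphic_on U"
    using dU oU by (auto simp: holomorphic_on_open)
  have "deriv eqh \<tau>0 \<noteq> 0" using DERIV_imp_deriv[OF dU[OF U]] w(3) by simp
  then obtain r where r: "r > 0" "ball \<tau>0 r \<subseteq> U" "inj_on eqh (ball \<tau>0 r)"
    using has_complex_derivative_locally_injective[OF hol U oU] by blast
  have holb: "eqh holomorphic_on ball \<tau>0 r" using hol r(2) by (rule holomorphic_on_subset)
  obtain g where g: "g holomorphic_on (eqh ` ball \<tau>0 r)"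
    "\<And>z. z \<in> ball \<tau>0 r \<Longrightarrow> deriv eqh z * deriv g (eqh z) = 1" "\<And>z. z \<in> ball \<tau>0 r \<Longrightarrow> g (eqh z) = z"
    using holomorphic_has_inverse[OF holb open_ball r(3)] by blast
  have "open (eqh ` ball \<tau>0 r)" by (rule open_mapping_thm3[OF holb open_ball r(3)])
  moreover have "of_real s0 \<in> eqh ` ball \<tau>0 r" using z(3) r(1) by (metis centre_in_ball image_eqI)
  ultimately obtain e where e: "e > 0" "ball (of_real s0) e \<subseteq> eqh ` ball \<tau>0 r"
    by (auto simp: open_contains_ball)
  show ?thesis
  proof (rule that[of e g])
    show "g holomorphic_on ball (of_real s0) e" using g(1) e(2) by (rule holomorphic_on_subset)
    show "deriv g (of_real s0) \<noteq> 0" using g(2)[of \<tau>0] r(1) z(3) by auto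
    fix s :: real assume "\<bar>s - s0\<bar> < e"
    then have "complex_of_real s \<in> ball (of_real s0) e"
      by (simp add: dist_norm abs_minus_commute flip: of_real_diff)
    then obtain \<tau> where \<tau>: "\<tau> \<in> ball \<tau>0 r" "eqh \<tau> = of_real s" using e(2) by (metis image_iff subsetD)
    then have "\<tau> \<in> U" using r(2) by blast
    then have "Im \<tau> > 0" "nE6' \<tau> \<noteq> 0" "\<tau> \<in> wedge" by (auto simp: U_def open_wedge_def wedge_def)
    moreover from this \<tau> have "\<tau> \<in> real_locus" using Im_eqh_eq_0_iff by simp
    ultimately have "zeta_curve s = \<tau>" "s > 0"
      using zeta_curve_eqI[of \<tau> s] real_locus_wedge(5)[of \<tau>] \<tau> by auto
    then show "s > 0 \<and> zeta_curve s = g (of_real s)" using g(3)[OF \<tau>(1)] \<tau>(2) by simp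
  qed (rule e(1))
qed

section \<open>The three curves\<close>

text \<open>This class of functions is closed under differentiation, so membership alone yields
  derivatives of all orders.\<close>

definition locally_holomorphic_on :: "(real \<Rightarrow> complex) \<Rightarrow> real set \<Rightarrow> bool" where
  "locally_holomorphic_on \<gamma> S \<longleftrightarrow> (\<forall>t\<in>S. \<exists>e>0. \<exists>\<phi>. \<phi> holomorphic_on ball (of_real t) e \<and>
     (\<forall>s. \<bar>s - t\<bar> < e \<longrightarrow> \<gamma> s = \<phi> (of_real s)))"

lemma of_real_in_ball_iff: "complex_of_real s \<in> ball (of_real t) e \<longleftrightarrow> \<bar>s - t\<bar> < e"
  by (simp add: dist_norm abs_minus_commute flip: of_real_diff)

lemma has_vector_derivative_holomorphic_restriction:
  assumes "\<phi> holomorphic_on ball (of_real t) e" "\<And>s. \<bar>s - t\<bar> < e \<Longrightarrow> \<gamma> s = \<phi> (of_real s)" "\<bar>s - t\<bar> < e"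
  shows "(\<gamma> has_vector_derivative deriv \<phi> (of_real s)) (at s)"
proof -
  have "(\<phi> has_field_derivative deriv \<phi> (of_real s)) (at (of_real s))"
    using assms(1,3) by (intro holomorphic_derivI[OF _ open_ball]) (auto simp only: of_real_in_ball_iff)
  moreover have "(of_real has_vector_derivative (1::complex)) (at s)"
    using has_vector_derivative_of_real[of "\<lambda>x. x" 1 "at s"] by simp
  ultimately have "((\<lambda>s. \<phi> (of_real s)) has_vector_derivative 1 * deriv \<phi> (of_real s)) (at s)"
    using field_vector_diff_chain_at[of of_real 1 s \<phi>] by (simp add: o_def)
  then have d: "((\<lambda>s. \<phi> (of_real s)) has_vector_derivative deriv \<phi> (of_real s)) (at s)"
    by (simp only: mult_1)
  show ?thesis
  proof (rule has_vector_derivative_transform_within_open[OF d open_ball[of t e]])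
    show "s \<in> ball t e" using assms(3) by (simp add: dist_real_def abs_minus_commute)
    show "\<phi> (of_real r) = \<gamma> r" if "r \<in> ball t e" for r
      using assms(2)[of r] that by (simp add: dist_real_def abs_minus_commute)
  qed
qed

lemma locally_holomorphic_vector_derivative:
  assumes "locally_holomorphic_on \<gamma> S"
  shows "locally_holomorphic_on (\<lambda>t. vector_derivative \<gamma> (at t)) S"
  unfolding locally_holomorphic_on_def
proof
  fix t assume "t \<in> S"
  then obtain e \<phi> where e: "e > 0" "\<phi> holomorphic_on ball (of_real t) e"
    "\<And>s. \<bar>s - t\<bar> < e \<Longrightarrow> \<gamma> s = \<phi> (of_real s)"
    using assms unfolding locally_holomorphic_on_def by blast
  have "deriv \<phi> holomorphic_on ball (of_real t) e" using e(2) by (intro holomorphic_deriv) auto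
  moreover have "vector_derivative \<gamma> (at s) = deriv \<phi> (of_real s)" if "\<bar>s - t\<bar> < e" for s
    using has_vector_derivative_holomorphic_restriction[OF e(2,3) that] by (rule vector_derivative_at)
  ultimately show "\<exists>e>0. \<exists>\<phi>. \<phi> holomorphic_on ball (of_real t) e \<and>
     (\<forall>s. \<bar>s - t\<bar> < e \<longrightarrow> vector_derivative \<gamma> (at s) = \<phi> (of_real s))" using e(1) by blast
qed

lemma smooth_on_open_locally_holomorphic:
  assumes "locally_holomorphic_on \<gamma> S"
  shows "smooth_on_open S \<gamma>"
  unfolding smooth_on_open_def
proof
  fix k :: nat
  define \<delta> where "\<delta> = ((\<lambda>f t. vector_derivative f (at t)) ^^ k) \<gamma>"
  have lh: "locally_holomorphic_on \<delta> S"
    unfolding \<delta>_def by (induction k) (use assms locally_holomorphic_vector_derivative in auto)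
  have "\<delta> differentiable (at t within S)" if "t \<in> S" for t
  proof -
    obtain e \<phi> where e: "e > 0" "\<phi> holomorphic_on ball (of_real t) e"
      "\<And>s. \<bar>s - t\<bar> < e \<Longrightarrow> \<delta> s = \<phi> (of_real s)"
      using lh \<open>t \<in> S\<close> unfolding locally_holomorphic_on_def by blast
    have "(\<delta> has_vector_derivative deriv \<phi> (of_real t)) (at t)"
      by (rule has_vector_derivative_holomorphic_restriction[OF e(2,3)]) (simp_all add: e(1))
    then show ?thesis by (rule differentiable_at_withinI[OF differentiableI_vector])
  qed
  then show "((\<lambda>f t. vector_derivative f (at t)) ^^ k) \<gamma> differentiable_on S"
    unfolding differentiable_on_def \<delta>_def by blast
qed

text \<open>Treats the three arcs at once: \<open>m\<close> is the identity or a rotation,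
  \<open>\<sigma>\<close> maps (0, 1) onto the parameters (0, \<infinity>), and
  \<open>\<Sigma>\<close> is its holomorphic extension, so the whole parametrisation is locally
  holomorphic with nonzero derivative.\<close>

lemma smooth_curve_with_ends_zeta:
  assumes m: "m holomorphic_on {z. Im z > 0}" "inj_on m {z. Im z > 0}" "\<And>z. Im z > 0 \<Longrightarrow> deriv m z \<noteq> 0"
    and T: "open T" "\<Sigma> holomorphic_on T" "\<And>t. 0 < t \<Longrightarrow> t < 1 \<Longrightarrow> of_real t \<in> T \<and> deriv \<Sigma> (of_real t) \<noteq> 0"
    and \<sigma>: "\<And>t. of_real t \<in> T \<Longrightarrow> \<Sigma> (of_real t) = of_real (\<sigma> t)" "bij_betw \<sigma> {0<..<1} {0<..}"
    and ends: "filterlim (\<lambda>t. m (zeta_curve (\<sigma> t))) P (at_right 0)" "filterlim (\<lambda>t. m (zeta_curve (\<sigma> t))) Q (at_left 1)"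
  shows "smooth_curve_with_ends (m ` (real_locus \<inter> wedge)) P Q"
proof -
  define \<gamma> where "\<gamma> = (\<lambda>t. m (zeta_curve (\<sigma> t)))"
  have oH: "open {z::complex. Im z > 0}" by (simp add: open_halfspace_Im_gt)
  have spos: "\<sigma> t > 0" if "t \<in> {0<..<1}" for t using \<sigma>(2) that by (auto simp: bij_betw_def)
  have zH: "Im (zeta_curve s) > 0" if "s > 0" for s using zeta_curve(2)[OF that] by (auto simp: wedge_def)
  have main: "\<exists>e>0. \<exists>\<psi>. \<psi> holomorphic_on ball (of_real t) e \<and> (\<forall>s. \<bar>s - t\<bar> < e \<longrightarrow> \<gamma> s = \<psi> (of_real s))
      \<and> deriv \<psi> (of_real t) \<noteq> 0" if t: "t \<in> {0<..<1}" for t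
  proof -
    define s0 where "s0 = \<sigma> t"
    have tT: "of_real t \<in> T" "deriv \<Sigma> (of_real t) \<noteq> 0" using T(3) t by auto
    have S0: "\<Sigma> (of_real t) = of_real s0" unfolding s0_def by (rule \<sigma>(1)[OF tT(1)])
    obtain e \<phi> where e: "e > 0" "\<phi> holomorphic_on ball (of_real s0) e" "deriv \<phi> (of_real s0) \<noteq> 0"
      "\<And>s. \<bar>s - s0\<bar> < e \<Longrightarrow> s > 0 \<and> zeta_curve s = \<phi> (of_real s)"
      using zeta_curve_holomorphic_extension[OF spos[OF t, folded s0_def]] by blast
    \<comment> \<open>Restricts the extension \<phi> to parameters whose image lies in the upper
      half-plane, the domain of \<open>m\<close>.\<close>
    define B where "B = ball (complex_of_real s0) e \<inter> \<phi> -` {z. Im z > 0}"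
    have oB: "open B"
      unfolding B_def by (rule continuous_open_preimage[OF holomorphic_on_imp_continuous_on[OF e(2)] open_ball oH])
    define V where "V = T \<inter> \<Sigma> -` B"
    have oO: "open V"
      unfolding V_def by (rule continuous_open_preimage[OF holomorphic_on_imp_continuous_on[OF T(2)] T(1) oB])
    have p0: "\<phi> (of_real s0) = zeta_curve s0" using e(1) e(4)[of s0] by simp
    have s0B: "of_real s0 \<in> B" using e(1) zH[OF spos[OF t]] p0 by (simp add: B_def s0_def)
    have "of_real t \<in> V" using tT S0 s0B by (simp add: V_def)
    then obtain d where d: "d > 0" "ball (of_real t) d \<subseteq> V" using oO by (auto simp: open_contains_ball)
    define \<psi> where "\<psi> = m \<circ> (\<phi> \<circ> \<Sigma>)"
    have holO: "\<psi> holomorphic_on V"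
      unfolding \<psi>_def
    proof (intro holomorphic_on_compose_gen[OF holomorphic_on_compose_gen m(1)])
      show "\<Sigma> holomorphic_on V" using T(2) by (rule holomorphic_on_subset) (auto simp: V_def)
      show "\<phi> holomorphic_on B" using e(2) by (rule holomorphic_on_subset) (auto simp: B_def)
    qed (auto simp: V_def B_def)
    have d1: "(\<Sigma> has_field_derivative deriv \<Sigma> (of_real t)) (at (of_real t))"
      by (rule holomorphic_derivI[OF T(2,1) tT(1)])
    have d2: "(\<phi> has_field_derivative deriv \<phi> (of_real s0)) (at (\<Sigma> (of_real t)))"
      unfolding S0 using e(1) by (intro holomorphic_derivI[OF e(2) open_ball]) auto
    have d3: "(m has_field_derivative deriv m (zeta_curve s0)) (at (\<phi> (\<Sigma> (of_real t))))"
      unfolding S0 p0 using zH[OF spos[OF t]] by (intro holomorphic_derivI[OF m(1) oH]) (auto simp: s0_def)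
    have "(\<psi> has_field_derivative deriv m (zeta_curve s0) * (deriv \<phi> (of_real s0) * deriv \<Sigma> (of_real t))) (at (of_real t))"
      unfolding \<psi>_def o_def by (rule DERIV_chain2[OF d3 DERIV_chain2[OF d2 d1]])
    from DERIV_imp_deriv[OF this] have "deriv \<psi> (of_real t) \<noteq> 0"
      using e(3) tT(2) m(3)[OF zH[OF spos[OF t]]] by (simp add: s0_def)
    moreover have "\<gamma> s = \<psi> (of_real s)" if "\<bar>s - t\<bar> < d" for s
    proof -
      have sO: "of_real s \<in> V" using d(2) that of_real_in_ball_iff by blast
      then have "\<Sigma> (of_real s) = of_real (\<sigma> s)" "of_real (\<sigma> s) \<in> B" using \<sigma>(1) by (auto simp: V_def)
      then show ?thesis
        using e(4)[of "\<sigma> s"] by (simp add: \<gamma>_def \<psi>_def B_def of_real_in_ball_iff del: mem_ball)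
    qed
    ultimately show ?thesis using d holO holomorphic_on_subset by metis
  qed
  have "locally_holomorphic_on \<gamma> {0<..<1}" unfolding locally_holomorphic_on_def using main by meson
  then have 1: "smooth_on_open {0<..<1} \<gamma>" by (rule smooth_on_open_locally_holomorphic)
  have 2: "vector_derivative \<gamma> (at t) \<noteq> 0" if t: "t \<in> {0<..<1}" for t
  proof -
    obtain e \<psi> where "e > 0" "\<psi> holomorphic_on ball (of_real t) e" "\<forall>s. \<bar>s - t\<bar> < e \<longrightarrow> \<gamma> s = \<psi> (of_real s)"
      "deriv \<psi> (of_real t) \<noteq> 0" using main[OF t] by blast
    then show ?thesis
      using vector_derivative_at[OF has_vector_derivative_holomorphic_restriction[of \<psi> t e \<gamma> t]] by simp
  qed
  have 3: "inj_on \<gamma> {0<..<1}"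
  proof (rule inj_onI)
    fix s t :: real assume st: "s \<in> {0<..<1}" "t \<in> {0<..<1}" "\<gamma> s = \<gamma> t"
    then have "zeta_curve (\<sigma> s) = zeta_curve (\<sigma> t)"
      using inj_onD[OF m(2)] zH spos by (auto simp: \<gamma>_def)
    then have "\<sigma> s = \<sigma> t" using inj_onD[OF inj_on_zeta_curve] spos st by auto
    then show "s = t" using \<sigma>(2) st by (auto simp: bij_betw_def dest: inj_onD)
  qed
  have 4: "m ` (real_locus \<inter> wedge) = \<gamma> ` {0<..<1}"
    unfolding real_locus_wedge_eq bij_betw_imp_surj_on[OF \<sigma>(2), symmetric] by (simp add: \<gamma>_def image_image)
  show ?thesis
    unfolding smooth_curve_with_ends_def using 1 2 3 4 ends by (intro exI[of _ \<gamma>]) (auto simp: \<gamma>_def)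
qed

text \<open>The rotation of order three about exp(pi \<i> / 3), with inverse \<open>rho2\<close>; it
  permutes the cusps as \<infinity> -> 0 -> 1 -> \<infinity>.\<close>

definition rho1 :: "complex \<Rightarrow> complex" where "rho1 z = 1 / (1 - z)"
definition rho2 :: "complex \<Rightarrow> complex" where "rho2 z = 1 - 1 / z"

lemma rho_inverse: "Im z \<noteq> 0 \<Longrightarrow> rho1 (rho2 z) = z" "Im z \<noteq> 0 \<Longrightarrow> rho2 (rho1 z) = z"
proof -
  assume z: "Im z \<noteq> 0"
  then have "z \<noteq> 0" "1 - z \<noteq> 0" by (auto simp: complex_eq_iff)
  then show "rho1 (rho2 z) = z" "rho2 (rho1 z) = z" by (simp_all add: rho1_def rho2_def)
qed

lemma smooth_curve_rho1: "smooth_curve_with_ends (rho1 ` (real_locus \<inter> wedge)) (nhds 0) (nhds 1)"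
  and smooth_curve_wedge: "smooth_curve_with_ends (real_locus \<inter> wedge) (nhds 0) (at_i_infinity (1 / 4))"
  and smooth_curve_rho2: "smooth_curve_with_ends (rho2 ` (real_locus \<inter> wedge)) (nhds 1) (at_i_infinity (3 / 4))"
proof -
  have nz: "z \<noteq> 0" "1 - z \<noteq> 0" if "Im z > 0" for z using that by (auto simp: complex_eq_iff)
  define \<Sigma>1 \<Sigma>2 :: "complex \<Rightarrow> complex" where "\<Sigma>1 = (\<lambda>z. z / (1 - z))" and "\<Sigma>2 = (\<lambda>z. (1 - z) / z)"
  \<comment> \<open>\<open>\<sigma>1\<close> runs from 0 to \<infinity>, \<open>\<sigma>2\<close>
    from \<infinity> to 0: the two rotated arcs are traversed backwards so that their ends come in
    the stated order.\<close>
  define \<sigma>1 \<sigma>2 :: "real \<Rightarrow> real" where "\<sigma>1 = (\<lambda>t. t / (1 - t))" and "\<sigma>2 = (\<lambda>t. (1 - t) / t)"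
  have d1: "(\<Sigma>1 has_field_derivative 1 / (1 - z) ^ 2) (at z)" if "z \<in> - {1}" for z
    unfolding \<Sigma>1_def using that by (auto intro!: derivative_eq_intros simp: power2_eq_square field_simps)
  have d2: "(\<Sigma>2 has_field_derivative - 1 / z ^ 2) (at z)" if "z \<in> - {0}" for z
    unfolding \<Sigma>2_def using that by (auto intro!: derivative_eq_intros simp: power2_eq_square field_simps)
  have o: "open (- {1::complex})" "open (- {0::complex})" by auto
  have T1: "\<Sigma>1 holomorphic_on - {1}" "\<And>t. 0 < t \<Longrightarrow> t < 1 \<Longrightarrow> of_real t \<in> - {1::complex} \<and> deriv \<Sigma>1 (of_real t) \<noteq> 0"
    using d1 o DERIV_imp_deriv[OF d1] by (auto simp: holomorphic_on_open)
  have T2: "\<Sigma>2 holomorphic_on - {0}" "\<And>t. 0 < t \<Longrightarrow> t < 1 \<Longrightarrow> of_real t \<in> - {0::complex} \<and> deriv \<Sigma>2 (of_real t) \<noteq> 0"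
    using d2 o DERIV_imp_deriv[OF d2] by (auto simp: holomorphic_on_open)
  have s1: "\<Sigma>1 (of_real t) = of_real (\<sigma>1 t)" and s2: "\<Sigma>2 (of_real t) = of_real (\<sigma>2 t)" for t
    by (simp_all add: \<Sigma>1_def \<sigma>1_def \<Sigma>2_def \<sigma>2_def)
  have b1: "bij_betw \<sigma>1 {0<..<1} {0<..}"
    by (rule bij_betwI[of _ _ _ "\<lambda>s. s / (1 + s)"]) (auto simp: \<sigma>1_def field_simps)
  have b2: "bij_betw \<sigma>2 {0<..<1} {0<..}"
    by (rule bij_betwI[of _ _ _ "\<lambda>s. 1 / (1 + s)"]) (auto simp: \<sigma>2_def field_simps)
  have l1: "filterlim \<sigma>1 (at_right 0) (at_right 0)" "filterlim \<sigma>1 at_top (at_left 1)"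
    unfolding \<sigma>1_def by real_asymp+
  have l2: "filterlim \<sigma>2 at_top (at_right 0)" "filterlim \<sigma>2 (at_right 0) (at_left 1)"
    unfolding \<sigma>2_def by real_asymp+
  have dr1: "(rho1 has_field_derivative 1 / (1 - z) ^ 2) (at z)" if "Im z > 0" for z
    unfolding rho1_def using nz[OF that] by (auto intro!: derivative_eq_intros simp: power2_eq_square field_simps)
  have dr2: "(rho2 has_field_derivative 1 / z ^ 2) (at z)" if "Im z > 0" for z
    unfolding rho2_def using nz[OF that] by (auto intro!: derivative_eq_intros simp: power2_eq_square field_simps)
  have oH: "open {z::complex. Im z > 0}" by (simp add: open_halfspace_Im_gt)
  have m1: "rho1 holomorphic_on {z. Im z > 0}" "inj_on rho1 {z. Im z > 0}" "\<And>z. Im z > 0 \<Longrightarrow> deriv rho1 z \<noteq> 0"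
    using dr1 oH DERIV_imp_deriv[OF dr1] nz by (auto simp: holomorphic_on_open rho1_def inj_on_def)
  have m2: "rho2 holomorphic_on {z. Im z > 0}" "inj_on rho2 {z. Im z > 0}" "\<And>z. Im z > 0 \<Longrightarrow> deriv rho2 z \<noteq> 0"
    using dr2 oH DERIV_imp_deriv[OF dr2] nz by (auto simp: holomorphic_on_open rho2_def inj_on_def)
  have zinf: "filterlim zeta_curve at_infinity at_top" "filterlim (\<lambda>s. 1 - zeta_curve s) at_infinity at_top"
  proof -
    have "filterlim (\<lambda>s. norm (zeta_curve s)) at_top at_top"
      by (rule filterlim_at_top_mono[OF Im_zeta_curve_at_top])
        (auto intro!: always_eventually order_trans[OF abs_ge_self abs_Im_le_cmod])
    then show "filterlim zeta_curve at_infinity at_top" by (rule filterlim_norm_at_top_imp_at_infinity)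
    have "Im z \<le> norm (1 - z)" for z using abs_Im_le_cmod[of "1 - z"] by simp
    then have "filterlim (\<lambda>s. norm (1 - zeta_curve s)) at_top at_top"
      by (intro filterlim_at_top_mono[OF Im_zeta_curve_at_top]) (auto intro!: always_eventually)
    then show "filterlim (\<lambda>s. 1 - zeta_curve s) at_infinity at_top" by (rule filterlim_norm_at_top_imp_at_infinity)
  qed
  have r1: "((\<lambda>s. rho1 (zeta_curve s)) \<longlongrightarrow> 0) at_top"
    unfolding rho1_def divide_inverse mult_1 by (rule filterlim_compose[OF tendsto_inverse_0 zinf(2)])
  have r1': "((\<lambda>s. rho1 (zeta_curve s)) \<longlongrightarrow> 1) (at_right 0)"
    unfolding rho1_def using zeta_curve_at_0 by (auto intro!: tendsto_eq_intros)
  have r2: "((\<lambda>s. rho2 (zeta_curve s)) \<longlongrightarrow> 1) at_top"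
    unfolding rho2_def divide_inverse mult_1
    using tendsto_diff[OF tendsto_const filterlim_compose[OF tendsto_inverse_0 zinf(1)], of 1] by simp
  have r2': "filterlim (\<lambda>s. rho2 (zeta_curve s)) (at_i_infinity (3 / 4)) (at_right 0)"
  proof -
    have z: "filterlim (\<lambda>s. zeta_curve (inverse s)) (at_i_infinity (1 / 4)) (at_right 0)"
      by (rule filterlim_compose[OF zeta_curve_at_top filterlim_inverse_at_top_right])
    then have 1: "filterlim (\<lambda>s. Im (zeta_curve (inverse s))) at_top (at_right 0)"
       "((\<lambda>s. Re (zeta_curve (inverse s))) \<longlongrightarrow> 1 / 4) (at_right 0)"
      unfolding at_i_infinity_def by (auto simp: filterlim_inf filterlim_filtercomap_iff o_def)
    \<comment> \<open>As \<open>zeta_curve (inverse s)\<close> is 1 / cnj of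
      \<open>zeta_curve s\<close>, the map 1 - 1 / z becomes 1 - cnj of a point tending to 1/4 +
      \<i>\<infinity>, whence 3/4 = 1 - 1/4.\<close>
    have ev: "eventually (\<lambda>s. rho2 (zeta_curve s) = 1 - cnj (zeta_curve (inverse s))) (at_right 0)"
      using inverse_zeta_curve_at_0 by eventually_elim (simp add: rho2_def divide_inverse)
    have "filterlim (\<lambda>s. 1 - cnj (zeta_curve (inverse s))) (at_i_infinity (3 / 4)) (at_right 0)"
      unfolding at_i_infinity_def using 1(1) tendsto_diff[OF tendsto_const 1(2), of 1]
      by (simp add: filterlim_inf filterlim_filtercomap_iff o_def)
    then show ?thesis by (subst filterlim_cong[OF refl refl ev])
  qed
  show "smooth_curve_with_ends (rho1 ` (real_locus \<inter> wedge)) (nhds 0) (nhds 1)"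
    by (rule smooth_curve_with_ends_zeta[OF m1 o(2) T2 s2 b2
          filterlim_compose[OF r1 l2(1)] filterlim_compose[OF r1' l2(2)]])
  show "smooth_curve_with_ends (rho2 ` (real_locus \<inter> wedge)) (nhds 1) (at_i_infinity (3 / 4))"
    by (rule smooth_curve_with_ends_zeta[OF m2 o(2) T2 s2 b2
          filterlim_compose[OF r2 l2(1)] filterlim_compose[OF r2' l2(2)]])
  have "smooth_curve_with_ends ((\<lambda>z. z) ` (real_locus \<inter> wedge)) (nhds 0) (at_i_infinity (1 / 4))"
    by (rule smooth_curve_with_ends_zeta[OF _ _ _ o(1) T1 s1 b1
          filterlim_compose[OF zeta_curve_at_0 l1(1)] filterlim_compose[OF zeta_curve_at_top l1(2)]]) auto
  then show "smooth_curve_with_ends (real_locus \<inter> wedge) (nhds 0) (at_i_infinity (1 / 4))" by simp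
qed

section \<open>The critical points in F0\<close>

lemma F0_iff: "\<tau> \<in> F0 \<longleftrightarrow> Im \<tau> > 0 \<and> 0 \<le> Re \<tau> \<and> Re \<tau> \<le> 1 \<and> Re \<tau> \<le> norm \<tau> ^ 2"
proof -
  have "norm (\<tau> - 1 / 2) ^ 2 = norm \<tau> ^ 2 - Re \<tau> + (1 / 2) ^ 2"
    unfolding cmod_power2 by (simp add: power2_eq_square algebra_simps)
  then have "norm (\<tau> - 1 / 2) \<ge> 1 / 2 \<longleftrightarrow> Re \<tau> \<le> norm \<tau> ^ 2"
    using power_mono_iff[of "1 / 2" "norm (\<tau> - 1 / 2)" 2] by auto
  then show ?thesis by (auto simp: F0_def upper_half_plane_def)
qed

lemma rho2_sel:
  assumes "Im \<tau> > 0"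
  shows "Re (rho2 \<tau>) = 1 - Re \<tau> / norm \<tau> ^ 2" "Im (rho2 \<tau>) = Im \<tau> / norm \<tau> ^ 2"
    "norm (rho2 \<tau>) ^ 2 = (norm \<tau> ^ 2 - 2 * Re \<tau> + 1) / norm \<tau> ^ 2"
proof -
  show "Re (rho2 \<tau>) = 1 - Re \<tau> / norm \<tau> ^ 2" "Im (rho2 \<tau>) = Im \<tau> / norm \<tau> ^ 2"
    by (simp_all add: rho2_def Re_divide Im_divide cmod_power2)
  have "\<tau> \<noteq> 0" using assms by auto
  then have "rho2 \<tau> = (\<tau> - 1) / \<tau>" by (simp add: rho2_def field_simps)
  then have "norm (rho2 \<tau>) ^ 2 = norm (\<tau> - 1) ^ 2 / norm \<tau> ^ 2" by (simp add: norm_divide power_divide)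
  also have "norm (\<tau> - 1) ^ 2 = norm \<tau> ^ 2 - 2 * Re \<tau> + 1"
    unfolding cmod_power2 by (simp add: power2_eq_square algebra_simps)
  finally show "norm (rho2 \<tau>) ^ 2 = (norm \<tau> ^ 2 - 2 * Re \<tau> + 1) / norm \<tau> ^ 2" .
qed

lemma rho1_sel:
  fixes \<tau> defines "D \<equiv> norm \<tau> ^ 2 - 2 * Re \<tau> + 1"
  assumes "Im \<tau> > 0"
  shows "D > 0" "Re (rho1 \<tau>) = (1 - Re \<tau>) / D" "Im (rho1 \<tau>) = Im \<tau> / D" "norm (rho1 \<tau>) ^ 2 = 1 / D"
proof -
  have D: "D = norm (1 - \<tau>) ^ 2"
    unfolding D_def cmod_power2 by (simp add: power2_eq_square algebra_simps)
  have "1 - \<tau> \<noteq> 0" using assms by (auto simp: complex_eq_iff)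
  then show "D > 0" by (simp add: D)
  show "Re (rho1 \<tau>) = (1 - Re \<tau>) / D" "Im (rho1 \<tau>) = Im \<tau> / D" "norm (rho1 \<tau>) ^ 2 = 1 / D"
    by (simp_all add: rho1_def Re_divide Im_divide D cmod_power2 norm_divide power_divide)
qed

text \<open>As \<open>rho1\<close> inverts \<open>rho2\<close>, these inequalities describe the
  image of \<open>wedge\<close> under \<open>rho1\<close>; \<open>rho1_wedge_iff\<close> describes
  that under \<open>rho2\<close>.\<close>

lemma rho2_wedge_iff:
  assumes "Im \<tau> > 0"
  shows "rho2 \<tau> \<in> wedge \<longleftrightarrow> Re \<tau> \<le> norm \<tau> ^ 2 \<and> norm \<tau> ^ 2 \<le> 2 * Re \<tau> \<and> norm \<tau> ^ 2 \<le> 1"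
    and "rho2 \<tau> \<in> open_wedge \<longleftrightarrow> Re \<tau> < norm \<tau> ^ 2 \<and> norm \<tau> ^ 2 < 2 * Re \<tau> \<and> norm \<tau> ^ 2 < 1"
proof -
  define n where "n = norm \<tau> ^ 2"
  have n: "n > 0" using assms by (auto simp: n_def)
  show "rho2 \<tau> \<in> wedge \<longleftrightarrow> Re \<tau> \<le> norm \<tau> ^ 2 \<and> norm \<tau> ^ 2 \<le> 2 * Re \<tau> \<and> norm \<tau> ^ 2 \<le> 1"
    and "rho2 \<tau> \<in> open_wedge \<longleftrightarrow> Re \<tau> < norm \<tau> ^ 2 \<and> norm \<tau> ^ 2 < 2 * Re \<tau> \<and> norm \<tau> ^ 2 < 1"
    unfolding wedge_def open_wedge_def mem_Collect_eq norm_minus_1_iff rho2_sel[OF assms] n_def[symmetric]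
    using n assms by (auto simp: field_simps)
qed

lemma rho1_wedge_iff:
  assumes "Im \<tau> > 0"
  shows "rho1 \<tau> \<in> wedge \<longleftrightarrow> Re \<tau> \<le> 1 \<and> 1 \<le> norm \<tau> ^ 2 \<and> 1 / 2 \<le> Re \<tau>"
    and "rho1 \<tau> \<in> open_wedge \<longleftrightarrow> Re \<tau> < 1 \<and> 1 < norm \<tau> ^ 2 \<and> 1 / 2 < Re \<tau>"
proof -
  define n D where "n = norm \<tau> ^ 2" and "D = norm \<tau> ^ 2 - 2 * Re \<tau> + 1"
  note s = rho1_sel[OF assms, folded D_def]
  have nD: "norm \<tau> ^ 2 = D + 2 * Re \<tau> - 1" by (simp add: D_def)
  show "rho1 \<tau> \<in> wedge \<longleftrightarrow> Re \<tau> \<le> 1 \<and> 1 \<le> norm \<tau> ^ 2 \<and> 1 / 2 \<le> Re \<tau>"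
    and "rho1 \<tau> \<in> open_wedge \<longleftrightarrow> Re \<tau> < 1 \<and> 1 < norm \<tau> ^ 2 \<and> 1 / 2 < Re \<tau>"
    unfolding wedge_def open_wedge_def mem_Collect_eq norm_minus_1_iff s nD
    using s(1) assms by (auto simp: field_simps)
qed

lemma F0_decomposition: "F0 = wedge \<union> rho1 ` wedge \<union> rho2 ` wedge"
proof (intro equalityI subsetI)
  fix \<tau> assume "\<tau> \<in> F0"
  then have \<tau>: "Im \<tau> > 0" "0 \<le> Re \<tau>" "Re \<tau> \<le> 1" "Re \<tau> \<le> norm \<tau> ^ 2" by (auto simp: F0_iff)
  have r: "rho1 (rho2 \<tau>) = \<tau>" "rho2 (rho1 \<tau>) = \<tau>" using rho_inverse \<tau>(1) by auto
  \<comment> \<open>The geodesics Re = 1/2, |\<tau> - 1| = 1 and |\<tau>| = 1 through the fixed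
    point exp(pi \<i> / 3) separate the three pieces.\<close>
  consider "Re \<tau> \<le> 1 / 2" "2 * Re \<tau> \<le> norm \<tau> ^ 2" | "1 / 2 \<le> Re \<tau>" "1 \<le> norm \<tau> ^ 2"
    | "norm \<tau> ^ 2 \<le> 2 * Re \<tau>" "norm \<tau> ^ 2 \<le> 1" by linarith
  then show "\<tau> \<in> wedge \<union> rho1 ` wedge \<union> rho2 ` wedge"
  proof cases
    case 1
    then show ?thesis using \<tau> by (auto simp: wedge_def norm_minus_1_iff)
  next
    case 2
    then have "rho1 \<tau> \<in> wedge" using rho1_wedge_iff(1)[OF \<tau>(1)] \<tau> by simp
    then show ?thesis using r(2) by (metis UnI2 image_eqI)
  next
    case 3
    then have "rho2 \<tau> \<in> wedge" using rho2_wedge_iff(1)[OF \<tau>(1)] \<tau> by simp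
    then show ?thesis using r(1) by (metis UnI1 UnI2 image_eqI)
  qed
next
  fix \<tau> assume "\<tau> \<in> wedge \<union> rho1 ` wedge \<union> rho2 ` wedge"
  then consider "\<tau> \<in> wedge" | w where "w \<in> wedge" "\<tau> = rho1 w" | w where "w \<in> wedge" "\<tau> = rho2 w" by auto
  then show "\<tau> \<in> F0"
  proof cases
    case 1
    then show ?thesis by (auto simp: wedge_def norm_minus_1_iff F0_iff)
  next
    case (2 w)
    then have w: "Im w > 0" "0 \<le> Re w" "Re w \<le> 1 / 2" "2 * Re w \<le> norm w ^ 2"
      by (auto simp: wedge_def norm_minus_1_iff)
    define D where "D = norm w ^ 2 - 2 * Re w + 1"
    note r = rho1_sel[OF w(1), folded D_def]
    have "1 - Re w \<le> D" using w by (simp add: D_def)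
    then show ?thesis
      unfolding F0_iff 2(2) r using r(1) w by (simp add: divide_right_mono)
  next
    case (3 w)
    then have w: "Im w > 0" "0 \<le> Re w" "Re w \<le> 1 / 2" "2 * Re w \<le> norm w ^ 2"
      by (auto simp: wedge_def norm_minus_1_iff)
    then have "norm w ^ 2 > 0" by auto
    then show ?thesis
      unfolding F0_iff 3(2) rho2_sel[OF w(1)] using w by (simp add: field_simps)
  qed
qed

lemma rho_moebius:
  assumes "Im \<tau> > 0"
  shows "(of_int 0 * \<tau> + of_int 1) / (of_int (-1) * \<tau> + of_int 1) = rho1 \<tau>"
    "(of_int 1 * \<tau> + of_int (-1)) / (of_int 1 * \<tau> + of_int 0) = rho2 \<tau>"
proof -
  have "\<tau> \<noteq> 0" using assms by auto
  then show "(of_int 1 * \<tau> + of_int (-1)) / (of_int 1 * \<tau> + of_int 0) = rho2 \<tau>"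
    by (simp add: rho2_def diff_divide_distrib)
  show "(of_int 0 * \<tau> + of_int 1) / (of_int (-1) * \<tau> + of_int 1) = rho1 \<tau>" by (simp add: rho1_def)
qed

lemma real_locus_rho:
  assumes "Im \<tau> > 0"
  shows "rho1 \<tau> \<in> real_locus \<longleftrightarrow> \<tau> \<in> real_locus" "rho2 \<tau> \<in> real_locus \<longleftrightarrow> \<tau> \<in> real_locus"
  using real_locus_moebius[of 0 1 1 "-1" \<tau>] real_locus_moebius[of 1 0 "-1" 1 \<tau>] assms
  by (simp_all only: rho_moebius[OF assms])

lemma real_locus_F0:
  "real_locus \<inter> F0 = rho1 ` (real_locus \<inter> wedge) \<union> (real_locus \<inter> wedge) \<union> rho2 ` (real_locus \<inter> wedge)"
proof -
  have "Im w > 0" if "w \<in> wedge" for w using that by (simp add: wedge_def)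
  then show ?thesis unfolding F0_decomposition using real_locus_rho by blast
qed

text \<open>The three pieces meet only along their boundaries, which the locus avoids.\<close>

lemma wedge_images_disjoint:
  "(real_locus \<inter> wedge) \<inter> rho1 ` (real_locus \<inter> wedge) = {}"
  "(real_locus \<inter> wedge) \<inter> rho2 ` (real_locus \<inter> wedge) = {}"
  "rho1 ` (real_locus \<inter> wedge) \<inter> rho2 ` (real_locus \<inter> wedge) = {}"
proof -
  have w: "Im w > 0" "w \<in> open_wedge" "Im (rho1 w) > 0" "Im (rho2 w) > 0" if "w \<in> real_locus \<inter> wedge" for w
    using that real_locus_wedge(1)[of w] real_locus_rho[of w] by (auto simp: wedge_def real_locus_def)
  have 0: "Re w < 1 / 2" "2 * Re w < norm w ^ 2" if "w \<in> real_locus \<inter> wedge" for w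
    using w(2)[OF that] by (auto simp: open_wedge_def norm_minus_1_iff)
  have 1: "norm (rho1 w) ^ 2 < 2 * Re (rho1 w)" "norm (rho1 w) ^ 2 < 1" if "w \<in> real_locus \<inter> wedge" for w
    using rho2_wedge_iff(2)[OF w(3)[OF that]] w(1,2)[OF that] rho_inverse(2)[of w] by auto
  have 2: "Re (rho2 w) > 1 / 2" "norm (rho2 w) ^ 2 > 1" if "w \<in> real_locus \<inter> wedge" for w
    using rho1_wedge_iff(2)[OF w(4)[OF that]] w(1,2)[OF that] rho_inverse(1)[of w] by auto
  show "(real_locus \<inter> wedge) \<inter> rho1 ` (real_locus \<inter> wedge) = {}" using 0 1 by fastforce
  show "(real_locus \<inter> wedge) \<inter> rho2 ` (real_locus \<inter> wedge) = {}" using 0 2 by fastforce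
  show "rho1 ` (real_locus \<inter> wedge) \<inter> rho2 ` (real_locus \<inter> wedge) = {}"
  proof -
    have "rho1 a \<noteq> rho2 b" if "a \<in> real_locus \<inter> wedge" "b \<in> real_locus \<inter> wedge" for a b
      using 1(2)[OF that(1)] 2(2)[OF that(2)] by auto
    then show ?thesis by blast
  qed
qed

text \<open>Homogeneous form of h(\<tau>) = -d / c, where c = 0 means h(\<tau>) = \<infinity>. The
  pair (c, d) is the lower row of a matrix in \<Gamma>0(2) that carries \<tau> back to a critical
  point.\<close>

lemma D0_iff:
  "\<tau> \<in> D0 \<longleftrightarrow> \<tau> \<in> F0 \<and> (\<exists>c d :: int. coprime c d \<and> even c \<and> of_int c * eqN \<tau> + of_int d * nE6' \<tau> = 0)"
proof
  assume "\<tau> \<in> D0"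
  then obtain A \<omega> where A: "\<tau> = moebius_action A \<omega>" "A \<in> Gamma0 2" "\<omega> \<in> E6_critical_points" "\<tau> \<in> F0"
    by (auto simp: D0_def)
  define a b c d where "a = A $ 1 $ 1" and "b = A $ 1 $ 2" and "c = A $ 2 $ 1" and "d = A $ 2 $ 2"
  have det: "a * d - b * c = 1" and ev: "even c"
    using A(2) by (auto simp: Gamma0_def det_2 a_def b_def c_def d_def)
  have \<omega>: "Im \<omega> > 0" "nE6' \<omega> = 0"
    using A(3) E6_critical_iff by (auto simp: E6_critical_points_def upper_half_plane_def)
  have \<tau>: "\<tau> = (of_int a * \<omega> + of_int b) / (of_int c * \<omega> + of_int d)"
    using A(1) by (simp add: moebius_action_def moebius_def a_def b_def c_def d_def)
  have "of_int (- c) * eqN \<tau> + of_int a * nE6' \<tau> = 0"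
    unfolding \<tau> nE6_moebius[OF det \<omega>(1)] \<omega>(2) by simp
  moreover have "coprime (- c) a"
  proof (rule coprimeI)
    fix k assume "k dvd - c" "k dvd a"
    then have "k dvd a * d - b * c" by simp
    then show "is_unit k" using det by simp
  qed
  ultimately show "\<tau> \<in> F0 \<and> (\<exists>c d :: int. coprime c d \<and> even c \<and> of_int c * eqN \<tau> + of_int d * nE6' \<tau> = 0)"
    using A(4) ev by (meson dvd_minus_iff)
next
  assume R: "\<tau> \<in> F0 \<and> (\<exists>c d :: int. coprime c d \<and> even c \<and> of_int c * eqN \<tau> + of_int d * nE6' \<tau> = 0)"
  then obtain c d :: int where cd: "coprime c d" "even c" "of_int c * eqN \<tau> + of_int d * nE6' \<tau> = 0" by blast
  have i: "Im \<tau> > 0" using R by (simp add: F0_iff)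
  \<comment> \<open>Bezout completes (c, d) to a matrix of determinant 1; it sends \<tau> to the
    critical point \<omega>, and \<open>A\<close> is its inverse.\<close>
  obtain x y where "x * c + y * d = 1" using cd(1) bezout_int[of c d] by auto
  then have det: "y * d - (- x) * c = 1" by (simp add: algebra_simps)
  define \<omega> where "\<omega> = (of_int y * \<tau> + of_int (- x)) / (of_int c * \<tau> + of_int d)"
  have j: "of_int c * \<tau> + of_int d \<noteq> 0" by (rule moebius_denominator_nonzero[OF det i])
  have "nE6' \<omega> = 0" unfolding \<omega>_def nE6_moebius[OF det i] cd(3) by simp
  moreover have i\<omega>: "Im \<omega> > 0" unfolding \<omega>_def Im_moebius[OF det] using i j by simp
  ultimately have crit: "\<omega> \<in> E6_critical_points"
    using E6_critical_iff by (simp add: E6_critical_points_def upper_half_plane_def)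
  define A :: "int ^ 2 ^ 2" where "A = vector [vector [d, x], vector [- c, y]]"
  have A: "A $ 1 $ 1 = d" "A $ 1 $ 2 = x" "A $ 2 $ 1 = - c" "A $ 2 $ 2 = y" by (simp_all add: A_def)
  have G: "A \<in> Gamma0 2" unfolding Gamma0_def using det cd(2) by (simp add: det_2 A algebra_simps)
  have det': "of_int y * of_int d + of_int x * of_int c = (1::complex)"
    using det by (metis minus_mult_left diff_minus_eq_add of_int_1 of_int_add of_int_mult)
  have w: "\<omega> * (of_int c * \<tau> + of_int d) = of_int y * \<tau> - of_int x" using j by (simp add: \<omega>_def)
  have "\<tau> * (- of_int c * \<omega> + of_int y) * (of_int c * \<tau> + of_int d) = (of_int d * \<omega> + of_int x) * (of_int c * \<tau> + of_int d)"
  proof -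
    have "\<tau> * (- of_int c * \<omega> + of_int y) * (of_int c * \<tau> + of_int d) = \<tau> * (- of_int c * (\<omega> * (of_int c * \<tau> + of_int d)) + of_int y * (of_int c * \<tau> + of_int d))"
      by (simp add: algebra_simps)
    also have "\<dots> = \<tau> * (of_int y * of_int d + of_int x * of_int c)" unfolding w by (simp add: algebra_simps)
    also have "\<dots> = of_int d * (\<omega> * (of_int c * \<tau> + of_int d)) + of_int x * (of_int c * \<tau> + of_int d)"
      unfolding w by (simp add: algebra_simps)
    finally show ?thesis by (simp add: algebra_simps)
  qed
  then have e: "\<tau> * (- of_int c * \<omega> + of_int y) = of_int d * \<omega> + of_int x" using j by simp
  have "of_int (- c) * \<omega> + of_int y \<noteq> (0::complex)"
    using det i\<omega> by (intro moebius_denominator_nonzero[of d y x "- c"]) (auto simp: algebra_simps)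
  then have "\<tau> = moebius_action A \<omega>"
    using e by (simp add: moebius_action_def moebius_def A field_simps)
  then show "\<tau> \<in> D0" unfolding D0_def using R G crit by blast
qed

lemma D0_subset_real_locus: "D0 \<subseteq> real_locus"
proof
  fix \<tau> assume "\<tau> \<in> D0"
  then obtain c d :: int where cd: "coprime c d" "of_int c * eqN \<tau> + of_int d * nE6' \<tau> = 0" and i: "Im \<tau> > 0"
    by (auto simp: D0_iff F0_iff)
  have "Im (eqN \<tau> * cnj (nE6' \<tau>)) = 0"
  proof (cases "c = 0")
    case True
    then have "d \<noteq> 0" using cd(1) by auto
    then show ?thesis using cd(2) True by simp
  next
    case False
    then have "eqN \<tau> = of_real (- (of_int d / of_int c)) * nE6' \<tau>"
      using cd(2) by (simp add: field_simps eq_neg_iff_add_eq_0)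
    then have "eqN \<tau> * cnj (nE6' \<tau>) = of_real (- (of_int d / of_int c)) * (nE6' \<tau> * cnj (nE6' \<tau>))" by simp
    also have "\<dots> = of_real (- (of_int d / of_int c) * norm (nE6' \<tau>) ^ 2)"
      by (simp only: complex_norm_square of_real_mult)
    finally show ?thesis by (simp only: Im_complex_of_real)
  qed
  then show "\<tau> \<in> real_locus" using i by (simp add: real_locus_def)
qed

text \<open>Fixing the numerator modulo 6 fixes its parity and its coprimality to a base 2 or 3.
  Consecutive numerators differ by 6, hence the choice of n with B^n (s2 - s1) > 6.\<close>

lemma fractions_dense:
  fixes B :: nat and r :: int
  assumes "B \<ge> 2" "0 < s1" "s1 < s2"
  obtains n :: nat and k :: int where "n \<ge> 1" "s1 < of_int (6 * k + r) / real B ^ n" "of_int (6 * k + r) / real B ^ n < s2"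
proof -
  have "real B > 1" using assms by simp
  from real_arch_pow[OF this] obtain n where n: "max 1 (6 / (s2 - s1)) < real B ^ n" by blast
  have n1: "n \<ge> 1" using n by (cases n) auto
  define X where "X = real B ^ n"
  have X: "X > 0" "6 < X * s2 - X * s1" using n assms by (auto simp: X_def field_simps)
  define k where "k = \<lfloor>(X * s1 - of_int r) / 6\<rfloor> + 1"
  have "of_int k > (X * s1 - of_int r) / 6" "of_int k \<le> (X * s1 - of_int r) / 6 + 1"
    unfolding k_def by linarith+
  then have "X * s1 < of_int (6 * k + r)" "of_int (6 * k + r) < X * s2" using X(2) by (auto simp: field_simps)
  then show ?thesis using X(1) n1 by (intro that[of n k]) (auto simp: X_def[symmetric] field_simps)
qed

lemma closure_D0_image:
  assumes m: "\<And>z. Im z > 0 \<Longrightarrow> isCont m z"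
    and dense: "\<And>s1 s2. 0 < s1 \<Longrightarrow> s1 < s2 \<Longrightarrow> \<exists>s. s1 < s \<and> s < s2 \<and> m (zeta_curve s) \<in> D0"
  shows "m ` (real_locus \<inter> wedge) \<subseteq> closure D0"
proof
  fix z assume "z \<in> m ` (real_locus \<inter> wedge)"
  then obtain s0 where s0: "s0 > 0" "z = m (zeta_curve s0)" unfolding real_locus_wedge_eq by auto
  have zH: "Im (zeta_curve s0) > 0" using zeta_curve(2)[OF s0(1)] by (simp add: wedge_def)
  obtain e \<phi> where e: "e > 0" "\<phi> holomorphic_on ball (of_real s0) e"
      "\<And>s. \<bar>s - s0\<bar> < e \<Longrightarrow> s > 0 \<and> zeta_curve s = \<phi> (of_real s)"
    using zeta_curve_holomorphic_extension[OF s0(1)] by metis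
  have "isCont zeta_curve s0"
    using has_vector_derivative_holomorphic_restriction[OF e(2), of zeta_curve s0] e
    by (auto intro: has_vector_derivative_continuous)
  then have c: "isCont (\<lambda>s. m (zeta_curve s)) s0" by (rule isCont_o2) (rule m[OF zH])
  show "z \<in> closure D0"
    unfolding closure_approachable
  proof (intro allI impI)
    fix \<epsilon> :: real assume "\<epsilon> > 0"
    then obtain d where d: "d > 0" "\<And>s. dist s s0 < d \<Longrightarrow> dist (m (zeta_curve s)) (m (zeta_curve s0)) < \<epsilon>"
      using c unfolding continuous_at_eps_delta by blast
    obtain s where s: "s0 < s" "s < s0 + d" "m (zeta_curve s) \<in> D0" using dense[of s0 "s0 + d"] s0 d(1) by auto
    then show "\<exists>y\<in>D0. dist y z < \<epsilon>"
      using d(2)[of s] s0 by (intro bexI[of _ "m (zeta_curve s)"]) (auto simp: dist_real_def)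
  qed
qed

lemma eqN_zeta:
  assumes "s > 0"
  shows "eqN (zeta_curve s) = of_real s * nE6' (zeta_curve s)"
proof -
  note z = zeta_curve[OF assms]
  then show ?thesis using real_locus_wedge(2)[OF z(1,2)] by (simp add: eqh_def field_simps)
qed

text \<open>At the parameter s = p / q in lowest terms, h takes the values p / q, q / (q - p) and (p
  - q) / p on the arc and its images under \<open>rho1\<close> and \<open>rho2\<close>. The
  denominator is even if q is even, if p and q are both odd, and if p is even, respectively; each
  condition holds for a dense set of s.\<close>

lemma real_locus_F0_subset_closure: "real_locus \<inter> F0 \<subseteq> closure D0"
proof -
  have zH: "Im (zeta_curve s) > 0" "zeta_curve s \<in> F0" "rho1 (zeta_curve s) \<in> F0" "rho2 (zeta_curve s) \<in> F0" if "s > 0" for s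
    using zeta_curve(2)[OF that] by (auto simp: wedge_def F0_decomposition)
  have c6: "coprime (6 * k + 1) 2" "coprime (6 * k + 1) 3" "coprime (6 * k + 2) 3" for k :: int
  proof -
    have cop: "coprime a b" if "u * a + v * b = 1" for a b u v :: int
      by (rule coprimeI) (metis that dvd_add dvd_mult)
    show "coprime (6 * k + 1) 2" by (rule cop[of 1 _ "- 3 * k"]) simp
    show "coprime (6 * k + 1) 3" by (rule cop[of 1 _ "- 2 * k"]) simp
    show "coprime (6 * k + 2) 3" by (rule cop[of "- 1" _ "2 * k + 1"]) simp
  qed
  have 0: "(\<lambda>z. z) ` (real_locus \<inter> wedge) \<subseteq> closure D0"
  proof (rule closure_D0_image)
    fix s1 s2 :: real assume "0 < s1" "s1 < s2"
    then obtain n k where nk: "n \<ge> 1" "s1 < of_int (6 * k + 1) / real 2 ^ n" "of_int (6 * k + 1) / real 2 ^ n < s2"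
      using fractions_dense[of 2 s1 s2 1] by auto
    define p q :: int where "p = 6 * k + 1" and "q = 2 ^ n"
    define s where "s = of_int p / (of_int q :: real)"
    have s: "s1 < s" "s < s2" "s > 0" "q \<noteq> 0" using nk \<open>0 < s1\<close> by (auto simp: s_def p_def q_def)
    have "coprime q (- p)" using c6(1)[of k] by (simp add: p_def q_def coprime_commute)
    moreover have "even q" using nk(1) by (simp add: q_def)
    moreover have "of_int q * eqN (zeta_curve s) + of_int (- p) * nE6' (zeta_curve s) = 0"
      unfolding eqN_zeta[OF s(3)] using s(4) by (simp add: s_def)
    ultimately have "zeta_curve s \<in> D0" using zH[OF s(3)] by (subst D0_iff) blast
    then show "\<exists>s. s1 < s \<and> s < s2 \<and> zeta_curve s \<in> D0" using s by blast
  qed auto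
  have 1: "rho1 ` (real_locus \<inter> wedge) \<subseteq> closure D0"
  proof (rule closure_D0_image)
    show "isCont rho1 z" if "Im z > 0" for z
      unfolding rho1_def using that by (auto intro!: continuous_intros simp: complex_eq_iff)
    fix s1 s2 :: real assume "0 < s1" "s1 < s2"
    then obtain n k where nk: "n \<ge> 1" "s1 < of_int (6 * k + 1) / real 3 ^ n" "of_int (6 * k + 1) / real 3 ^ n < s2"
      using fractions_dense[of 3 s1 s2 1] by auto
    define p q :: int where "p = 6 * k + 1" and "q = 3 ^ n"
    define s where "s = of_int p / (of_int q :: real)"
    have s: "s1 < s" "s < s2" "s > 0" "q \<noteq> 0" using nk \<open>0 < s1\<close> by (auto simp: s_def p_def q_def)
    have "coprime q p" using c6(2)[of k] by (simp add: p_def q_def coprime_commute)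
    then have "coprime (p - q) q" by (simp add: coprime_iff_gcd_eq_1 gcd_diff1 gcd.commute[of q])
    moreover have "even (p - q)" by (simp add: p_def q_def)
    moreover have "of_int (p - q) * eqN (rho1 (zeta_curve s)) + of_int q * nE6' (rho1 (zeta_curve s)) = 0"
    proof -
      have det: "0 * 1 - 1 * (- 1) = (1::int)" by simp
      note r = nE6_moebius[OF det zH(1)[OF s(3)], unfolded rho_moebius[OF zH(1)[OF s(3)]]]
      have E: "of_int q * eqN (zeta_curve s) = of_int p * nE6' (zeta_curve s)"
        unfolding eqN_zeta[OF s(3)] using s(4) by (simp add: s_def)
      define J where "J = (of_int (- 1) * zeta_curve s + of_int 1) ^ 7"
      have "of_int (p - q) * eqN (rho1 (zeta_curve s)) + of_int q * nE6' (rho1 (zeta_curve s))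
          = J * (of_int p * nE6' (zeta_curve s) - of_int q * eqN (zeta_curve s))"
        unfolding r J_def[symmetric] by (simp add: algebra_simps)
      then show ?thesis unfolding E by simp
    qed
    ultimately have "rho1 (zeta_curve s) \<in> D0" using zH[OF s(3)] by (subst D0_iff) blast
    then show "\<exists>s. s1 < s \<and> s < s2 \<and> rho1 (zeta_curve s) \<in> D0" using s by blast
  qed
  have 2: "rho2 ` (real_locus \<inter> wedge) \<subseteq> closure D0"
  proof (rule closure_D0_image)
    show "isCont rho2 z" if "Im z > 0" for z
      unfolding rho2_def using that by (auto intro!: continuous_intros simp: complex_eq_iff)
    fix s1 s2 :: real assume "0 < s1" "s1 < s2"
    then obtain n k where nk: "n \<ge> 1" "s1 < of_int (6 * k + 2) / real 3 ^ n" "of_int (6 * k + 2) / real 3 ^ n < s2"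
      using fractions_dense[of 3 s1 s2 2] by auto
    define p q :: int where "p = 6 * k + 2" and "q = 3 ^ n"
    define s where "s = of_int p / (of_int q :: real)"
    have s: "s1 < s" "s < s2" "s > 0" "q \<noteq> 0" using nk \<open>0 < s1\<close> by (auto simp: s_def p_def q_def)
    have "coprime p q" using c6(3)[of k] by (simp add: p_def q_def)
    then have "coprime p (q - p)" by (simp add: coprime_iff_gcd_eq_1 gcd_diff1 gcd.commute[of p])
    moreover have "even p" by (simp add: p_def)
    moreover have "of_int p * eqN (rho2 (zeta_curve s)) + of_int (q - p) * nE6' (rho2 (zeta_curve s)) = 0"
    proof -
      have det: "1 * 0 - (- 1) * 1 = (1::int)" by simp
      note r = nE6_moebius[OF det zH(1)[OF s(3)], unfolded rho_moebius[OF zH(1)[OF s(3)]]]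
      have E: "of_int q * eqN (zeta_curve s) = of_int p * nE6' (zeta_curve s)"
        unfolding eqN_zeta[OF s(3)] using s(4) by (simp add: s_def)
      define J where "J = (of_int 1 * zeta_curve s + of_int 0) ^ 7"
      have "of_int p * eqN (rho2 (zeta_curve s)) + of_int (q - p) * nE6' (rho2 (zeta_curve s))
          = J * (of_int q * eqN (zeta_curve s) - of_int p * nE6' (zeta_curve s))"
        unfolding r J_def[symmetric] by (simp add: algebra_simps)
      then show ?thesis unfolding E by simp
    qed
    ultimately have "rho2 (zeta_curve s) \<in> D0" using zH[OF s(3)] by (subst D0_iff) blast
    then show "\<exists>s. s1 < s \<and> s < s2 \<and> rho2 (zeta_curve s) \<in> D0" using s by blast
  qed
  show ?thesis unfolding real_locus_F0 using 0 1 2 by auto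
qed

section \<open>The closure of D0 in the extended half-plane\<close>

lemma closure_D0_subset_real_locus:
  assumes "z \<in> closure D0" "Im z > 0"
  shows "z \<in> real_locus"
proof -
  obtain x where x: "\<And>n. x n \<in> D0" "x \<longlonglongrightarrow> z" using assms(1) closure_sequential by blast
  have c: "isCont nE6' z" "isCont nE6 z"
    using has_field_derivative_nE6'[OF assms(2)] has_field_derivative_nE6[OF assms(2)] DERIV_isCont by blast+
  then have "isCont (\<lambda>\<tau>. Im (eqN \<tau> * cnj (nE6' \<tau>))) z"
    unfolding eqN_def
    by (intro continuous_Im continuous_cnj continuous_mult continuous_add continuous_ident continuous_const)
  then have "(\<lambda>n. Im (eqN (x n) * cnj (nE6' (x n)))) \<longlonglongrightarrow> Im (eqN z * cnj (nE6' z))"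
    by (rule isCont_tendsto_compose) (rule x(2))
  moreover have "Im (eqN (x n) * cnj (nE6' (x n))) = 0" for n
    using D0_subset_real_locus x(1)[of n] by (auto simp: real_locus_def)
  ultimately have "Im (eqN z * cnj (nE6' z)) = 0" by (simp add: LIMSEQ_const_iff)
  then show ?thesis using assms(2) by (simp add: real_locus_def)
qed

text \<open>The finite points form an open subspace of the compactification with the topology of the
  closed half-plane, so closure at a finite point is the usual one.\<close>

lemma Some_in_closure_of_iff:
  assumes "S \<subseteq> {\<tau>. Im \<tau> \<ge> 0}"
  shows "Some z \<in> extended_half_plane closure_of (Some ` S) \<longleftrightarrow> Im z \<ge> 0 \<and> z \<in> closure S"
proof -
  define X where "X = top_of_set {\<tau>::complex. Im \<tau> \<ge> 0}"
  have tX: "topspace X = {\<tau>. Im \<tau> \<ge> 0}" by (simp add: X_def)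
  have e: "extended_half_plane = Alexandroff_compactification X" by (simp add: extended_half_plane_def X_def)
  have ts: "Some z \<in> topspace (Alexandroff_compactification X) \<longleftrightarrow> Im z \<ge> 0" by (auto simp: tX)
  show ?thesis
  proof
    assume cl: "Some z \<in> extended_half_plane closure_of (Some ` S)"
    then have z: "Im z \<ge> 0" using ts by (auto simp: e in_closure_of)
    from cl have meet: "\<forall>T. Some z \<in> T \<and> openin (Alexandroff_compactification X) T \<longrightarrow> (\<exists>y. y \<in> Some ` S \<and> y \<in> T)"
      unfolding e in_closure_of by (rule conjunct2)
    have "z \<in> closure S"
      unfolding closure_iff_nhds_not_empty
    proof (intro allI impI)
      fix A V assume V: "V \<subseteq> A" "open V" "z \<in> V"
      have "openin X ({\<tau>. Im \<tau> \<ge> 0} \<inter> V)" unfolding X_def using V(2) by (rule openin_open_Int)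
      then have "openin (Alexandroff_compactification X) (Some ` ({\<tau>. Im \<tau> \<ge> 0} \<inter> V))" by simp
      moreover have "Some z \<in> Some ` ({\<tau>. Im \<tau> \<ge> 0} \<inter> V)" using z V by simp
      ultimately have "\<exists>y. y \<in> Some ` S \<and> y \<in> Some ` ({\<tau>. Im \<tau> \<ge> 0} \<inter> V)"
        by (intro meet[rule_format] conjI)
      then show "S \<inter> A \<noteq> {}" using V(1) by auto
    qed
    then show "Im z \<ge> 0 \<and> z \<in> closure S" using z by simp
  next
    assume z: "Im z \<ge> 0 \<and> z \<in> closure S"
    show "Some z \<in> extended_half_plane closure_of (Some ` S)"
      unfolding e in_closure_of
    proof (intro conjI allI impI)
      show "Some z \<in> topspace (Alexandroff_compactification X)" using z ts by simp
      fix T assume T: "Some z \<in> T \<and> openin (Alexandroff_compactification X) T"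
      have "openin X {w \<in> topspace X. Some w \<in> T}"
        by (rule openin_continuous_map_preimage[OF continuous_map_Some]) (use T in simp)
      then obtain V where V: "open V" "{w \<in> topspace X. Some w \<in> T} = {\<tau>. Im \<tau> \<ge> 0} \<inter> V"
        unfolding X_def openin_open by auto
      have "z \<in> V" using V(2) T z tX by auto
      then obtain y where "y \<in> S" "y \<in> V" using V(1) z by (metis closure_iff_nhds_not_empty disjoint_iff order_refl)
      then have "Some y \<in> T" using V(2) assms by auto
      then show "\<exists>y. y \<in> Some ` S \<and> y \<in> T" using \<open>y \<in> S\<close> by blast
    qed
  qed
qed

text \<open>On the real axis the conditions |\<tau> - 1/2| >= 1/2 and 0 <= Re \<tau> <= 1 leave only
  0 and 1.\<close>

lemma closure_D0_subset:
  assumes "z \<in> closure D0"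
  shows "z \<in> F0 \<or> z = 0 \<or> z = 1"
proof -
  define K :: "complex set" where "K = {\<tau>. Im \<tau> \<ge> 0} \<inter> {\<tau>. Re \<tau> \<ge> 0} \<inter> {\<tau>. Re \<tau> \<le> 1} \<inter> - ball (1 / 2) (1 / 2)"
  have "closed K"
    unfolding K_def
    by (intro closed_Int closed_halfspace_Im_ge closed_halfspace_Re_ge closed_halfspace_Re_le closed_Compl open_ball)
  moreover have "D0 \<subseteq> K"
    by (auto simp: D0_def F0_def K_def upper_half_plane_def dist_norm norm_minus_commute)
  ultimately have z: "z \<in> K" using assms closure_minimal by blast
  show ?thesis
  proof (cases "Im z > 0")
    case True
    then show ?thesis using z by (auto simp: F0_def K_def upper_half_plane_def dist_norm norm_minus_commute)
  next
    case False
    then have i: "Im z = 0" using z by (simp add: K_def)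
    then have "z - 1 / 2 = of_real (Re z - 1 / 2)" by (simp add: complex_eq_iff)
    then have "norm (z - 1 / 2) = \<bar>Re z - 1 / 2\<bar>" by (metis norm_of_real)
    then have "Re z = 0 \<or> Re z = 1" using z by (auto simp: K_def dist_norm norm_minus_commute abs_if split: if_splits)
    then show ?thesis using i by (auto simp: complex_eq_iff)
  qed
qed

theorem theorem1p4:
  shows "\<exists>C1 C2 C3 :: complex set.
    C1 \<subseteq> F0 \<and> C2 \<subseteq> F0 \<and> C3 \<subseteq> F0 \<and>
    C1 \<inter> C2 = {} \<and> C1 \<inter> C3 = {} \<and> C2 \<inter> C3 = {} \<and>
    smooth_curve_with_ends C1 (nhds 0) (nhds 1) \<and>
    smooth_curve_with_ends C2 (nhds 0) (at_i_infinity (1 / 4)) \<and>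
    smooth_curve_with_ends C3 (nhds 1) (at_i_infinity (3 / 4)) \<and>
    D0 \<subseteq> C1 \<union> C2 \<union> C3 \<and>
    Some ` (C1 \<union> C2 \<union> C3) = (extended_half_plane closure_of (Some ` D0)) \<inter> Some ` F0 \<and>
    (extended_half_plane closure_of (Some ` D0)) \<inter> Some ` F0 =
      (extended_half_plane closure_of (Some ` D0)) - {Some 0, Some 1, None}"
proof -
  define C1 C2 C3 where "C1 = rho1 ` (real_locus \<inter> wedge)" and "C2 = real_locus \<inter> wedge"
    and "C3 = rho2 ` (real_locus \<inter> wedge)"
  have C: "C1 \<union> C2 \<union> C3 = real_locus \<inter> F0" unfolding C1_def C2_def C3_def real_locus_F0 ..
  define cl where "cl = extended_half_plane closure_of (Some ` D0)"
  have F0H: "Im z > 0" if "z \<in> F0" for z using that by (simp add: F0_iff)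
  have D0F0: "D0 \<subseteq> F0" by (auto simp: D0_def)
  have "D0 \<subseteq> {\<tau>. Im \<tau> \<ge> 0}" using D0F0 F0H by fastforce
  note cl_iff = Some_in_closure_of_iff[OF this, folded cl_def]
  have D0: "D0 \<subseteq> C1 \<union> C2 \<union> C3" unfolding C using D0F0 D0_subset_real_locus by blast
  have "Some z \<in> cl \<longleftrightarrow> z \<in> real_locus" if "z \<in> F0" for z
    unfolding cl_iff using that F0H[OF that] real_locus_F0_subset_closure closure_D0_subset_real_locus
    by (auto intro: less_imp_le)
  then have 1: "Some ` (C1 \<union> C2 \<union> C3) = cl \<inter> Some ` F0" unfolding C by auto
  have 2: "cl \<inter> Some ` F0 = cl - {Some 0, Some 1, None}"
  proof -
    have "x \<in> Some ` F0" if x: "x \<in> cl - {Some 0, Some 1, None}" for x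
    proof -
      obtain z where "x = Some z" using x by (cases x) auto
      then show ?thesis using x closure_D0_subset[of z] cl_iff[of z] by auto
    qed
    moreover have "0 \<notin> F0" "1 \<notin> F0" using F0H by fastforce+
    ultimately show ?thesis by auto
  qed
  have sub: "C1 \<subseteq> F0" "C2 \<subseteq> F0" "C3 \<subseteq> F0" using C by auto
  have disj: "C1 \<inter> C2 = {}" "C1 \<inter> C3 = {}" "C2 \<inter> C3 = {}"
    using wedge_images_disjoint unfolding C1_def C2_def C3_def by blast+
  note curves = smooth_curve_rho1[folded C1_def] smooth_curve_wedge[folded C2_def] smooth_curve_rho2[folded C3_def]
  show ?thesis
    unfolding cl_def[symmetric]
    by (rule exI[of _ C1], rule exI[of _ C2], rule exI[of _ C3]) (intro conjI sub disj curves D0 1 2)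
qed

end
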